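(* Let the flux function $\mathfrak{f}$ satisfy, for every $\omega\in\Omega$, the assumptions (B-1), (B-2) and either (B-3) or (B-3'), together with the assumptions (B-4), (B-5), (B-6), all listed in the context, and let the initial condition satisfy $u_0\in L^p(\Omega,L^1(\mathbb{R}))$. For $\omega\in\Omega$ let $u(\omega,\cdot,\cdot)$ be the unique pathwise adapted entropy solution of $$u_t+\mathfrak{f}(\omega,x,u)_x=0 \ \text{ in } \Omega\times\mathbb{R}\times\mathbb{T},\qquad u(\omega,x,0)=u_0(\omega,x)\ \text{ in } \Omega\times\mathbb{R}.$$ Then the mapping $u:\Omega\to L^\infty(\mathbb{R}\times\mathbb{T})\cap C^0(\mathbb{T};L^1_{\mathrm{loc}}(\mathbb{R}))$, $\omega\mapsto u(\omega,\cdot,\cdot)$, is strongly measurable, i.e. it is measurable and its image $u(\Omega)\subset L^\infty(\mathbb{R}\times\mathbb{T})\cap C^0(\mathbb{T};L^1_{\mathrm{loc}}(\mathbb{R}))$ is separable.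
   Context: Setting: $(\Omega,\mathcal{A},\mathbb{P})$ is a complete probability space, $\mathbb{T}=[0,T]$ with $T>0$, $\mathfrak{f}:\Omega\times\mathbb{R}\times\mathbb{R}\to\mathbb{R}$ is the stochastic flux function. Throughout, the initial condition satisfies $u_0\in L^p(\Omega;L^\infty(\mathbb{R}))$ ($p\ge1$ fixed), with $u_0(\omega,\cdot)\in L^\infty(\mathbb{R})$. The space $L^\infty(\mathbb{R}\times\mathbb{T})\cap C^0(\mathbb{T};L^1_{\mathrm{loc}}(\mathbb{R}))$ is regarded as a separable space, with the topology of $C^0(\mathbb{T};L^1_{\mathrm{loc}}(\mathbb{R}))$ (uniform in time convergence in $L^1$ on compact sets) and its Borel $\sigma$-algebra. Assumptions on the flux, for every $\omega\in\Omega$: (B-1) $\mathfrak{f}(\omega,\cdot,\cdot)$ is continuous at all points of $(\mathbb{R}\setminus\mathcal{N}(\omega))\times\mathbb{R}$, where $\mathcal{N}(\omega)\subset\mathbb{R}$ is a closed set of measure zero containing the discontinuity points of $\mathfrak{f}(\omega,\cdot,\rho)$. (B-2) There exist $g_-(\omega,\cdot),g_+(\omega,\cdot)\in C^0(\mathbb{R})$ such that $g_-(\omega,\rho)\le|\mathfrak{f}(\omega,x,\rho)|\le g_+(\omega,\rho)$ for all $x,\rho\in\mathbb{R}$, where $g_-(\omega,\cdot)\ge0$ is a (not necessarily strictly) decreasing then increasing function with $|g_-(\omega,\pm\infty)|=+\infty$. (B-3) There exist a function $u_M:\Omega\times\mathbb{R}\to\mathbb{R}$ and a constant $M_0\in\mathbb{R}$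 such that for $x\in\mathbb{R}\setminus\mathcal{N}(\omega)$ the function $\mathfrak{f}(\omega,x,\cdot)$ is locally Lipschitz and one-to-one (bijective) from each of $(-\infty,u_M(\omega,x)]$ and $[u_M(\omega,x),+\infty)$ to $[M_0,+\infty)$ (or, alternatively, to $(-\infty,M_0]$), with $\mathfrak{f}(\omega,x,u_M(\omega,x))=M_0$ and, for any bounded interval $I\subset\mathbb{R}$, a common Lipschitz constant $L_I$ for all $x\in\mathbb{R}\setminus\mathcal{N}(\omega)$ and all $u\in I$. (B-3') For $x\in\mathbb{R}\setminus\mathcal{N}(\omega)$ the function $\mathfrak{f}(\omega,x,\cdot)$ is locally Lipschitz and one-to-one (bijective) from $\mathbb{R}$ to $\mathbb{R}$, with, for any bounded interval $I\subset\mathbb{R}$, a common Lipschitz constant $L_I$ for all $x\in\mathbb{R}\setminus\mathcal{N}(\omega)$ and all $u\in I$. Let the admissible range be $[M_0,\infty)$ (or $(-\infty,M_0]$, in the alternative case) under (B-3), and $\mathbb{R}$ under (B-3'). Let $\mathfrak{f}^{-1}_\pm(\omega,x,\cdot)$ denote the inverse function(s) of $\mathfrak{f}(\omega,x,\cdot)$ on the admissible range: under (B-3), $\mathfrak{f}^{-1}_+$ is the inverse of the branch on $[u_M(\omega,x),\infty)$ and $\mathfrak{f}^{-1}_-$ the inverse of the branch on $(-\infty,u_M(\omega,x)]$; under (B-3') both are the inverse on $\mathbb{R}$. (B-4) For almost every $x\in\mathbb{R}$, the mapping $\omega\mapsto\mathfrak{f}(\omega,x,\rho)$ is measurable. (B-5)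 For almost every $x\in\mathbb{R}$, the mapping $\omega\mapsto\mathfrak{f}^{-1}_\pm(\omega,x,\rho)$ is measurable. (B-6) For fixed $\omega\in\Omega$ and $\rho$, one has $\mathfrak{f}^{-1}_\pm(\omega,\cdot,\rho)\in L^\infty(\mathbb{R})$. Steady state solutions: for admissible $\alpha$, $m^\pm_\alpha$ denote the solutions of $\mathfrak{f}(\omega,x,m^\pm_\alpha(\omega,x))=\alpha$ for a.e. $x\in\mathbb{R}$. Under (B-3) there are two of them, with $m^+_\alpha(\omega,x)\in[u_M(\omega,x),\infty)$ and $m^-_\alpha(\omega,x)\in(-\infty,u_M(\omega,x)]$; under (B-3') they coincide. Pathwise adapted entropy solution: for fixed $\omega\in\Omega$, a function $u(\omega,\cdot,\cdot)\in L^\infty(\mathbb{T}\times\mathbb{R})\cap C^0(\mathbb{T};L^1_{\mathrm{loc}}(\mathbb{R}))$ is an adapted entropy solution on $\mathbb{R}\times\mathbb{T}$ if for each admissible $\alpha$, each of the corresponding steady states $m^\pm_\alpha$, and every test function $\phi\in C^\infty_c(\mathbb{R}\times\mathbb{T};\mathbb{R}_{\ge0})$, $$\int|u(\omega,x,t)-m^\pm_\alpha(\omega,x)|\,\partial_t\phi(x,t)\,dt\,dx+\int\operatorname{sign}(u(\omega,x,t)-m^\pm_\alpha(\omega,x))\,(\mathfrak{f}(\omega,x,u(\omega,x,t))-\alpha)\,\partial_x\phi(x,t)\,dt\,dx+\int|u_0(\omega,x)-m^\pm_\alpha(\omega,x)|\,\phi(x,0)\,dx\ge0.$$ Under (B-1),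 (B-2) and (B-3) or (B-3'), such a solution exists and is unique for every $\omega\in\Omega$. *)

theory Defs
  imports "HOL-Probability.Probability"
begin

text \<open>Elements of Lebesgue spaces are represented by functions, and the topologies below are
  generated by pseudometrics. Their open sets do not separate functions that agree almost
  everywhere, so Borel sets and separability are those of the quotient modulo such equality.\<close>

definition pseudometrics_topology :: "'a set \<Rightarrow> ('a \<Rightarrow> 'a \<Rightarrow> real) set \<Rightarrow> 'a topology" where
  "pseudometrics_topology X D =
     topology_generated_by {{v \<in> X. d u v < e} | u d e. u \<in> X \<and> d \<in> D \<and> e > 0}"

definition borel_of_topology :: "'a topology \<Rightarrow> 'a measure" where
  "borel_of_topology X = sigma (topspace X) {U. openin X U}"

definition strongly_measurable :: "'w measure \<Rightarrow> 'a topology \<Rightarrow> ('w \<Rightarrow> 'a) \<Rightarrow> bool" where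
  "strongly_measurable M X h \<longleftrightarrow>
     h \<in> measurable M (borel_of_topology X) \<and> separable_space (subtopology X (h ` space M))"

definition Linf :: "'a measure \<Rightarrow> ('a \<Rightarrow> real) set" where
  "Linf M = {g \<in> borel_measurable M. esssup M (\<lambda>x. ereal \<bar>g x\<bar>) < \<infinity>}"

definition Linf_norm :: "(real \<Rightarrow> real) \<Rightarrow> real" where
  "Linf_norm g = real_of_ereal (esssup lebesgue (\<lambda>x. ereal \<bar>g x\<bar>))"

definition L1_norm :: "(real \<Rightarrow> real) \<Rightarrow> real" where
  "L1_norm g = (LINT x|lebesgue. \<bar>g x\<bar>)"

definition Linf_topology :: "(real \<Rightarrow> real) topology" where
  "Linf_topology = pseudometrics_topology (Linf lebesgue) {\<lambda>g h. Linf_norm (\<lambda>x. g x - h x)}"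

definition L1_topology :: "(real \<Rightarrow> real) topology" where
  "L1_topology =
     pseudometrics_topology {g. integrable lebesgue g} {\<lambda>g h. L1_norm (\<lambda>x. g x - h x)}"

definition L1loc_topology :: "(real \<Rightarrow> real) topology" where
  "L1loc_topology =
     pseudometrics_topology {g. \<forall>K. compact K \<longrightarrow> set_integrable lebesgue K g}
       {\<lambda>g h. (LINT x:K|lebesgue. \<bar>g x - h x\<bar>) | K. compact K}"

text \<open>Membership of a function on \<open>\<Omega> \<times> \<real>\<close> in the Bochner space \<open>L\<^sup>p(\<Omega>; E)\<close>, where \<open>E\<close> is a space
  of functions on the line with the given topology and norm. As \<open>L\<^sup>p(\<Omega>; E)\<close> consists of classes
  modulo null sets, only a version of \<open>h\<close> has to be strongly measurable.\<close>

definition in_Bochner_Lp ::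
  "'w measure \<Rightarrow> real \<Rightarrow> (real \<Rightarrow> real) topology \<Rightarrow> ((real \<Rightarrow> real) \<Rightarrow> real) \<Rightarrow> ('w \<Rightarrow> real \<Rightarrow> real) \<Rightarrow> bool"
  where
  "in_Bochner_Lp M p E nrm h \<longleftrightarrow>
     (\<exists>h'. strongly_measurable M E h' \<and>
           (AE \<omega> in M. AE x in lebesgue. h \<omega> x = h' \<omega> x) \<and>
           integrable M (\<lambda>\<omega>. nrm (h' \<omega>) powr p))"

text \<open>The space \<open>L\<^sup>\<infinity>(\<real> \<times> [0,T]) \<inter> C\<^sup>0([0,T]; L\<^sup>1\<^sub>l\<^sub>o\<^sub>c(\<real>))\<close>; its elements are functions of \<open>(x, t)\<close>,
  and values at \<open>t \<notin> [0,T]\<close> are irrelevant.\<close>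

definition solution_space :: "real \<Rightarrow> (real \<times> real \<Rightarrow> real) set" where
  "solution_space T =
     {u \<in> Linf (lebesgue_on (UNIV \<times> {0..T})).
        continuous_map (top_of_set {0..T}) L1loc_topology (\<lambda>t x. u (x, t))}"

definition solution_topology :: "real \<Rightarrow> (real \<times> real \<Rightarrow> real) topology" where
  "solution_topology T =
     pseudometrics_topology (solution_space T)
       {\<lambda>u v. (SUP t\<in>{0..T}. LINT x:K|lebesgue. \<bar>u (x, t) - v (x, t)\<bar>) | K. compact K}"

text \<open>Nonnegative elements of \<open>C\<^sub>c\<^sup>\<infinity>(\<real> \<times> [0,T])\<close>, given by smooth extensions to the plane;
  \<open>D i j\<close> is \<open>\<partial>\<^sub>x\<^sup>i \<partial>\<^sub>t\<^sup>j \<phi>\<close>. They need not vanish at \<open>t = 0\<close> or \<open>t = T\<close>.\<close>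

definition smooth_on_plane :: "(real \<times> real \<Rightarrow> real) \<Rightarrow> bool" where
  "smooth_on_plane \<phi> \<longleftrightarrow>
     (\<exists>D :: nat \<Rightarrow> nat \<Rightarrow> real \<times> real \<Rightarrow> real. D 0 0 = \<phi> \<and>
        (\<forall>i j z. (D i j has_derivative
                   (\<lambda>(h, k). h * D (Suc i) j z + k * D i (Suc j) z)) (at z)))"

definition test_functions :: "real \<Rightarrow> (real \<times> real \<Rightarrow> real) set" where
  "test_functions T =
     {\<phi>. smooth_on_plane \<phi> \<and> compact (closure {z. \<phi> z \<noteq> 0}) \<and> (\<forall>x. \<forall>t\<in>{0..T}. \<phi> (x, t) \<ge> 0)}"

text \<open>Pathwise conditions are stated for a fixed flux \<open>F = \<ff>(\<omega>, \<cdot>, \<cdot>)\<close> and the set \<open>N = \<N>(\<omega>)\<close>.\<close>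

definition flux_B1 :: "(real \<Rightarrow> real \<Rightarrow> real) \<Rightarrow> real set \<Rightarrow> bool" where
  "flux_B1 F N \<longleftrightarrow>
     closed N \<and> N \<in> null_sets lebesgue \<and>
     (\<forall>x \<rho>. \<not> isCont (\<lambda>y. F y \<rho>) x \<longrightarrow> x \<in> N) \<and>
     (\<forall>x \<rho>. x \<notin> N \<longrightarrow> isCont (\<lambda>(y, r). F y r) (x, \<rho>))"

definition flux_B2 :: "(real \<Rightarrow> real \<Rightarrow> real) \<Rightarrow> bool" where
  "flux_B2 F \<longleftrightarrow>
     (\<exists>g\<^sub>m g\<^sub>p :: real \<Rightarrow> real.
        continuous_on UNIV g\<^sub>m \<and> continuous_on UNIV g\<^sub>p \<and>
        (\<forall>x \<rho>. g\<^sub>m \<rho> \<le> \<bar>F x \<rho>\<bar> \<and> \<bar>F x \<rho>\<bar> \<le> g\<^sub>p \<rho>) \<and>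
        (\<forall>\<rho>. g\<^sub>m \<rho> \<ge> 0) \<and>
        (\<exists>c. antimono_on {..c} g\<^sub>m \<and> mono_on {c..} g\<^sub>m) \<and>
        filterlim (\<lambda>\<rho>. \<bar>g\<^sub>m \<rho>\<bar>) at_top at_top \<and> filterlim (\<lambda>\<rho>. \<bar>g\<^sub>m \<rho>\<bar>) at_top at_bot)"

text \<open>This contains local Lipschitz continuity of each \<open>F x\<close> with \<open>x \<notin> N\<close>.\<close>

definition common_Lipschitz :: "(real \<Rightarrow> real \<Rightarrow> real) \<Rightarrow> real set \<Rightarrow> bool" where
  "common_Lipschitz F N \<longleftrightarrow>
     (\<forall>I. is_interval I \<and> bounded I \<longrightarrow> (\<exists>L. \<forall>x. x \<notin> N \<longrightarrow> L-lipschitz_on I (F x)))"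

text \<open>\<open>A\<close> is the admissible range, and \<open>B\<^sub>m \<omega> x\<close>, \<open>B\<^sub>p \<omega> x\<close> are the two branches, i.e. the sets on
  which \<open>\<ff>(\<omega>, x, \<cdot>)\<close> is inverted by \<open>\<ff>\<^sub>-\<^sup>-\<^sup>1\<close> and \<open>\<ff>\<^sub>+\<^sup>-\<^sup>1\<close>. The two flux conditions determine them, so that
  everything that follows can be said once for both cases.\<close>

definition flux_B3 ::
  "'w set \<Rightarrow> ('w \<Rightarrow> real \<Rightarrow> real \<Rightarrow> real) \<Rightarrow> ('w \<Rightarrow> real set) \<Rightarrow>
   real set \<Rightarrow> ('w \<Rightarrow> real \<Rightarrow> real set) \<Rightarrow> ('w \<Rightarrow> real \<Rightarrow> real set) \<Rightarrow> bool" where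
  "flux_B3 \<Omega> f N A B\<^sub>m B\<^sub>p \<longleftrightarrow>
     (\<exists>(u\<^sub>M :: 'w \<Rightarrow> real \<Rightarrow> real) (M\<^sub>0 :: real).
        (A = {M\<^sub>0..} \<or> A = {..M\<^sub>0}) \<and>
        B\<^sub>m = (\<lambda>\<omega> x. {..u\<^sub>M \<omega> x}) \<and> B\<^sub>p = (\<lambda>\<omega> x. {u\<^sub>M \<omega> x..}) \<and>
        (\<forall>\<omega>\<in>\<Omega>. \<forall>x. x \<notin> N \<omega> \<longrightarrow>
           f \<omega> x (u\<^sub>M \<omega> x) = M\<^sub>0 \<and>
           bij_betw (f \<omega> x) (B\<^sub>m \<omega> x) A \<and> bij_betw (f \<omega> x) (B\<^sub>p \<omega> x) A) \<and>
        (\<forall>\<omega>\<in>\<Omega>. common_Lipschitz (f \<omega>) (N \<omega>)))"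

definition flux_B3' ::
  "'w set \<Rightarrow> ('w \<Rightarrow> real \<Rightarrow> real \<Rightarrow> real) \<Rightarrow> ('w \<Rightarrow> real set) \<Rightarrow>
   real set \<Rightarrow> ('w \<Rightarrow> real \<Rightarrow> real set) \<Rightarrow> ('w \<Rightarrow> real \<Rightarrow> real set) \<Rightarrow> bool" where
  "flux_B3' \<Omega> f N A B\<^sub>m B\<^sub>p \<longleftrightarrow>
     A = UNIV \<and> B\<^sub>m = (\<lambda>\<omega> x. UNIV) \<and> B\<^sub>p = (\<lambda>\<omega> x. UNIV) \<and>
     (\<forall>\<omega>\<in>\<Omega>. \<forall>x. x \<notin> N \<omega> \<longrightarrow> bij (f \<omega> x)) \<and>
     (\<forall>\<omega>\<in>\<Omega>. common_Lipschitz (f \<omega>) (N \<omega>))"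

text \<open>\<open>G \<omega> x\<close> is the inverse of \<open>f \<omega> x\<close> on the branch \<open>B \<omega> x\<close>. For \<open>x \<in> N \<omega>\<close> there may be no inverse,
  and the values of \<open>G\<close> are left arbitrary there.\<close>

definition branch_inverse ::
  "'w set \<Rightarrow> ('w \<Rightarrow> real \<Rightarrow> real \<Rightarrow> real) \<Rightarrow> ('w \<Rightarrow> real set) \<Rightarrow>
   real set \<Rightarrow> ('w \<Rightarrow> real \<Rightarrow> real set) \<Rightarrow> ('w \<Rightarrow> real \<Rightarrow> real \<Rightarrow> real) \<Rightarrow> bool" where
  "branch_inverse \<Omega> f N A B G \<longleftrightarrow>
     (\<forall>\<omega>\<in>\<Omega>. \<forall>x. x \<notin> N \<omega> \<longrightarrow> (\<forall>\<alpha>\<in>A. G \<omega> x \<alpha> = the_inv_into (B \<omega> x) (f \<omega> x) \<alpha>))"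

definition steady_state ::
  "(real \<Rightarrow> real \<Rightarrow> real) \<Rightarrow> (real \<Rightarrow> real set) \<Rightarrow> real \<Rightarrow> (real \<Rightarrow> real) \<Rightarrow> bool" where
  "steady_state F B \<alpha> m \<longleftrightarrow> (AE x in lebesgue. F x (m x) = \<alpha> \<and> m x \<in> B x)"

definition adapted_entropy_inequality ::
  "real \<Rightarrow> (real \<Rightarrow> real \<Rightarrow> real) \<Rightarrow> (real \<Rightarrow> real) \<Rightarrow> real \<Rightarrow> (real \<Rightarrow> real) \<Rightarrow>
   (real \<times> real \<Rightarrow> real) \<Rightarrow> (real \<times> real \<Rightarrow> real) \<Rightarrow> bool" where
  "adapted_entropy_inequality T F u\<^sub>0 \<alpha> m \<phi> u \<longleftrightarrow>
     integral\<^sup>L (lebesgue_on (UNIV \<times> {0..T}))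
       (\<lambda>(x, t). \<bar>u (x, t) - m x\<bar> * deriv (\<lambda>s. \<phi> (x, s)) t)
   + integral\<^sup>L (lebesgue_on (UNIV \<times> {0..T}))
       (\<lambda>(x, t). sgn (u (x, t) - m x) * (F x (u (x, t)) - \<alpha>) * deriv (\<lambda>y. \<phi> (y, t)) x)
   + (LINT x|lebesgue. \<bar>u\<^sub>0 x - m x\<bar> * \<phi> (x, 0)) \<ge> 0"

definition adapted_entropy_solution ::
  "real \<Rightarrow> (real \<Rightarrow> real \<Rightarrow> real) \<Rightarrow> real set \<Rightarrow> (real \<Rightarrow> real set) \<Rightarrow> (real \<Rightarrow> real set) \<Rightarrow>
   (real \<Rightarrow> real) \<Rightarrow> (real \<times> real \<Rightarrow> real) \<Rightarrow> bool" where
  "adapted_entropy_solution T F A B\<^sub>m B\<^sub>p u\<^sub>0 u \<longleftrightarrow>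
     u \<in> solution_space T \<and>
     (\<forall>\<alpha>\<in>A. \<forall>m. steady_state F B\<^sub>m \<alpha> m \<or> steady_state F B\<^sub>p \<alpha> m \<longrightarrow>
        (\<forall>\<phi>\<in>test_functions T. adapted_entropy_inequality T F u\<^sub>0 \<alpha> m \<phi> u))"

text \<open>Uniqueness is equality in \<open>C\<^sup>0([0,T]; L\<^sup>1\<^sub>l\<^sub>o\<^sub>c(\<real>))\<close>.\<close>

definition unique_adapted_entropy_solution ::
  "real \<Rightarrow> (real \<Rightarrow> real \<Rightarrow> real) \<Rightarrow> real set \<Rightarrow> (real \<Rightarrow> real set) \<Rightarrow> (real \<Rightarrow> real set) \<Rightarrow>
   (real \<Rightarrow> real) \<Rightarrow> (real \<times> real \<Rightarrow> real) \<Rightarrow> bool" where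
  "unique_adapted_entropy_solution T F A B\<^sub>m B\<^sub>p u\<^sub>0 u \<longleftrightarrow>
     adapted_entropy_solution T F A B\<^sub>m B\<^sub>p u\<^sub>0 u \<and>
     (\<forall>v. adapted_entropy_solution T F A B\<^sub>m B\<^sub>p u\<^sub>0 v \<longrightarrow>
        (\<forall>t\<in>{0..T}. AE x in lebesgue. v (x, t) = u (x, t)))"

end

theory Submission
  imports Defs
begin

text \<open>For each \<open>\<omega>\<close> the solution is characterized by countably many entropy inequalities \<open>\<Psi>\<^sub>q(\<omega>, v) \<ge> 0\<close>:
  levels \<open>\<alpha>\<close> and test functions may be taken from countable dense sets, because the steady states depend
  continuously on \<open>\<alpha>\<close>. Each \<open>\<Psi>\<^sub>q\<close> is measurable in \<open>\<omega>\<close> and, since the flux is Lipschitz on bounded sets,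
  Lipschitz in \<open>v\<close> on \<open>L\<^sup>\<infinity>\<close>-bounded sets. Hence \<open>u(\<omega>)\<close> lies in a given closed ball iff some sequence from a
  countable dense set converges rapidly, stays close to the ball and satisfies the first \<open>n\<close> inequalities up
  to \<open>1/n\<close> at its \<open>n\<close>-th member; its limit is a solution and uniqueness identifies it with \<open>u(\<omega>)\<close>. The
  existence of such a sequence is a Suslin operation on measurable sets, so the event is measurable because
  the probability space is complete. Separability of the solution space then turns balls into arbitrary open sets.\<close>

section \<open>The Suslin operation\<close>

text \<open>The argument uses no stability estimate for the solution under changes of the flux, only
  uniqueness. The event that the solution lies in a ball is therefore treated as a projection: it
  asks whether some function in the ball satisfies countably many conditions, and the quantifier
  over an uncountable space yields an analytic set rather than an evidently measurable one. Coding
  functions by sequences of naturals brings this quantifier into Suslin form.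

  Two quantities are not known to depend measurably on \<omega>. The set \<open>N \<omega>\<close>
  is bypassed by limits of samples, which recover the flux and its inverses at every point off it.
  The essential bound of the solution is bypassed by fixing a bound \<open>M\<close>: this restores
  completeness, which the whole space lacks for uniform L1 distances, and the measurable set
  obtained lies between the event with the bound and the event without it.

  The jump of the sign is harmless, both in the Lipschitz estimate and in the passage to the limit
  in \<alpha>, because the flux equals \<alpha> exactly where the sign jumps.\<close>

lemma konig_nat_lists:
  fixes T :: "nat list \<Rightarrow> bool"
  assumes prefix: "\<And>s n. T s \<Longrightarrow> T (take n s)"
    and bound: "\<And>s i. T s \<Longrightarrow> i < length s \<Longrightarrow> s ! i \<le> k i"
    and inf: "\<And>n. \<exists>s. length s = n \<and> T s"
  shows "\<exists>\<sigma>. \<forall>n. T (map \<sigma> [0..<n])"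
proof -
  \<comment> \<open>Nodes with extensions in the tree at every length. Each has a child of the same
    kind, so repeated choice follows an infinite branch.\<close>
  define good where
    "good s \<longleftrightarrow> (\<forall>n\<ge>length s. \<exists>t. length t = n \<and> T t \<and> take (length s) t = s)" for s
  have step: "\<exists>j. good (s @ [j])" if s: "good s" for s
  proof (rule ccontr)
    assume "\<nexists>j. good (s @ [j])"
    then have "\<forall>j. \<exists>n\<ge>Suc (length s). \<forall>t. T t \<longrightarrow> length t = n \<longrightarrow> take (Suc (length s)) t \<noteq> s @ [j]"
      unfolding good_def by simp
    then obtain m where m: "\<And>j. m j \<ge> Suc (length s)"
      "\<And>j t. length t = m j \<Longrightarrow> T t \<Longrightarrow> take (Suc (length s)) t \<noteq> s @ [j]"
      by metis
    \<comment> \<open>\<open>m j\<close> is a length at which the child \<open>j\<close> has no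
      extension left. Only children up to \<open>k (length s)\<close> can occur, so an extension of
      \<open>s\<close> of length \<open>K\<close> runs through one of them and, cut back to length
      \<open>m j\<close>, contradicts the choice of \<open>m j\<close>.\<close>
    define K where "K = Max (m ` {..k (length s)})"
    have mK: "m j \<le> K" if "j \<le> k (length s)" for j
      unfolding K_def using that by (intro Max_ge) auto
    have K: "K \<ge> Suc (length s)" using mK[of 0] m(1)[of 0] by simp
    then obtain t where t: "length t = K" "T t" "take (length s) t = s"
      using s unfolding good_def by (meson Suc_leD)
    define j where "j = t ! length s"
    have "j \<le> k (length s)" unfolding j_def using bound[OF t(2)] K t(1) by simp
    then have mj: "m j \<le> K" by (rule mK)
    have "take (Suc (length s)) t = s @ [j]"
      using t K unfolding j_def by (simp add: take_Suc_conv_app_nth)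
    moreover have "take (Suc (length s)) (take (m j) t) = take (Suc (length s)) t"
      using m(1)[of j] by (simp add: min_def)
    ultimately show False
      using m(2)[of "take (m j) t" j] prefix[OF t(2)] t(1) mj by simp
  qed
  define L where "L = rec_nat [] (\<lambda>_ s. s @ [SOME j. good (s @ [j])])"
  define \<sigma> where "\<sigma> n = (SOME j. good (L n @ [j]))" for n
  have L0: "L 0 = []" and LS: "L (Suc n) = L n @ [\<sigma> n]" for n
    by (simp_all add: L_def \<sigma>_def)
  have L: "L n = map \<sigma> [0..<n]" for n
    by (induction n) (simp_all add: L0 LS)
  have "good (L n)" for n
  proof (induction n)
    case 0
    then show ?case using inf by (auto simp: good_def L0)
  next
    case (Suc n)
    then show ?case unfolding LS \<sigma>_def by (rule someI_ex[OF step])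
  qed
  then have "\<exists>t. length t = length (L n) \<and> T t \<and> take (length (L n)) t = L n" for n
    unfolding good_def by blast
  then have "T (L n)" for n
    using take_all order_refl by metis
  then show ?thesis by (intro exI[of _ \<sigma>]) (simp add: L[symmetric])
qed

text \<open>The measurable kernels are the bounded parts of the scheme: restricting the codes to
  \<open>\<sigma> i \<le> k i\<close> loses arbitrarily little outer measure, and by compactness the bounded part is a
  countable intersection of finite unions.\<close>

lemma suslin_operation_measurable:
  fixes A :: "nat list \<Rightarrow> 'w set"
  assumes "finite_measure M" "complete_measure M" and A: "\<And>s. A s \<in> sets M"
  shows "{\<omega> \<in> space M. \<exists>\<sigma>. \<forall>n. \<omega> \<in> A (map \<sigma> [0..<n])} \<in> sets M" (is "?S \<in> _")
proof -
  interpret finite_measure M by fact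
  interpret complete_measure M by fact
  \<comment> \<open>A list bounds the leading entries of a code from above instead of prescribing
    them. The sets therefore increase in the last entry, and their union over that entry frees
    it.\<close>
  define S where "S s = {\<omega> \<in> space M. \<exists>\<sigma>. (\<forall>i<length s. \<sigma> i \<le> s ! i) \<and> (\<forall>n. \<omega> \<in> A (map \<sigma> [0..<n]))}" for s
  have S_Nil: "S [] = ?S" by (simp add: S_def)
  have S_space: "S s \<subseteq> space M" for s by (auto simp: S_def)
  have S_Un: "(\<Union>j. S (s @ [j])) = S s" for s
  proof
    show "(\<Union>j. S (s @ [j])) \<subseteq> S s"
    proof
      fix \<omega> assume "\<omega> \<in> (\<Union>j. S (s @ [j]))"
      then obtain j \<sigma> where \<sigma>: "\<omega> \<in> space M" "\<forall>i<length (s @ [j]). \<sigma> i \<le> (s @ [j]) ! i"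
        "\<forall>n. \<omega> \<in> A (map \<sigma> [0..<n])"
        by (auto simp: S_def)
      have "\<sigma> i \<le> s ! i" if "i < length s" for i
        using \<sigma>(2)[rule_format, of i] that by (simp add: nth_append)
      then show "\<omega> \<in> S s" using \<sigma> by (auto simp: S_def)
    qed
    show "S s \<subseteq> (\<Union>j. S (s @ [j]))"
    proof
      fix \<omega> assume "\<omega> \<in> S s"
      then obtain \<sigma> where "\<omega> \<in> space M" "\<forall>i<length s. \<sigma> i \<le> s ! i" "\<forall>n. \<omega> \<in> A (map \<sigma> [0..<n])"
        by (auto simp: S_def)
      then have "\<omega> \<in> S (s @ [\<sigma> (length s)])"
        unfolding S_def by (auto intro!: exI[of _ \<sigma>] simp: nth_append less_Suc_eq)
      then show "\<omega> \<in> (\<Union>j. S (s @ [j]))" by blast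
    qed
  qed
  have S_inc: "incseq (\<lambda>j. S (s @ [j]))" for s
  proof (rule monoI)
    fix a b :: nat assume ab: "a \<le> b"
    show "S (s @ [a]) \<subseteq> S (s @ [b])"
    proof
      fix \<omega> assume "\<omega> \<in> S (s @ [a])"
      then obtain \<sigma> where \<sigma>: "\<omega> \<in> space M" "\<forall>i<length (s @ [a]). \<sigma> i \<le> (s @ [a]) ! i"
        "\<forall>n. \<omega> \<in> A (map \<sigma> [0..<n])"
        by (auto simp: S_def)
      have "\<sigma> i \<le> (s @ [b]) ! i" if "i < length (s @ [b])" for i
        using \<sigma>(2)[rule_format, of i] that ab by (auto simp: nth_append less_Suc_eq split: if_splits)
      then show "\<omega> \<in> S (s @ [b])" using \<sigma> by (auto simp: S_def)
    qed
  qed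
  \<comment> \<open>Outer measure is continuous along increasing sequences of arbitrary sets; no
    \<open>S s\<close> is yet known to be measurable.\<close>
  have S_SUP: "(SUP j. outer_measure_of M (S (s @ [j]))) = outer_measure_of M (S s)" for s
    using SUP_outer_measure_of_incseq[OF S_space S_inc[of s]] unfolding S_Un .
  have inner: "\<exists>C\<in>sets M. C \<subseteq> ?S \<and> a \<le> emeasure M C" if a: "a < outer_measure_of M ?S" for a
  proof -
    have step: "\<exists>j. a < outer_measure_of M (S (s @ [j]))" if "a < outer_measure_of M (S s)" for s
      using that unfolding S_SUP[of s, symmetric] less_SUP_iff by blast
    \<comment> \<open>The bounds \<open>k n\<close> are fixed one at a time, each so large that the
      outer measure stays above \<open>a\<close>.\<close>
    define L where "L = rec_nat [] (\<lambda>_ s. s @ [SOME j. a < outer_measure_of M (S (s @ [j]))])"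
    define k where "k n = (SOME j. a < outer_measure_of M (S (L n @ [j])))" for n
    have L0: "L 0 = []" and LS: "L (Suc n) = L n @ [k n]" for n
      by (simp_all add: L_def k_def)
    have L: "L n = map k [0..<n]" for n
      by (induction n) (simp_all add: L0 LS)
    have aL: "a < outer_measure_of M (S (L n))" for n
    proof (induction n)
      case 0
      then show ?case using a by (simp add: L0 S_Nil)
    next
      case (Suc n)
      then show ?case unfolding LS k_def by (rule someI_ex[OF step])
    qed
    define Ls where "Ls n = {s. length s = n \<and> (\<forall>i<n. s ! i \<le> k i)}" for n
    have finite_Ls: "finite (Ls n)" for n
    proof (rule finite_subset)
      show "Ls n \<subseteq> {s. set s \<subseteq> {..Max (k ` {..n})} \<and> length s = n}"
      proof safe
        fix s x assume s: "s \<in> Ls n" and "x \<in> set s"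
        then obtain i where i: "i < n" "x = s ! i" by (auto simp: Ls_def in_set_conv_nth)
        then have "x \<le> k i" using s by (simp add: Ls_def)
        also have "k i \<le> Max (k ` {..n})" using i by (intro Max_ge) auto
        finally show "x \<le> Max (k ` {..n})" .
      qed (simp add: Ls_def)
      show "finite {s. set s \<subseteq> {..Max (k ` {..n})} \<and> length s = n}"
        by (rule finite_lists_length_eq) simp
    qed
    \<comment> \<open>Codes bounded by \<open>k\<close> have finitely many prefixes of length
      \<open>n\<close>, so a finite union of measurable sets covers \<open>S (L n)\<close>.\<close>
    define C where "C n = {\<omega> \<in> space M. \<exists>s\<in>Ls n. \<forall>m\<le>n. \<omega> \<in> A (take m s)}" for n
    have C_eq: "C n = (\<Union>s\<in>Ls n. \<Inter>m\<in>{..n}. A (take m s))" for n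
      unfolding C_def using sets.sets_into_space[OF A] by auto
    have C: "C n \<in> sets M" for n
      unfolding C_eq using A finite_Ls by (intro sets.finite_UN sets.finite_INT) auto
    have SC: "S (L n) \<subseteq> C n" for n
    proof
      fix \<omega> assume "\<omega> \<in> S (L n)"
      then obtain \<sigma> where \<sigma>: "\<omega> \<in> space M" "\<And>i. i < n \<Longrightarrow> \<sigma> i \<le> k i" "\<And>n. \<omega> \<in> A (map \<sigma> [0..<n])"
        by (auto simp: S_def L)
      have "map \<sigma> [0..<n] \<in> Ls n" using \<sigma>(2) by (simp add: Ls_def)
      moreover have "\<forall>m\<le>n. \<omega> \<in> A (take m (map \<sigma> [0..<n]))"
        using \<sigma>(3) by (simp add: take_map min_def)
      ultimately show "\<omega> \<in> C n" using \<sigma>(1) unfolding C_def by blast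
    qed
    have Ca: "a \<le> emeasure M (C n)" for n
      using aL[of n] outer_measure_of_mono[OF SC, of M n] C[of n] by simp
    have "decseq C"
    proof (rule decseq_SucI)
      fix n show "C (Suc n) \<subseteq> C n"
      proof
        fix \<omega> assume "\<omega> \<in> C (Suc n)"
        then obtain s where "\<omega> \<in> space M" "s \<in> Ls (Suc n)" "\<forall>m\<le>Suc n. \<omega> \<in> A (take m s)"
          by (auto simp: C_def)
        then have "take n s \<in> Ls n" "\<forall>m\<le>n. \<omega> \<in> A (take m (take n s))"
          by (auto simp: Ls_def min_def)
        then show "\<omega> \<in> C n" using \<open>\<omega> \<in> space M\<close> unfolding C_def by blast
      qed
    qed
    then have "emeasure M (\<Inter>n. C n) = (INF n. emeasure M (C n))"
      using C by (intro INF_emeasure_decseq[symmetric]) auto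
    then have "a \<le> emeasure M (\<Inter>n. C n)"
      using Ca by (simp add: INF_greatest)
    moreover have "(\<Inter>n. C n) \<subseteq> ?S"
    proof
      fix \<omega> assume \<omega>: "\<omega> \<in> (\<Inter>n. C n)"
      \<comment> \<open>The tree of bounded codes whose conditions hold at \<omega>. Membership in
        every \<open>C n\<close> gives nodes of every length, possibly unrelated; Koenig's lemma
        joins them into a single code.\<close>
      define T where "T s \<longleftrightarrow> (\<forall>i<length s. s ! i \<le> k i) \<and> (\<forall>m\<le>length s. \<omega> \<in> A (take m s))" for s
      have "\<exists>\<sigma>. \<forall>n. T (map \<sigma> [0..<n])"
      proof (rule konig_nat_lists)
        show "T s \<Longrightarrow> T (take n s)" for s n by (auto simp: T_def min_def)
        show "T s \<Longrightarrow> i < length s \<Longrightarrow> s ! i \<le> k i" for s i by (auto simp: T_def)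
        show "\<exists>s. length s = n \<and> T s" for n
        proof -
          have "\<omega> \<in> C n" using \<omega> by blast
          then obtain s where "s \<in> Ls n" "\<forall>m\<le>n. \<omega> \<in> A (take m s)" unfolding C_def by blast
          then show ?thesis unfolding Ls_def T_def by (intro exI[of _ s]) auto
        qed
      qed
      then obtain \<sigma> where "\<And>n. T (map \<sigma> [0..<n])" by blast
      then have "\<omega> \<in> A (take n (map \<sigma> [0..<n]))" for n
        using T_def by (metis length_map length_upt minus_nat.diff_0 order_refl)
      then show "\<omega> \<in> ?S" using \<omega> by (auto simp: C_def)
    qed
    ultimately show ?thesis using C by (intro bexI[of _ "\<Inter>n. C n"]) auto
  qed
  \<comment> \<open>Kernels from inside meet a measurable hull \<open>E\<close> of the same outer
    measure from outside; completeness makes the set enclosed between them measurable.\<close>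
  have "?S \<in> fmeasurable M"
  proof (rule fmeasurable_inner_outer[THEN iffD2], intro allI impI)
    fix e :: real assume e: "e > 0"
    obtain E where E: "E \<in> sets M" "?S \<subseteq> E" "outer_measure_of M ?S = emeasure M E"
      using outer_measure_of_attain[of ?S M] by auto
    have "\<exists>C\<in>sets M. C \<subseteq> ?S \<and> measure M E - e < measure M C"
    \<comment> \<open>The level has to be nonnegative to be read as an extended nonnegative real;
      below 0 the empty kernel suffices.\<close>
    proof (cases "measure M E - e/2 < 0")
      case True
      then show ?thesis using e by (intro bexI[of _ "{}"]) auto
    next
      case False
      have "ennreal (measure M E - e/2) < outer_measure_of M ?S"
        unfolding E(3) using False e unfolding emeasure_eq_measure by (intro ennreal_lessI) auto
      from inner[OF this] obtain C
        where C: "C \<in> sets M" "C \<subseteq> ?S" "ennreal (measure M E - e/2) \<le> emeasure M C"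
        by blast
      then have "measure M E - e/2 \<le> measure M C"
        unfolding emeasure_eq_measure by (subst (asm) ennreal_le_iff) auto
      then show ?thesis using C e by (intro bexI[of _ C]) auto
    qed
    then obtain C where "C \<in> sets M" "C \<subseteq> ?S" "measure M E - e < measure M C" by blast
    moreover have "measure M C \<le> measure M E"
      using calculation E by (intro finite_measure_mono) auto
    ultimately show "\<exists>T\<in>fmeasurable M. \<exists>U\<in>fmeasurable M. T \<subseteq> ?S \<and> ?S \<subseteq> U \<and> \<bar>measure M T - measure M U\<bar> < e"
      using E by (intro bexI[of _ C] bexI[of _ E]) (auto simp: fmeasurable_eq_sets)
  qed
  then show ?thesis by auto
qed

section \<open>Topologies generated by pseudometrics; separability of \<open>L\<^sup>1\<close>\<close>

lemma openin_pseudometrics_topology_ball: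
  assumes "u \<in> X" "d \<in> D" "e > 0"
  shows "openin (pseudometrics_topology X D) {v \<in> X. d u v < e}"
  unfolding pseudometrics_topology_def openin_topology_generated_by_iff
  using assms by (intro generate_topology_on.Basis) blast

lemma topspace_pseudometrics_topology:
  assumes "D \<noteq> {}" "\<And>d u. d \<in> D \<Longrightarrow> u \<in> X \<Longrightarrow> d u u = 0"
  shows "topspace (pseudometrics_topology X D) = X"
proof -
  obtain d where d: "d \<in> D" using assms by blast
  have "u \<in> \<Union>{{v \<in> X. d u v < e} | u d e. u \<in> X \<and> d \<in> D \<and> e > 0}" if "u \<in> X" for u
    using assms(2)[OF d that] that d
    by (intro UnionI[of "{v \<in> X. d u v < 1}"]) (auto intro!: exI[of _ u] exI[of _ d] exI[of _ 1])
  then show ?thesis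
    unfolding pseudometrics_topology_def topology_generated_by_topspace by blast
qed

text \<open>Models the exhaustion of the line by compact sets: an increasing sequence in
  \<open>D\<close> that dominates each of its members. The laws are required only on
  \<open>X\<close>, since the integrals that serve as distances behave as such only for integrable
  differences.\<close>

locale pseudometric_sequence =
  fixes X :: "'a set" and D :: "('a \<Rightarrow> 'a \<Rightarrow> real) set" and dn :: "nat \<Rightarrow> 'a \<Rightarrow> 'a \<Rightarrow> real"
  assumes dn_in: "dn n \<in> D"
    and dominated: "d \<in> D \<Longrightarrow> \<exists>n. \<forall>u\<in>X. \<forall>v\<in>X. d u v \<le> dn n u v"
    and dn_mono: "m \<le> n \<Longrightarrow> u \<in> X \<Longrightarrow> v \<in> X \<Longrightarrow> dn m u v \<le> dn n u v"
    and self: "d \<in> D \<Longrightarrow> u \<in> X \<Longrightarrow> d u u = 0"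
    and sym: "d \<in> D \<Longrightarrow> u \<in> X \<Longrightarrow> v \<in> X \<Longrightarrow> d u v = d v u"
    and triangle: "d \<in> D \<Longrightarrow> u \<in> X \<Longrightarrow> v \<in> X \<Longrightarrow> w \<in> X \<Longrightarrow> d u w \<le> d u v + d v w"
begin

lemma topspace_eq: "topspace (pseudometrics_topology X D) = X"
  using dn_in self by (intro topspace_pseudometrics_topology) auto

text \<open>Generating sets have arbitrary centres; the triangle inequality recentres them at
  \<open>v\<close>, and monotonicity of \<open>dn\<close> lets one index serve a finite
  intersection.\<close>

lemma open_contains_ball:
  assumes "openin (pseudometrics_topology X D) U" "v \<in> U"
  shows "\<exists>n e. e > 0 \<and> {w \<in> X. dn n v w < e} \<subseteq> U"
proof -
  have "generate_topology_on {{v \<in> X. d u v < e} | u d e. u \<in> X \<and> d \<in> D \<and> e > 0} U"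
    using assms(1) unfolding pseudometrics_topology_def openin_topology_generated_by_iff .
  then show ?thesis using assms(2)
  proof (induction arbitrary: v)
    case Empty
    then show ?case by simp
  next
    case (Int a b)
    then obtain n e m e' where ne: "e > 0" "{w \<in> X. dn n v w < e} \<subseteq> a"
      "e' > 0" "{w \<in> X. dn m v w < e'} \<subseteq> b"
      by (meson IntE)
    have "v \<in> X"
      using Int openin_subset[OF openin_topology_generated_by_iff[THEN iffD2, OF Int(1)]]
        topspace_eq unfolding pseudometrics_topology_def by blast
    have "{w \<in> X. dn (max n m) v w < min e e'} \<subseteq> a \<inter> b"
    proof
      fix w assume w: "w \<in> {w \<in> X. dn (max n m) v w < min e e'}"
      then have "dn n v w < e" "dn m v w < e'"
        using dn_mono[of n "max n m" v w] dn_mono[of m "max n m" v w] \<open>v \<in> X\<close> by auto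
      then show "w \<in> a \<inter> b" using ne w by auto
    qed
    then show ?case using ne by (intro exI[of _ "max n m"] exI[of _ "min e e'"]) auto
  next
    case (UN K)
    then obtain k where "k \<in> K" "v \<in> k" by blast
    then obtain n e where "e > 0" "{w \<in> X. dn n v w < e} \<subseteq> k" using UN by meson
    then show ?case using \<open>k \<in> K\<close> by (meson Union_upper subset_trans)
  next
    case (Basis s)
    then obtain u d e where s: "s = {v \<in> X. d u v < e}" "u \<in> X" "d \<in> D" "e > 0" by blast
    have v: "v \<in> X" "d u v < e" using Basis s by auto
    obtain n where n: "\<forall>u\<in>X. \<forall>v\<in>X. d u v \<le> dn n u v" using dominated[OF s(3)] by blast
    have "{w \<in> X. dn n v w < e - d u v} \<subseteq> s"
    proof
      fix w assume "w \<in> {w \<in> X. dn n v w < e - d u v}"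
      then have w: "w \<in> X" "dn n v w < e - d u v" by auto
      have "d u w \<le> d u v + d v w" using triangle s v w by blast
      also have "d v w \<le> dn n v w" using n v w by blast
      finally show "w \<in> s" using w s by auto
    qed
    then show ?case using v by (intro exI[of _ n] exI[of _ "e - d u v"]) auto
  qed
qed

lemma separable_subtopology:
  assumes "S \<subseteq> X" "countable C" "C \<subseteq> S"
    and dense: "\<And>v n e. v \<in> S \<Longrightarrow> e > 0 \<Longrightarrow> \<exists>c\<in>C. dn n v c < e"
  shows "separable_space (subtopology (pseudometrics_topology X D) S)"
  unfolding separable_space_def
proof (intro exI conjI)
  show "countable C" by fact
  have top: "topspace (subtopology (pseudometrics_topology X D) S) = S"
    using assms(1) topspace_eq by auto
  show "C \<subseteq> topspace (subtopology (pseudometrics_topology X D) S)" using top assms by simp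
  show "subtopology (pseudometrics_topology X D) S closure_of C =
    topspace (subtopology (pseudometrics_topology X D) S)"
    unfolding top
  proof
    show "subtopology (pseudometrics_topology X D) S closure_of C \<subseteq> S"
      using closure_of_subset_topspace top by metis
    show "S \<subseteq> subtopology (pseudometrics_topology X D) S closure_of C"
    proof
      fix v assume v: "v \<in> S"
      show "v \<in> subtopology (pseudometrics_topology X D) S closure_of C"
        unfolding in_closure_of top openin_subtopology
      proof (intro conjI allI impI v, elim conjE exE)
        fix U T assume U: "v \<in> U" "openin (pseudometrics_topology X D) T" "U = T \<inter> S"
        then obtain n e where "e > 0" "{w \<in> X. dn n v w < e} \<subseteq> T"
          using open_contains_ball[of T v] by blast
        moreover obtain c where "c \<in> C" "dn n v c < e" using dense[OF v \<open>e > 0\<close>] by blast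
        ultimately show "\<exists>y. y \<in> C \<and> y \<in> U" using U assms by blast
      qed
    qed
  qed
qed

text \<open>Every open set is a countable union of balls with centres in \<open>C\<close> and radii
  \<open>1 / Suc k\<close>. The balls are closed because a non-strict bound is what survives the
  limit of an approximating sequence.\<close>

lemma measurable_borel_of_topology:
  assumes h: "h \<in> space M \<rightarrow> X" and "countable C" "C \<subseteq> X"
    and dense: "\<And>v n e. v \<in> X \<Longrightarrow> e > 0 \<Longrightarrow> \<exists>c\<in>C. dn n v c < e"
    and meas: "\<And>c n r. c \<in> C \<Longrightarrow> {\<omega> \<in> space M. dn n c (h \<omega>) \<le> r} \<in> sets M"
  shows "h \<in> measurable M (borel_of_topology (pseudometrics_topology X D))"
  unfolding borel_of_topology_def topspace_eq
proof (rule measurable_measure_of)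
  show "{U. openin (pseudometrics_topology X D) U} \<subseteq> Pow X"
    using openin_subset topspace_eq by blast
  show "h \<in> space M \<rightarrow> X" by fact
  fix U assume "U \<in> {U. openin (pseudometrics_topology X D) U}"
  then have U: "openin (pseudometrics_topology X D) U" by simp
  define I where "I = {(c, n, k :: nat). c \<in> C \<and> {w \<in> X. dn n c w \<le> 1 / real (Suc k)} \<subseteq> U}"
  have "h -` U \<inter> space M = (\<Union>(c, n, k)\<in>I. {\<omega> \<in> space M. dn n c (h \<omega>) \<le> 1 / real (Suc k)})"
  proof
    show "(\<Union>(c, n, k)\<in>I. {\<omega> \<in> space M. dn n c (h \<omega>) \<le> 1 / real (Suc k)}) \<subseteq> h -` U \<inter> space M"
      using h by (auto simp: I_def subset_iff)
    show "h -` U \<inter> space M \<subseteq> (\<Union>(c, n, k)\<in>I. {\<omega> \<in> space M. dn n c (h \<omega>) \<le> 1 / real (Suc k)})"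
    proof
      fix \<omega> assume \<omega>: "\<omega> \<in> h -` U \<inter> space M"
      then have hX: "h \<omega> \<in> X" using h by auto
      obtain n e where e: "e > 0" "{w \<in> X. dn n (h \<omega>) w < e} \<subseteq> U"
        using open_contains_ball[OF U] \<omega> by blast
      \<comment> \<open>Half of \<open>e\<close>, because the way from \<open>h \<omega>\<close> to
        a point of the ball leads through its centre and each leg is at most
        \<open>1 / Suc k\<close>.\<close>
      obtain k where k: "1 / real (Suc k) < e / 2" using e nat_approx_posE[of "e/2"] by auto
      obtain c where c: "c \<in> C" "dn n (h \<omega>) c < 1 / real (Suc k)"
        using dense[OF hX, of "1 / real (Suc k)" n] by auto
      have cX: "c \<in> X" using c assms by blast
      have "{w \<in> X. dn n c w \<le> 1 / real (Suc k)} \<subseteq> U"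
      proof
        fix w assume "w \<in> {w \<in> X. dn n c w \<le> 1 / real (Suc k)}"
        then have w: "w \<in> X" "dn n c w \<le> 1 / real (Suc k)" by auto
        have "dn n (h \<omega>) w \<le> dn n (h \<omega>) c + dn n c w" using triangle[OF dn_in] hX cX w by blast
        then show "w \<in> U" using e c w k by auto
      qed
      then have "(c, n, k) \<in> I" using c by (simp add: I_def)
      moreover have "dn n c (h \<omega>) \<le> 1 / real (Suc k)"
        using c sym[OF dn_in hX cX, of n] by simp
      ultimately show "\<omega> \<in> (\<Union>(c, n, k)\<in>I. {\<omega> \<in> space M. dn n c (h \<omega>) \<le> 1 / real (Suc k)})"
        using \<omega> by (intro UN_I[of "(c, n, k)"]) auto
    qed
  qed
  moreover have "countable I"
    by (rule countable_subset[of _ "C \<times> UNIV"]) (auto simp: I_def \<open>countable C\<close>)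
  moreover have "(\<Union>(c, n, k)\<in>I. {\<omega> \<in> space M. dn n c (h \<omega>) \<le> 1 / real (Suc k)}) \<in> sets M"
    using \<open>countable I\<close> meas by (intro sets.countable_UN') (auto simp: I_def)
  ultimately show "h -` U \<inter> space M \<in> sets M" by simp
qed

end

text \<open>The approximants in \<open>C\<close> need not belong to \<open>S\<close>; a dense subset is obtained by choosing, for each
  of them and each tolerance, one nearby element of \<open>S\<close>.\<close>

lemma countable_dense_subset_of_approximants:
  fixes near :: "'a \<Rightarrow> 'c \<Rightarrow> real \<Rightarrow> bool" and d :: "'a \<Rightarrow> 'a \<Rightarrow> real"
  assumes "countable C"
    and approx: "\<And>s e. s \<in> S \<Longrightarrow> e > 0 \<Longrightarrow> \<exists>c\<in>C. near s c e"
    and tri: "\<And>s s' c e. s \<in> S \<Longrightarrow> s' \<in> S \<Longrightarrow> c \<in> C \<Longrightarrow> near s c e \<Longrightarrow> near s' c e \<Longrightarrow> d s s' \<le> 2 * e"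
  obtains S' where "countable S'" "S' \<subseteq> S" "\<And>s e. s \<in> S \<Longrightarrow> e > 0 \<Longrightarrow> \<exists>s'\<in>S'. d s s' < e"
proof
  define I where "I = {(c, k). c \<in> C \<and> (\<exists>s\<in>S. near s c (1 / real (Suc k)))}"
  define g where "g = (\<lambda>(c, k). SOME s. s \<in> S \<and> near s c (1 / real (Suc k)))"
  have g: "g (c, k) \<in> S \<and> near (g (c, k)) c (1 / real (Suc k))" if "(c, k) \<in> I" for c k
    using that unfolding I_def g_def by simp (rule someI_ex, blast)
  have "countable I"
    by (rule countable_subset[of _ "C \<times> UNIV"]) (auto simp: I_def \<open>countable C\<close>)
  then show "countable (g ` I)" by simp
  show "g ` I \<subseteq> S" using g by auto
  fix s and e :: real assume s: "s \<in> S" and e: "e > 0"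
  obtain k where k: "1 / real (Suc k) < e / 2" using e nat_approx_posE[of "e/2"] by auto
  obtain c where c: "c \<in> C" "near s c (1 / real (Suc k))" using approx[OF s, of "1 / real (Suc k)"] by auto
  then have I: "(c, k) \<in> I" using s by (auto simp: I_def)
  have "d s (g (c, k)) \<le> 2 * (1 / real (Suc k))" using tri s g[OF I] c by blast
  also have "\<dots> < e" using k by simp
  finally show "\<exists>s'\<in>g ` I. d s s' < e" using I by blast
qed

text \<open>The dense set consists of the integrable rational combinations of indicators of finite unions of basic
  open sets.\<close>

lemma separable_L1_lebesgue:
  obtains D :: "('a::euclidean_space \<Rightarrow> real) set" where "countable D"
    "\<And>d. d \<in> D \<Longrightarrow> d \<in> borel_measurable borel" "\<And>d. d \<in> D \<Longrightarrow> integrable lborel d"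
    "\<And>g e. integrable lebesgue g \<Longrightarrow> e > 0 \<Longrightarrow> \<exists>d\<in>D. (LINT x|lebesgue. \<bar>g x - d x\<bar>) < e"
proof -
  obtain \<B> :: "'a set set" where \<B>: "countable \<B>" "topological_basis \<B>"
    using ex_countable_basis by blast
  define I where "I = {I. finite I \<and> I \<subseteq> \<B>}"
  have "countable I" unfolding I_def using \<B>(1) by (rule countable_Collect_finite_subset)
  define ev where "ev l = (\<lambda>x. \<Sum>(q, J)\<leftarrow>l. of_rat q * indicator (\<Union>J) x :: real)" for l :: "(rat \<times> 'a set set) list" 
  define D where "D = {d \<in> ev ` lists (UNIV \<times> I). integrable lborel d}"
  have "countable (lists ((UNIV :: rat set) \<times> I))" using \<open>countable I\<close> by (intro countable_lists) auto
  then have cD: "countable D" unfolding D_def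
    by (rule countable_subset[rotated, OF countable_image]) auto
  have bD: "d \<in> borel_measurable borel" if "d \<in> D" for d
    using that borel_measurable_integrable unfolding D_def by force
  have D_int: "integrable lborel d" if "d \<in> D" for d using that by (simp add: D_def)
  have D_add: "(\<lambda>x. d x + d' x) \<in> D" if "d \<in> D" "d' \<in> D" for d d'
  proof -
    from that obtain l where "d = ev l" "l \<in> lists (UNIV \<times> I)"
      unfolding D_def by (elim CollectE conjE imageE)
    moreover from that obtain l' where "d' = ev l'" "l' \<in> lists (UNIV \<times> I)"
      unfolding D_def by (elim CollectE conjE imageE)
    ultimately have "(\<lambda>x. d x + d' x) = ev (l @ l')" "l @ l' \<in> lists (UNIV \<times> I)"
      by (auto simp: ev_def)
    moreover have "integrable lborel (\<lambda>x. d x + d' x)"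
      using that unfolding D_def by (intro Bochner_Integration.integrable_add) auto
    ultimately show ?thesis unfolding D_def by blast
  qed
  have D_ind: "(\<lambda>x. of_rat q * indicator (\<Union>J) x) \<in> D" if "finite J" "J \<subseteq> \<B>" "emeasure lborel (\<Union>J) < \<infinity>" for q J
  proof -
    have "\<Union>J \<in> sets borel" using that \<B>(2) topological_basis_open by (intro borel_open open_Union) auto
    then have "integrable lborel (\<lambda>x. of_rat q * indicator (\<Union>J) x :: real)"
      using that(3) by (intro integrable_mult_right integrable_real_indicator) auto
    moreover have "(\<lambda>x. of_rat q * indicator (\<Union>J) x) = ev [(q, J)]" "[(q, J)] \<in> lists (UNIV \<times> I)"
      using that by (auto simp: ev_def I_def)
    ultimately show ?thesis by (auto simp: D_def)
  qed
  have ind: "\<exists>J. finite J \<and> J \<subseteq> \<B> \<and> emeasure lborel (\<Union>J) < \<infinity> \<and>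
      (LINT x|lborel. \<bar>indicator S x - indicator (\<Union>J) x\<bar>) < e"
    if S: "S \<in> sets lborel" "emeasure lborel S < \<infinity>" and e: "e > 0" for S and e :: real
  proof -
    \<comment> \<open>Outer regularity yields an open set, which is an increasing union of finite
      unions of basic sets; continuity from below selects one of these.\<close>
    obtain U where U: "open U" "S \<subseteq> U" "emeasure lborel (U - S) < ennreal (e/2)"
      using outer_regular_lborel[of S "e/2"] S e by auto
    have "U = S \<union> (U - S)" using U by blast
    then have "emeasure lborel U \<le> emeasure lborel S + emeasure lborel (U - S)"
      using S U by (metis borel_open emeasure_subadditive sets.Diff sets_lborel)
    also have "\<dots> < \<infinity>" using S(2) U(3) by (auto simp: less_top[symmetric])
    finally have Ufin: "emeasure lborel U < \<infinity>" .
    obtain \<B>' where \<B>': "\<B>' \<subseteq> \<B>" "\<Union>\<B>' = U" using \<B>(2) U(1) unfolding topological_basis_def by blast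
    show ?thesis
    proof (cases "\<B>' = {}")
      case True
      then have "S = {}" using U \<B>' by auto
      then show ?thesis using e by (intro exI[of _ "{}"]) auto
    next
      case False
      have cB': "countable \<B>'" using \<B>' \<B>(1) countable_subset by blast
      define b where "b = from_nat_into \<B>'"
      have b: "range b = \<B>'" unfolding b_def using False cB' by (rule range_from_nat_into)
      then have bB: "b i \<in> \<B>" for i using \<B>'(1) by blast
      define V where "V n = (\<Union>i\<le>n. b i)" for n :: nat
      have Vopen: "open (V n)" for n
        unfolding V_def using bB topological_basis_open[OF \<B>(2)] by (intro open_UN) auto
      have V: "incseq V" "(\<Union>n. V n) = U" "V n \<subseteq> U" for n
      proof -
        show "incseq V" unfolding V_def by (intro monoI UN_mono) auto
        show "(\<Union>n. V n) = U" unfolding V_def using \<B>'(2) b by auto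
        then show "V n \<subseteq> U" by blast
      qed
      have "(\<lambda>n. emeasure lborel (V n)) \<longlonglongrightarrow> emeasure lborel U"
        using Lim_emeasure_incseq[of V lborel] V Vopen by (simp add: image_subset_iff)
      moreover have "emeasure lborel (V n) = ennreal (measure lborel (V n))" for n
        using emeasure_mono[OF V(3), of lborel n] U Ufin
        by (intro emeasure_eq_ennreal_measure) (auto simp: top_unique)
      moreover have "emeasure lborel U = ennreal (measure lborel U)"
        using Ufin by (intro emeasure_eq_ennreal_measure) auto
      ultimately have "(\<lambda>n. measure lborel (V n)) \<longlonglongrightarrow> measure lborel U"
        by simp
      then obtain n where n: "\<bar>measure lborel (V n) - measure lborel U\<bar> < e/2"
        using e LIMSEQ_D[of _ _ "e/2"] by (metis half_gt_zero order_refl real_norm_def)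
      define J where "J = b ` {..n}"
      have J: "finite J" "J \<subseteq> \<B>" "\<Union>J = V n" using b \<B>' by (auto simp: J_def V_def)
      have Vfin: "emeasure lborel (V n) < \<infinity>"
        using emeasure_mono[OF V(3), of lborel n] U Ufin by (auto simp: top_unique less_top)
      have i1: "integrable lborel (indicator S :: 'a \<Rightarrow> real)"
        "integrable lborel (indicator U :: 'a \<Rightarrow> real)" "integrable lborel (indicator (V n) :: 'a \<Rightarrow> real)"
        using S U Ufin Vfin Vopen by (auto intro!: integrable_real_indicator)
      \<comment> \<open>Both \<open>S\<close> and \<open>V n\<close> lie in \<open>U\<close>, so
        their symmetric difference is covered by their complements in \<open>U\<close>, each of
        measure below \<open>e/2\<close>.\<close>
      have "(LINT x|lborel. \<bar>indicat_real S x - indicat_real (V n) x\<bar>) \<le>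
        (LINT x|lborel. (indicat_real U x - indicat_real S x) + (indicat_real U x - indicat_real (V n) x))"
      proof (intro integral_mono)
        show "integrable lborel (\<lambda>x. \<bar>indicat_real S x - indicat_real (V n) x\<bar>)"
          "integrable lborel (\<lambda>x. indicat_real U x - indicat_real S x + (indicat_real U x - indicat_real (V n) x))"
          using i1 by simp_all
        show "\<bar>indicat_real S x - indicat_real (V n) x\<bar> \<le>
          indicat_real U x - indicat_real S x + (indicat_real U x - indicat_real (V n) x)" for x
          using V(3)[of n] U(2) by (auto simp: indicator_def)
      qed
      also have "\<dots> = (measure lborel U - measure lborel S) + (measure lborel U - measure lborel (V n))"
        using i1 by simp
      also have "measure lborel U - measure lborel S = measure lborel (U - S)"
        using S U Ufin by (intro measure_Diff[symmetric]) auto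
      also have "\<dots> < e/2"
        using U(3) e unfolding measure_def by (metis enn2real_less_iff enn2real_ennreal ennreal_enn2real half_gt_zero_iff less_eq_real_def less_top order.strict_trans ennreal_less_top enn2real_nonneg ennreal_less_iff)
      finally have "(LINT x|lborel. \<bar>indicator S x - indicator (V n) x\<bar>) < e" using n by linarith
      then show ?thesis using J Vfin by (intro exI[of _ J]) auto
    qed
  qed
  have main: "\<forall>e>0. \<exists>d\<in>D. (LINT x|lborel. \<bar>g x - d x\<bar>) < e" if "integrable lborel g" for g :: "'a \<Rightarrow> real"
    using that
  proof (induction rule: integrable_induct)
    case (base S c)
    show ?case
    proof (intro allI impI)
      fix e :: real assume e: "e > 0"
      define m where "m = measure lborel S"
      have m: "m \<ge> 0" by (simp add: m_def)
      \<comment> \<open>One half of the error goes to the coefficient, the other to the set; the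
        summand 1 keeps both denominators positive.\<close>
      obtain q where q: "\<bar>c - of_rat q\<bar> < e / (2 * (m + 1))"
      proof -
        have "c < c + e / (2 * (m + 1))" using e m by (simp add: field_simps add_pos_nonneg)
        then obtain q where "c < of_rat q" "of_rat q < c + e / (2 * (m + 1))" using of_rat_dense by blast
        then show ?thesis by (intro that[of q]) auto
      qed
      define r where "r = \<bar>of_rat q :: real\<bar>"
      have r: "r \<ge> 0" by (simp add: r_def)
      obtain J where J: "finite J" "J \<subseteq> \<B>" "emeasure lborel (\<Union>J) < \<infinity>"
        "(LINT x|lborel. \<bar>indicator S x - indicator (\<Union>J) x\<bar>) < e / (2 * (r + 1))"
        using ind[OF base, of "e / (2 * (r + 1))"] e r by (auto simp: add_nonneg_pos)
      have Jb: "\<Union>J \<in> sets lborel" using J \<B>(2) topological_basis_open by (auto intro!: borel_open open_Union)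
      have i: "integrable lborel (indicator S :: 'a \<Rightarrow> real)" "integrable lborel (indicator (\<Union>J) :: 'a \<Rightarrow> real)"
        using base J Jb by (auto intro!: integrable_real_indicator)
      have "(LINT x|lborel. \<bar>indicator S x *\<^sub>R c - of_rat q * indicator (\<Union>J) x\<bar>) \<le>
         (LINT x|lborel. \<bar>c - of_rat q\<bar> * indicator S x + r * \<bar>indicator S x - indicator (\<Union>J) x\<bar>)"
      proof (intro integral_mono)
        show "integrable lborel (\<lambda>x. \<bar>indicator S x *\<^sub>R c - of_rat q * indicator (\<Union>J) x\<bar>)"
          "integrable lborel (\<lambda>x. \<bar>c - of_rat q\<bar> * indicator S x + r * \<bar>indicator S x - indicator (\<Union>J) x\<bar>)"
          using i by simp_all
        show "\<bar>indicator S x *\<^sub>R c - of_rat q * indicator (\<Union>J) x\<bar> \<le>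
          \<bar>c - of_rat q\<bar> * indicator S x + r * \<bar>indicator S x - indicator (\<Union>J) x\<bar>" for x
        proof -
          have *: "\<bar>s * c - k * t\<bar> \<le> \<bar>c - k\<bar> * s + \<bar>k\<bar> * \<bar>s - t\<bar>"
            if "s \<in> {0, 1}" "t \<in> {0, 1}" for s t k :: real
            using that by auto
          show ?thesis unfolding r_def real_scaleR_def by (rule *) (auto simp: indicator_def)
        qed
      qed
      also have "\<dots> = \<bar>c - of_rat q\<bar> * m + r * (LINT x|lborel. \<bar>indicator S x - indicator (\<Union>J) x\<bar>)"
        using i by (simp add: m_def)
      also have "\<dots> < e"
      proof -
        have "\<bar>c - of_rat q\<bar> * m \<le> e / (2 * (m + 1)) * m" using q m by (intro mult_right_mono) auto
        also have "\<dots> \<le> e / 2" using m e by (simp add: field_simps)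
        finally have 1: "\<bar>c - of_rat q\<bar> * m \<le> e / 2" .
        have "r * (LINT x|lborel. \<bar>indicator S x - indicator (\<Union>J) x\<bar>) \<le> r * (e / (2 * (r + 1)))"
          using J(4) r by (intro mult_left_mono) auto
        also have "\<dots> < e / 2" using r e by (simp add: field_simps)
        finally show ?thesis using 1 by simp
      qed
      finally show "\<exists>d\<in>D. (LINT x|lborel. \<bar>indicator S x *\<^sub>R c - d x\<bar>) < e"
        using bexI[OF _ D_ind[OF J(1,2,3), of q]] by simp
    qed
  next
    case (add g h)
    show ?case
    proof (intro allI impI)
      fix e :: real assume e: "e > 0"
      obtain d where d: "d \<in> D" "(LINT x|lborel. \<bar>g x - d x\<bar>) < e/2" using add.IH(1) e half_gt_zero by blast
      obtain d' where d': "d' \<in> D" "(LINT x|lborel. \<bar>h x - d' x\<bar>) < e/2" using add.IH(2) e half_gt_zero by blast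
      have i: "integrable lborel (\<lambda>x. g x - d x)" "integrable lborel (\<lambda>x. h x - d' x)"
        using add.hyps D_int d d' by auto
      have "(LINT x|lborel. \<bar>g x + h x - (d x + d' x)\<bar>) \<le> (LINT x|lborel. \<bar>g x - d x\<bar> + \<bar>h x - d' x\<bar>)"
        using add.hyps D_int d(1) d'(1)
        by (intro integral_mono integrable_add integrable_abs Bochner_Integration.integrable_diff) auto
      also have "\<dots> < e" using i d d' by simp
      finally show "\<exists>d\<in>D. (LINT x|lborel. \<bar>g x + h x - d x\<bar>) < e" using bexI[OF _ D_add[OF d(1) d'(1)]] by simp
    qed
  next
    case (lim g s)
    show ?case
    proof (intro allI impI)
      fix e :: real assume e: "e > 0"
      have "(\<lambda>n. LINT x|lborel. \<bar>g x - s n x\<bar>) \<longlonglongrightarrow> (LINT x|(lborel :: 'a measure). (0 :: real))"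
      \<comment> \<open>The approximants of \<open>integrable_induct\<close> are bounded by twice
        \<open>\<bar>g x\<bar>\<close>, which gives the factor 3 for the difference.\<close>
      proof (rule integral_dominated_convergence[where w = "\<lambda>x. 3 * \<bar>g x\<bar>"])
        show "integrable lborel (\<lambda>x. 3 * \<bar>g x\<bar>)" using lim by auto
        show "AE x in lborel. (\<lambda>n. \<bar>g x - s n x\<bar>) \<longlonglongrightarrow> 0"
        proof (intro AE_I2 tendsto_rabs_zero)
          fix x :: 'a
          have "(\<lambda>n. g x - s n x) \<longlonglongrightarrow> g x - g x"
            using lim(2)[of x] by (intro tendsto_intros) auto
          then show "(\<lambda>n. g x - s n x) \<longlonglongrightarrow> 0" by simp
        qed
        show "AE x in lborel. norm \<bar>g x - s n x\<bar> \<le> 3 * \<bar>g x\<bar>" for n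
        proof (rule AE_I2)
          fix x :: 'a
          have "\<bar>s n x\<bar> \<le> 2 * \<bar>g x\<bar>" using lim(3)[of x n] by simp
          then show "norm \<bar>g x - s n x\<bar> \<le> 3 * \<bar>g x\<bar>" by simp
        qed
      qed (use lim in auto)
      then obtain n where n: "(LINT x|lborel. \<bar>g x - s n x\<bar>) < e/2"
        using e LIMSEQ_D[of "\<lambda>n. LINT x|lborel. \<bar>g x - s n x\<bar>" _ "e/2"] by fastforce
      obtain d where d: "d \<in> D" "(LINT x|lborel. \<bar>s n x - d x\<bar>) < e/2" using lim.IH e half_gt_zero by blast
      have i: "integrable lborel (\<lambda>x. g x - s n x)" "integrable lborel (\<lambda>x. s n x - d x)"
        using lim D_int d by auto
      have "(LINT x|lborel. \<bar>g x - d x\<bar>) \<le> (LINT x|lborel. \<bar>g x - s n x\<bar> + \<bar>s n x - d x\<bar>)"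
        using lim D_int d(1)
        by (intro integral_mono integrable_add integrable_abs Bochner_Integration.integrable_diff) auto
      also have "\<dots> < e" using i n d by simp
      finally show "\<exists>d\<in>D. (LINT x|lborel. \<bar>g x - d x\<bar>) < e" using d by blast
    qed
  qed
  have "\<exists>d\<in>D. (LINT x|lebesgue. \<bar>g x - d x\<bar>) < e" if g: "integrable lebesgue g" and e: "e > 0" for g and e :: real
  proof -
    have "g \<in> borel_measurable (completion lborel)" using g by auto
    then obtain g' where g': "g' \<in> borel_measurable lborel" "AE x in lborel. g x = g' x"
      using completion_ex_borel_measurable_real by blast
    then have AE: "AE x in lebesgue. g x = g' x" by (simp add: AE_completion)
    have "integrable lebesgue g'"
      by (rule integrable_cong_AE_imp[OF g _ ]) (use g' AE in \<open>auto simp: measurable_completion\<close>)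
    then have "integrable lborel g'" using integrable_completion[OF g'(1)] by simp
    then obtain d where d: "d \<in> D" "(LINT x|lborel. \<bar>g' x - d x\<bar>) < e" using main e by blast
    have "(LINT x|lebesgue. \<bar>g x - d x\<bar>) = (LINT x|lebesgue. \<bar>g' x - d x\<bar>)"
    proof (rule integral_cong_AE)
      have [measurable]: "g \<in> borel_measurable lebesgue" "g' \<in> borel_measurable lebesgue"
        "d \<in> borel_measurable lebesgue"
        using g g'(1) bD[OF d(1)] by (auto intro: measurable_completion)
      show "(\<lambda>x. \<bar>g x - d x\<bar>) \<in> borel_measurable lebesgue"
        "(\<lambda>x. \<bar>g' x - d x\<bar>) \<in> borel_measurable lebesgue"
        by measurable
      show "AE x in lebesgue. \<bar>g x - d x\<bar> = \<bar>g' x - d x\<bar>" using AE by auto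
    qed
    also have "\<dots> = (LINT x|lborel. \<bar>g' x - d x\<bar>)"
      using g' bD[OF d(1)] by (intro integral_completion) auto
    finally show ?thesis using d by (intro bexI[of _ d]) auto
  qed
  with cD bD D_int show ?thesis by (intro that[of D])
qed

section \<open>The solution space\<close>

lemma Linf_iff: "g \<in> Linf M \<longleftrightarrow> g \<in> borel_measurable M \<and> (\<exists>C\<ge>0. AE x in M. \<bar>g x\<bar> \<le> C)"
proof
  assume g: "g \<in> Linf M"
  then have gm: "g \<in> borel_measurable M" and fin: "esssup M (\<lambda>x. ereal \<bar>g x\<bar>) < \<infinity>"
    by (auto simp: Linf_def)
  obtain C where C: "esssup M (\<lambda>x. ereal \<bar>g x\<bar>) \<le> ereal C"
    using fin by (cases "esssup M (\<lambda>x. ereal \<bar>g x\<bar>)") auto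
  have "AE x in M. \<bar>g x\<bar> \<le> max C 0"
    using esssup_AE[of "\<lambda>x. ereal \<bar>g x\<bar>" M]
  proof (rule AE_mp, intro AE_I2 impI)
    fix x assume "ereal \<bar>g x\<bar> \<le> esssup M (\<lambda>x. ereal \<bar>g x\<bar>)"
    then have "ereal \<bar>g x\<bar> \<le> ereal C" using C by (rule order_trans)
    then show "\<bar>g x\<bar> \<le> max C 0" by simp
  qed
  then show "g \<in> borel_measurable M \<and> (\<exists>C\<ge>0. AE x in M. \<bar>g x\<bar> \<le> C)"
    using gm by (intro conjI exI[of _ "max C 0"]) auto
next
  assume "g \<in> borel_measurable M \<and> (\<exists>C\<ge>0. AE x in M. \<bar>g x\<bar> \<le> C)"
  then obtain C where [measurable]: "g \<in> borel_measurable M" and C: "AE x in M. \<bar>g x\<bar> \<le> C" by blast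
  have "esssup M (\<lambda>x. ereal \<bar>g x\<bar>) \<le> ereal C"
    using C by (intro esssup_I) auto
  then show "g \<in> Linf M" by (auto simp: Linf_def)
qed

definition strip_dist :: "real \<Rightarrow> real set \<Rightarrow> (real \<times> real \<Rightarrow> real) \<Rightarrow> (real \<times> real \<Rightarrow> real) \<Rightarrow> real" where
  "strip_dist T K u v = (SUP t\<in>{0..T}. LINT x:K|lebesgue. \<bar>u (x, t) - v (x, t)\<bar>)"

lemma solution_topology_eq:
  "solution_topology T = pseudometrics_topology (solution_space T) {strip_dist T K | K. compact K}"
  unfolding solution_topology_def strip_dist_def[abs_def] ..

lemma L1loc_topology_eq:
  "L1loc_topology = pseudometrics_topology {g. \<forall>K. compact K \<longrightarrow> set_integrable lebesgue K g}
     ((\<lambda>K g h. LINT x:K|lebesgue. \<bar>g x - h x\<bar>) ` {K. compact K})"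
  unfolding L1loc_topology_def by (simp add: setcompr_eq_image)

lemma topspace_L1loc_topology:
  "topspace L1loc_topology = {g. \<forall>K. compact K \<longrightarrow> set_integrable lebesgue K g}"
  unfolding L1loc_topology_eq
  by (rule topspace_pseudometrics_topology) (auto intro: compact_empty)

lemma set_lint_le:
  fixes g h :: "real \<Rightarrow> real"
  assumes "set_integrable lebesgue K g" "set_integrable lebesgue K h" "\<And>x. x \<in> K \<Longrightarrow> g x \<le> h x"
  shows "(LINT x:K|lebesgue. g x) \<le> (LINT x:K|lebesgue. h x)"
  using assms unfolding set_lebesgue_integral_def set_integrable_def
  by (intro integral_mono) (auto simp: indicator_def)

lemma set_lint_triangle:
  fixes g h k :: "real \<Rightarrow> real"
  assumes "set_integrable lebesgue K g" "set_integrable lebesgue K h" "set_integrable lebesgue K k"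
  shows "(LINT x:K|lebesgue. \<bar>g x - k x\<bar>) \<le>
    (LINT x:K|lebesgue. \<bar>g x - h x\<bar>) + (LINT x:K|lebesgue. \<bar>h x - k x\<bar>)"
proof -
  have i: "set_integrable lebesgue K (\<lambda>x. \<bar>a x - b x\<bar>)"
    if "set_integrable lebesgue K a" "set_integrable lebesgue K b" for a b :: "real \<Rightarrow> real"
    using that by (intro set_integrable_abs set_integral_diff)
  have "(LINT x:K|lebesgue. \<bar>g x - k x\<bar>) \<le> (LINT x:K|lebesgue. \<bar>g x - h x\<bar> + \<bar>h x - k x\<bar>)"
    using assms by (intro set_lint_le set_integral_add i) auto
  also have "\<dots> = (LINT x:K|lebesgue. \<bar>g x - h x\<bar>) + (LINT x:K|lebesgue. \<bar>h x - k x\<bar>)"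
    using assms by (intro set_integral_add i)
  finally show ?thesis .
qed

lemma set_lint_mono_set:
  fixes g :: "real \<Rightarrow> real"
  assumes "set_integrable lebesgue K' g" "K \<subseteq> K'" "K \<in> sets lebesgue" "\<And>x. g x \<ge> 0"
  shows "(LINT x:K|lebesgue. g x) \<le> (LINT x:K'|lebesgue. g x)"
proof -
  have "set_integrable lebesgue K g" using set_integrable_subset assms by blast
  then show ?thesis using assms unfolding set_lebesgue_integral_def set_integrable_def
    by (intro integral_mono) (auto simp: indicator_def)
qed

section \<open>Time slices and the distances between solutions\<close>

locale time_strip =
  fixes T :: real
  assumes T_pos: "T > 0"
begin

abbreviation "E \<equiv> solution_space T"
abbreviation "strip \<equiv> lebesgue_on ((UNIV :: real set) \<times> {0..T})"

lemma slice_integrable: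
  assumes "u \<in> E" "t \<in> {0..T}" "compact K"
  shows "set_integrable lebesgue K (\<lambda>x. u (x, t))"
proof -
  have "continuous_map (top_of_set {0..T}) L1loc_topology (\<lambda>t x. u (x, t))"
    using assms by (simp add: solution_space_def)
  then have "(\<lambda>x. u (x, t)) \<in> topspace L1loc_topology"
    using assms(2) unfolding continuous_map_def by auto
  then show ?thesis using assms(3) by (simp add: topspace_L1loc_topology)
qed

lemma slice_diff_integrable:
  assumes "u \<in> E" "v \<in> E" "t \<in> {0..T}" "compact K"
  shows "set_integrable lebesgue K (\<lambda>x. \<bar>u (x, t) - v (x, t)\<bar>)"
  using assms by (intro set_integrable_abs set_integral_diff slice_integrable)

lemma E_L1loc_continuous:
  assumes u: "u \<in> E" and t: "t \<in> {0..T}" and K: "compact K" and e: "e > 0"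
  shows "\<exists>d>0. \<forall>s\<in>{0..T}. \<bar>s - t\<bar> < d \<longrightarrow> (LINT x:K|lebesgue. \<bar>u (x, t) - u (x, s)\<bar>) < e"
proof -
  have c: "continuous_map (top_of_set {0..T}) L1loc_topology (\<lambda>t x. u (x, t))"
    using u by (simp add: solution_space_def)
  define B where "B = {g \<in> {g. \<forall>K. compact K \<longrightarrow> set_integrable lebesgue K g}.
    (LINT x:K|lebesgue. \<bar>u (x, t) - g x\<bar>) < e}"
  have "openin L1loc_topology B"
    unfolding L1loc_topology_eq B_def
    using slice_integrable[OF u t] K e
    by (intro openin_pseudometrics_topology_ball[where d = "\<lambda>g h. LINT x:K|lebesgue. \<bar>g x - h x\<bar>"
          and u = "\<lambda>x. u (x, t)"]) auto
  then have "openin (top_of_set {0..T}) {s \<in> topspace (top_of_set {0..T}). (\<lambda>x. u (x, s)) \<in> B}"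
    using c by (rule openin_continuous_map_preimage[rotated])
  moreover have "t \<in> {s \<in> topspace (top_of_set {0..T}). (\<lambda>x. u (x, s)) \<in> B}"
    using t e slice_integrable[OF u t] by (auto simp: B_def)
  ultimately obtain d where d: "d > 0"
    "\<And>s. s \<in> {0..T} \<Longrightarrow> dist s t < d \<Longrightarrow> s \<in> {s \<in> topspace (top_of_set {0..T}). (\<lambda>x. u (x, s)) \<in> B}"
    unfolding openin_euclidean_subtopology_iff by meson
  then show ?thesis unfolding B_def by (intro exI[of _ d]) (auto simp: dist_real_def)
qed

lemma E_L1loc_continuousI:
  assumes int: "\<And>t K. t \<in> {0..T} \<Longrightarrow> compact K \<Longrightarrow> set_integrable lebesgue K (\<lambda>x. u (x, t))"
    and cont: "\<And>t K e. t \<in> {0..T} \<Longrightarrow> compact K \<Longrightarrow> e > 0 \<Longrightarrow>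
      \<exists>d>0. \<forall>s\<in>{0..T}. \<bar>s - t\<bar> < d \<longrightarrow> (LINT x:K|lebesgue. \<bar>u (x, t) - u (x, s)\<bar>) < e"
  shows "continuous_map (top_of_set {0..T}) L1loc_topology (\<lambda>t x. u (x, t))"
  unfolding L1loc_topology_eq pseudometrics_topology_def
proof (rule continuous_on_generated_topo)
  let ?X = "{g :: real \<Rightarrow> real. \<forall>K. compact K \<longrightarrow> set_integrable lebesgue K g}"
  let ?D = "(\<lambda>K g h. LINT x:K|lebesgue. \<bar>g x - h x\<bar> :: real) ` {K :: real set. compact K}"
  show "(\<lambda>t x. u (x, t)) ` topspace (top_of_set {0..T}) \<subseteq>
      \<Union>{{v \<in> ?X. d w v < e} |w d e. w \<in> ?X \<and> d \<in> ?D \<and> e > 0}"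
  proof (rule image_subsetI)
    fix t assume "t \<in> topspace (top_of_set {0..T})"
    then have "(\<lambda>x. u (x, t)) \<in> topspace L1loc_topology"
      using int by (simp add: topspace_L1loc_topology)
    then show "(\<lambda>x. u (x, t)) \<in> \<Union>{{v \<in> ?X. d w v < e} |w d e. w \<in> ?X \<and> d \<in> ?D \<and> e > 0}"
      unfolding L1loc_topology_eq pseudometrics_topology_def topology_generated_by_topspace .
  qed
  fix U assume "U \<in> {{v \<in> ?X. d w v < e} |w d e. w \<in> ?X \<and> d \<in> ?D \<and> e > 0}"
  then obtain w K e where w: "w \<in> ?X" and K: "compact K" and e: "e > 0"
    and U: "U = {v \<in> ?X. (LINT x:K|lebesgue. \<bar>w x - v x\<bar>) < e}" by blast
  have eq: "(\<lambda>t x. u (x, t)) -` U \<inter> topspace (top_of_set {0..T}) =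
    {t \<in> {0..T}. (LINT x:K|lebesgue. \<bar>w x - u (x, t)\<bar>) < e}"
    using int by (auto simp: U)
  show "openin (top_of_set {0..T}) ((\<lambda>t x. u (x, t)) -` U \<inter> topspace (top_of_set {0..T}))"
    unfolding eq openin_euclidean_subtopology_iff
  proof (intro conjI ballI)
    fix t assume "t \<in> {t \<in> {0..T}. (LINT x:K|lebesgue. \<bar>w x - u (x, t)\<bar>) < e}"
    then have t: "t \<in> {0..T}" "(LINT x:K|lebesgue. \<bar>w x - u (x, t)\<bar>) < e" by auto
    \<comment> \<open>A subbasic ball has an arbitrary centre \<open>w\<close>; \<open>e'\<close> is
      the room left between the slice at \<open>t\<close> and the boundary of the ball.\<close>
    define e' where "e' = e - (LINT x:K|lebesgue. \<bar>w x - u (x, t)\<bar>)"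
    have "e' > 0" using t by (simp add: e'_def)
    then obtain d where d: "d > 0"
      "\<And>s. s \<in> {0..T} \<Longrightarrow> \<bar>s - t\<bar> < d \<Longrightarrow> (LINT x:K|lebesgue. \<bar>u (x, t) - u (x, s)\<bar>) < e'"
      using cont[OF t(1) K] by blast
    show "\<exists>d>0. \<forall>s\<in>{0..T}. dist s t < d \<longrightarrow> s \<in> {t \<in> {0..T}. (LINT x:K|lebesgue. \<bar>w x - u (x, t)\<bar>) < e}"
    proof (intro exI[of _ d] conjI ballI impI d(1))
      fix s assume s: "s \<in> {0..T}" "dist s t < d"
      have "(LINT x:K|lebesgue. \<bar>w x - u (x, s)\<bar>) \<le>
        (LINT x:K|lebesgue. \<bar>w x - u (x, t)\<bar>) + (LINT x:K|lebesgue. \<bar>u (x, t) - u (x, s)\<bar>)"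
        using w K s t by (intro set_lint_triangle int) auto
      also have "\<dots> < e" using d(2)[of s] s by (simp add: dist_real_def e'_def)
      finally show "s \<in> {t \<in> {0..T}. (LINT x:K|lebesgue. \<bar>w x - u (x, t)\<bar>) < e}" using s by simp
    qed
  qed auto
qed

lemma slice_dist_continuous_on:
  assumes u: "u \<in> E" and v: "v \<in> E" and K: "compact K"
  shows "continuous_on {0..T} (\<lambda>t. LINT x:K|lebesgue. \<bar>u (x, t) - v (x, t)\<bar>)" (is "continuous_on _ ?F")
  unfolding continuous_on_iff
proof (intro ballI allI impI)
  fix t and e :: real assume t: "t \<in> {0..T}" and "e > 0"
  then have e: "e / 2 > 0" by simp
  obtain d where d: "d > 0"
    "\<And>s. s \<in> {0..T} \<Longrightarrow> \<bar>s - t\<bar> < d \<Longrightarrow> (LINT x:K|lebesgue. \<bar>u (x, t) - u (x, s)\<bar>) < e/2"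
    using E_L1loc_continuous[OF u t K e] by blast
  obtain d' where d': "d' > 0"
    "\<And>s. s \<in> {0..T} \<Longrightarrow> \<bar>s - t\<bar> < d' \<Longrightarrow> (LINT x:K|lebesgue. \<bar>v (x, t) - v (x, s)\<bar>) < e/2"
    using E_L1loc_continuous[OF v t K e] by blast
  show "\<exists>d>0. \<forall>s\<in>{0..T}. dist s t < d \<longrightarrow> dist (?F s) (?F t) < e"
  proof (intro exI[of _ "min d d'"] conjI ballI impI)
    fix s assume s: "s \<in> {0..T}" "dist s t < min d d'"
    note tri = set_lint_triangle[OF slice_integrable[OF _ _ K] slice_integrable[OF _ _ K] slice_integrable[OF _ _ K]]
    have sw: "(LINT x:K|lebesgue. \<bar>a x - b x\<bar>) = (LINT x:K|lebesgue. \<bar>b x - a x\<bar>)" for a b :: "real \<Rightarrow> real"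
      by (simp add: abs_minus_commute)
    \<comment> \<open>Each triangle inequality changes the time in one argument only; two of them
      bound the variation of \<open>?F\<close> in either direction.\<close>
    have "?F s \<le> (LINT x:K|lebesgue. \<bar>u (x, s) - u (x, t)\<bar>) + (LINT x:K|lebesgue. \<bar>u (x, t) - v (x, s)\<bar>)"
      using tri[OF u s(1) u t v s(1)] .
    moreover have "(LINT x:K|lebesgue. \<bar>u (x, t) - v (x, s)\<bar>) \<le> ?F t + (LINT x:K|lebesgue. \<bar>v (x, t) - v (x, s)\<bar>)"
      using tri[OF u t v t v s(1)] .
    moreover have "?F t \<le> (LINT x:K|lebesgue. \<bar>u (x, t) - u (x, s)\<bar>) + (LINT x:K|lebesgue. \<bar>u (x, s) - v (x, t)\<bar>)"
      using tri[OF u t u s(1) v t] .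
    moreover have "(LINT x:K|lebesgue. \<bar>u (x, s) - v (x, t)\<bar>) \<le> ?F s + (LINT x:K|lebesgue. \<bar>v (x, s) - v (x, t)\<bar>)"
      using tri[OF u s(1) v s(1) v t] .
    moreover have "(LINT x:K|lebesgue. \<bar>u (x, t) - u (x, s)\<bar>) < e/2" "(LINT x:K|lebesgue. \<bar>v (x, t) - v (x, s)\<bar>) < e/2"
      using d(2)[of s] d'(2)[of s] s by (auto simp: dist_real_def)
    moreover have "(LINT x:K|lebesgue. \<bar>u (x, s) - u (x, t)\<bar>) = (LINT x:K|lebesgue. \<bar>u (x, t) - u (x, s)\<bar>)"
      "(LINT x:K|lebesgue. \<bar>v (x, s) - v (x, t)\<bar>) = (LINT x:K|lebesgue. \<bar>v (x, t) - v (x, s)\<bar>)"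
      by (rule sw)+
    ultimately show "dist (?F s) (?F t) < e" unfolding dist_real_def by linarith
  qed (use d d' in auto)
qed

text \<open>A real supremum carries information only for a bounded family, so estimating slices by
  \<open>strip_dist\<close> rests on this bound, which comes from compactness of the time
  interval.\<close>

lemma slice_dist_bdd_above:
  assumes "u \<in> E" "v \<in> E" "compact K"
  shows "bdd_above ((\<lambda>t. LINT x:K|lebesgue. \<bar>u (x, t) - v (x, t)\<bar>) ` {0..T})"
  using compact_continuous_image[OF slice_dist_continuous_on[OF assms]]
  by (intro bounded_imp_bdd_above compact_imp_bounded) auto

lemma slice_le_strip_dist:
  assumes "u \<in> E" "v \<in> E" "compact K" "t \<in> {0..T}"
  shows "(LINT x:K|lebesgue. \<bar>u (x, t) - v (x, t)\<bar>) \<le> strip_dist T K u v"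
  unfolding strip_dist_def using assms by (intro cSUP_upper slice_dist_bdd_above)

lemma strip_dist_leI:
  assumes "\<And>t. t \<in> {0..T} \<Longrightarrow> (LINT x:K|lebesgue. \<bar>u (x, t) - v (x, t)\<bar>) \<le> r"
  shows "strip_dist T K u v \<le> r"
  unfolding strip_dist_def using assms T_pos by (intro cSUP_least) auto

lemma strip_dist_self: "strip_dist T K u u = 0"
  unfolding strip_dist_def set_lebesgue_integral_def using T_pos by simp

lemma strip_dist_commute: "strip_dist T K u v = strip_dist T K v u"
  unfolding strip_dist_def by (simp add: abs_minus_commute)

lemma strip_dist_triangle:
  assumes "u \<in> E" "v \<in> E" "w \<in> E" "compact K"
  shows "strip_dist T K u w \<le> strip_dist T K u v + strip_dist T K v w"
proof (rule strip_dist_leI)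
  fix t assume t: "t \<in> {0..T}"
  have "(LINT x:K|lebesgue. \<bar>u (x, t) - w (x, t)\<bar>) \<le>
    (LINT x:K|lebesgue. \<bar>u (x, t) - v (x, t)\<bar>) + (LINT x:K|lebesgue. \<bar>v (x, t) - w (x, t)\<bar>)"
    using assms t by (intro set_lint_triangle slice_integrable)
  also have "\<dots> \<le> strip_dist T K u v + strip_dist T K v w"
    using assms t by (intro add_mono slice_le_strip_dist)
  finally show "(LINT x:K|lebesgue. \<bar>u (x, t) - w (x, t)\<bar>) \<le> strip_dist T K u v + strip_dist T K v w" .
qed

lemma strip_dist_mono:
  assumes "u \<in> E" "v \<in> E" "compact K'" "compact K" "K \<subseteq> K'"
  shows "strip_dist T K u v \<le> strip_dist T K' u v"
proof (rule strip_dist_leI)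
  fix t assume t: "t \<in> {0..T}"
  have "(LINT x:K|lebesgue. \<bar>u (x, t) - v (x, t)\<bar>) \<le> (LINT x:K'|lebesgue. \<bar>u (x, t) - v (x, t)\<bar>)"
    using assms t by (intro set_lint_mono_set slice_diff_integrable) (auto intro: fmeasurableD lmeasurable_compact)
  also have "\<dots> \<le> strip_dist T K' u v" using assms t by (intro slice_le_strip_dist)
  finally show "(LINT x:K|lebesgue. \<bar>u (x, t) - v (x, t)\<bar>) \<le> strip_dist T K' u v" .
qed

definition dE :: "nat \<Rightarrow> (real \<times> real \<Rightarrow> real) \<Rightarrow> (real \<times> real \<Rightarrow> real) \<Rightarrow> real" where
  "dE n = strip_dist T {- real n..real n}"

sublocale pseudometric_sequence "solution_space T" "{strip_dist T K | K. compact K}" dE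
proof
  show "dE n \<in> {strip_dist T K |K. compact K}" for n by (auto simp: dE_def)
  show "\<exists>n. \<forall>u\<in>E. \<forall>v\<in>E. d u v \<le> dE n u v" if "d \<in> {strip_dist T K |K. compact K}" for d
  proof -
    obtain K where K: "d = strip_dist T K" "compact K" using \<open>d \<in> _\<close> by blast
    then obtain b where b: "\<And>x. x \<in> K \<Longrightarrow> \<bar>x\<bar> \<le> b"
      using compact_imp_bounded[OF K(2)] unfolding bounded_real by blast
    obtain n where "b \<le> real n" using real_arch_simple by blast
    have "K \<subseteq> {- real n..real n}"
    proof
      fix x assume "x \<in> K"
      then show "x \<in> {- real n..real n}" using b[of x] \<open>b \<le> real n\<close> by (simp add: abs_le_iff)
    qed
    then show ?thesis unfolding dE_def K(1) using K(2) by (intro exI[of _ n] ballI strip_dist_mono) auto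
  qed
  show "dE m u v \<le> dE n u v" if "m \<le> n" "u \<in> E" "v \<in> E" for m n u v
    unfolding dE_def using that by (intro strip_dist_mono) auto
qed (auto simp: strip_dist_self intro: strip_dist_triangle strip_dist_commute)

end

text \<open>Increments with summable norms form a telescoping series that converges absolutely
  almost everywhere, hence the Cauchy property; Fatou's lemma then carries the tail estimate to the
  limit. The factor 2 is the sum of the geometric tail. Increments are controlled only from
  \<open>n\<close> on, as is the case on a fixed interval when the k-th distance refers to the
  interval of radius k.\<close>

lemma L1_fast_Cauchy:
  fixes f :: "nat \<Rightarrow> 'a \<Rightarrow> real"
  assumes int: "\<And>k. integrable M (f k)"
    and fast: "\<And>k. k \<ge> n \<Longrightarrow> (LINT x|M. \<bar>f k x - f (Suc k) x\<bar>) \<le> (1/2)^k"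
  shows "AE x in M. Cauchy (\<lambda>k. f k x)"
    and "g \<in> borel_measurable M \<Longrightarrow> AE x in M. (\<lambda>k. f k x) \<longlonglongrightarrow> g x \<Longrightarrow>
      integrable M g \<and> (\<forall>k\<ge>n. (LINT x|M. \<bar>f k x - g x\<bar>) \<le> 2 * (1/2)^k)"
proof -
  have [measurable]: "f k \<in> borel_measurable M" for k using int by auto
  define a where "a k x = \<bar>f (k + n) x - f (Suc k + n) x\<bar>" for k x
  have a_int: "integrable M (a k)" for k unfolding a_def using int by auto
  have "(\<integral>\<^sup>+x. (\<Sum>k. ennreal (a k x)) \<partial>M) = (\<Sum>k. \<integral>\<^sup>+x. ennreal (a k x) \<partial>M)"
    using a_int by (intro nn_integral_suminf) auto
  also have "\<dots> = (\<Sum>k. ennreal (LINT x|M. a k x))"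
    by (intro suminf_cong nn_integral_eq_integral a_int) (simp add: a_def)
  also have "\<dots> \<le> (\<Sum>k. ennreal ((1/2)^k))"
  proof (intro suminf_le ennreal_leI)
    fix k
    have "(LINT x|M. a k x) \<le> (1/2)^(k + n)" unfolding a_def using fast[of "k + n"] by simp
    also have "\<dots> \<le> (1/2::real)^k" by (intro power_decreasing) auto
    finally show "(LINT x|M. a k x) \<le> (1/2)^k" .
  qed auto
  also have "\<dots> < \<infinity>"
    unfolding infinity_ennreal_def less_top[symmetric]
    by (rule ennreal_suminf_neq_top) (simp_all add: summable_geometric)
  finally have "AE x in M. (\<Sum>k. ennreal (a k x)) \<noteq> \<infinity>"
    using a_int by (intro nn_integral_PInf_AE) auto
  then show conv: "AE x in M. Cauchy (\<lambda>k. f k x)"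
  proof (rule AE_mp, intro AE_I2 impI)
    fix x assume "(\<Sum>k. ennreal (a k x)) \<noteq> \<infinity>"
    then have "summable (\<lambda>k. a k x)"
      using summable_iff_suminf_neq_top[of "\<lambda>k. a k x"] by (auto simp: a_def)
    then have "summable (\<lambda>k. f (k + n) x - f (Suc k + n) x)"
      unfolding a_def by (rule summable_rabs_cancel)
    then have "convergent (\<lambda>m. \<Sum>k<m. f (k + n) x - f (Suc k + n) x)"
      by (simp add: summable_iff_convergent)
    moreover have "(\<Sum>k<m. f (k + n) x - f (Suc k + n) x) = f n x - f (m + n) x" for m
      by (induction m) auto
    ultimately have "convergent (\<lambda>m. f n x - f (m + n) x)" by simp
    then have "convergent (\<lambda>m. f n x - (f n x - f (m + n) x))" by (rule convergent_diff[OF convergent_const])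
    moreover have "(\<lambda>m. f n x - (f n x - f (m + n) x)) = (\<lambda>m. f (m + n) x)" by (intro ext) simp
    ultimately have "convergent (\<lambda>m. f (m + n) x)" by (simp only:)
    then have "convergent (\<lambda>m. f m x)" using convergent_ignore_initial_segment[of "\<lambda>m. f m x" n] by simp
    then show "Cauchy (\<lambda>k. f k x)" by (rule convergent_Cauchy)
  qed
  assume gm: "g \<in> borel_measurable M" and lim: "AE x in M. (\<lambda>k. f k x) \<longlonglongrightarrow> g x"
  note gm[measurable]
  \<comment> \<open>The right-hand side is the geometric sum over the \<open>j\<close> indices
    starting at \<open>k\<close>.\<close>
  have step: "(LINT x|M. \<bar>f k x - f (k + j) x\<bar>) \<le> 2 * (1/2)^k - 2 * (1/2)^(k + j)" if "k \<ge> n" for k j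
  proof (induction j)
    case (Suc j)
    have "(LINT x|M. \<bar>f k x - f (k + Suc j) x\<bar>) \<le>
        (LINT x|M. \<bar>f k x - f (k + j) x\<bar> + \<bar>f (k + j) x - f (Suc (k + j)) x\<bar>)"
      using int by (intro integral_mono integrable_add integrable_abs Bochner_Integration.integrable_diff) auto
    also have "\<dots> = (LINT x|M. \<bar>f k x - f (k + j) x\<bar>) + (LINT x|M. \<bar>f (k + j) x - f (Suc (k + j)) x\<bar>)"
      using int by (intro Bochner_Integration.integral_add integrable_abs Bochner_Integration.integrable_diff) auto
    also have "\<dots> \<le> 2 * (1/2)^k - 2 * (1/2)^(k + j) + (1/2)^(k + j)"
      using Suc fast[of "k + j"] that by (intro add_mono) auto
    also have "\<dots> = 2 * (1/2)^k - 2 * (1/2)^(k + Suc j)" by simp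
    finally show ?case .
  qed simp
  have nn: "(\<integral>\<^sup>+x. ennreal \<bar>f k x - g x\<bar> \<partial>M) \<le> ennreal (2 * (1/2)^k)" if k: "k \<ge> n" for k
  proof -
    have "(\<integral>\<^sup>+x. ennreal \<bar>f k x - g x\<bar> \<partial>M) = (\<integral>\<^sup>+x. liminf (\<lambda>j. ennreal \<bar>f k x - f (k + j) x\<bar>) \<partial>M)"
    proof (rule nn_integral_cong_AE, rule AE_mp[OF lim], intro AE_I2 impI)
      fix x assume "(\<lambda>k. f k x) \<longlonglongrightarrow> g x"
      then have "(\<lambda>j. f (k + j) x) \<longlonglongrightarrow> g x" by (subst add.commute) (rule LIMSEQ_ignore_initial_segment)
      then have "(\<lambda>j. ennreal \<bar>f k x - f (k + j) x\<bar>) \<longlonglongrightarrow> ennreal \<bar>f k x - g x\<bar>"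
        by (intro tendsto_ennrealI tendsto_intros)
      then show "ennreal \<bar>f k x - g x\<bar> = liminf (\<lambda>j. ennreal \<bar>f k x - f (k + j) x\<bar>)"
        by (intro lim_imp_Liminf[symmetric]) auto
    qed
    also have "\<dots> \<le> liminf (\<lambda>j. \<integral>\<^sup>+x. ennreal \<bar>f k x - f (k + j) x\<bar> \<partial>M)"
      by (intro nn_integral_liminf) auto
    also have "\<dots> \<le> limsup (\<lambda>j. \<integral>\<^sup>+x. ennreal \<bar>f k x - f (k + j) x\<bar> \<partial>M)"
      by (intro Liminf_le_Limsup) auto
    also have "\<dots> \<le> ennreal (2 * (1/2)^k)"
    proof (intro Limsup_bounded always_eventually allI)
      fix j
      have "(\<integral>\<^sup>+x. ennreal \<bar>f k x - f (k + j) x\<bar> \<partial>M) = ennreal (LINT x|M. \<bar>f k x - f (k + j) x\<bar>)"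
        using int by (intro nn_integral_eq_integral) auto
      also have "\<dots> \<le> ennreal (2 * (1/2)^k)"
        using step[OF k, of j] zero_le_power[of "1/2 :: real" "k + j"] by (intro ennreal_leI) linarith
      finally show "(\<integral>\<^sup>+x. ennreal \<bar>f k x - f (k + j) x\<bar> \<partial>M) \<le> ennreal (2 * (1/2)^k)" .
    qed
    finally show ?thesis .
  qed
  have di: "integrable M (\<lambda>x. f k x - g x)" if "k \<ge> n" for k
    using nn[OF that] by (intro integrableI_bounded) (auto simp: le_less_trans)
  show "integrable M g \<and> (\<forall>k\<ge>n. (LINT x|M. \<bar>f k x - g x\<bar>) \<le> 2 * (1/2)^k)"
  proof (intro conjI allI impI)
    have "integrable M (\<lambda>x. f n x - (f n x - g x))" by (rule Bochner_Integration.integrable_diff[OF int di]) simp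
    then show "integrable M g" by simp
    fix k assume k: "k \<ge> n"
    have "ennreal (LINT x|M. \<bar>f k x - g x\<bar>) = (\<integral>\<^sup>+x. ennreal \<bar>f k x - g x\<bar> \<partial>M)"
      using di[OF k] by (intro nn_integral_eq_integral[symmetric]) auto
    also have "\<dots> \<le> ennreal (2 * (1/2)^k)" by (rule nn[OF k])
    finally show "(LINT x|M. \<bar>f k x - g x\<bar>) \<le> 2 * (1/2)^k" by simp
  qed
qed

lemma borel_fst: "fst \<in> borel_measurable (borel :: ('a::second_countable_topology \<times> 'b::second_countable_topology) measure)"
  by (intro borel_measurable_continuous_onI continuous_intros)

text \<open>Fubini for null sets, with time as the outer variable. The exceptional set is first
  enlarged to a Borel null set because exchanging the two quantifiers requires
  measurability.\<close>

lemma AE_lborel_slices: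
  assumes "AE z in (lborel :: (real \<times> real) measure). P z"
  shows "AE t in lborel. AE x in lborel. P (x, t)"
proof -
  obtain N where N: "N \<in> null_sets lborel" "{z. \<not> P z} \<subseteq> N"
    using assms unfolding eventually_ae_filter by auto
  have [measurable]: "N \<in> sets (lborel \<Otimes>\<^sub>M lborel)" using N(1) unfolding lborel_prod by auto
  have "AE z in lborel \<Otimes>\<^sub>M lborel. z \<notin> N" using AE_not_in[OF N(1)] unfolding lborel_prod .
  then have "AE x in lborel. AE t in lborel. (x, t) \<notin> N" by (rule lborel_pair.AE_pair)
  then have "AE t in lborel. AE x in lborel. (x, t) \<notin> N"
  proof (subst (asm) lborel_pair.AE_commute)
    have "{z \<in> space (lborel \<Otimes>\<^sub>M lborel). (fst z, snd z) \<notin> N} = space (lborel \<Otimes>\<^sub>M lborel) - N"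
      by auto
    also have "\<dots> \<in> sets (lborel \<Otimes>\<^sub>M lborel)" by measurable
    finally show "{z \<in> space (lborel \<Otimes>\<^sub>M lborel). (fst z, snd z) \<notin> N} \<in> sets (lborel \<Otimes>\<^sub>M lborel)" .
  qed
  then show ?thesis using N(2) by (auto elim!: eventually_mono)
qed

section \<open>Integration over the strip by slices\<close>

context time_strip
begin

lemma strip_set: "(UNIV :: real set) \<times> {0..T} \<in> sets lebesgue" "(UNIV :: real set) \<times> {0..T} \<in> sets borel"
proof -
  have "closed ((UNIV :: real set) \<times> {0..T})" by (intro closed_Times) auto
  then show "(UNIV :: real set) \<times> {0..T} \<in> sets borel" by (rule borel_closed)
  then show "(UNIV :: real set) \<times> {0..T} \<in> sets lebesgue" by auto
qed

lemma strip_Int_space: "(UNIV :: real set) \<times> {0..T} \<inter> space lebesgue \<in> sets lebesgue"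
  using strip_set by simp

lemma AE_strip_iff: "(AE z in strip. P z) \<longleftrightarrow> (AE z in lebesgue. z \<in> UNIV \<times> {0..T} \<longrightarrow> P z)"
  by (rule AE_restrict_space_iff[OF strip_Int_space])

text \<open>The cylinder over a null set of the line is null in the plane; in this way the
  exceptional set of the flux disappears from planar integrals.\<close>

lemma AE_strip_fst:
  assumes "AE x in lebesgue. P x"
  shows "AE z in strip. P (fst z)"
proof -
  have "AE x in lborel. P x" using assms by (simp add: AE_completion_iff)
  then obtain N where N: "N \<in> null_sets lborel" "{x. \<not> P x} \<subseteq> N"
    unfolding eventually_ae_filter by auto
  have [measurable]: "N \<in> sets lborel" using N by auto
  have "AE z in lborel \<Otimes>\<^sub>M (lborel :: real measure). fst z \<notin> N"
  proof (rule lborel_pair.AE_pair_measure)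
    show "{z \<in> space (lborel \<Otimes>\<^sub>M lborel). fst z \<notin> N} \<in> sets (lborel \<Otimes>\<^sub>M (lborel :: real measure))"
      by measurable
    show "AE x in lborel. AE y in lborel. fst (x, y) \<notin> N"
      using AE_not_in[OF N(1)] by (auto elim!: eventually_mono)
  qed
  then have "AE z in (lborel :: (real \<times> real) measure). P (fst z)"
    unfolding lborel_prod using N(2) by (auto elim!: eventually_mono)
  then show ?thesis unfolding AE_strip_iff by (intro AE_completion) (auto elim!: eventually_mono)
qed

text \<open>Slices of a function measurable for the completed planar measure need not be measurable.
  A Borel version has measurable slices, and at almost every time they agree almost everywhere with
  the original ones.\<close>

lemma strip_borel_version:
  assumes g: "g \<in> borel_measurable strip"
  obtains g' :: "real \<times> real \<Rightarrow> real" where "g' \<in> borel_measurable borel" "AE z in strip. g z = g' z"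
    "AE t in lborel. t \<in> {0..T} \<longrightarrow> (AE x in lborel. g (x, t) = g' (x, t))"
proof -
  let ?h = "\<lambda>z. indicator (UNIV \<times> {0..T}) z *\<^sub>R g z"
  have "?h \<in> borel_measurable lebesgue"
    using g by (subst (asm) borel_measurable_restrict_space_iff[OF strip_Int_space])
  then obtain g' where g': "g' \<in> borel_measurable lborel" "AE z in lborel. ?h z = g' z"
    using completion_ex_borel_measurable_real by blast
  show thesis
  proof (rule that)
    show "g' \<in> borel_measurable borel" using g'(1) by simp
    show "AE z in strip. g z = g' z"
      unfolding AE_strip_iff using g'(2) by (intro AE_completion) (auto elim!: eventually_mono)
    show "AE t in lborel. t \<in> {0..T} \<longrightarrow> (AE x in lborel. g (x, t) = g' (x, t))"
      using AE_lborel_slices[OF g'(2)] by eventually_elim (auto elim!: eventually_mono)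
  qed
qed

text \<open>Tonelli's theorem for a Borel version: the bound \<open>r\<close> on the slices is
  integrated over a time interval of length \<open>T\<close>. Integrability of the slices is a
  separate hypothesis because planar measurability does not give it at each time.\<close>

lemma strip_integral_le:
  assumes g: "g \<in> borel_measurable strip" and K: "compact K" and "r \<ge> 0"
    and int: "\<And>t. t \<in> {0..T} \<Longrightarrow> set_integrable lebesgue K (\<lambda>x. g (x, t))"
    and le: "\<And>t. t \<in> {0..T} \<Longrightarrow> (LINT x:K|lebesgue. \<bar>g (x, t)\<bar>) \<le> r"
  shows "integrable strip (\<lambda>z. indicator K (fst z) * \<bar>g z\<bar>)"
    and "(LINT z|strip. indicator K (fst z) * \<bar>g z\<bar>) \<le> T * r"
proof -
  obtain g' where g': "g' \<in> borel_measurable borel" "AE z in strip. g z = g' z"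
    "AE t in lborel. t \<in> {0..T} \<longrightarrow> (AE x in lborel. g (x, t) = g' (x, t))"
    using strip_borel_version[OF g] .
  have [measurable]: "K \<in> sets borel" using K by (rule borel_compact)
  note g'(1)[measurable]
  let ?S = "(UNIV :: real set) \<times> {0..T}"
  let ?k = "\<lambda>z. ennreal (indicator K (fst z) * \<bar>g' z\<bar>) * indicator ?S z"
  have fstK: "(\<lambda>z :: real \<times> real. indicator K (fst z) :: real) \<in> borel_measurable borel"
    by (rule measurable_compose[OF borel_fst]) measurable
  note this[measurable]
  have "(\<lambda>z. indicator K (fst z) :: real) \<in> borel_measurable strip"
    using measurable_completion[of "\<lambda>z :: real \<times> real. indicator K (fst z) :: real" lborel borel] fstK
    by (intro measurable_restrict_space1) simp
  then have m: "(\<lambda>z. indicator K (fst z) * \<bar>g z\<bar>) \<in> borel_measurable strip"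
    using g by measurable
  have [measurable]: "?S \<in> sets borel" by (rule strip_set)
  have kb: "?k \<in> borel_measurable borel" by measurable
  have "(\<integral>\<^sup>+z. ennreal (indicator K (fst z) * \<bar>g z\<bar>) \<partial>strip) = (\<integral>\<^sup>+z. ennreal (indicator K (fst z) * \<bar>g' z\<bar>) \<partial>strip)"
    using g'(2) by (intro nn_integral_cong_AE) (auto elim!: eventually_mono)
  also have "\<dots> = (\<integral>\<^sup>+z. ?k z \<partial>lebesgue)" by (rule nn_integral_restrict_space[OF strip_Int_space])
  also have "\<dots> = (\<integral>\<^sup>+z. ?k z \<partial>lborel)" by (rule nn_integral_completion)
  also have "\<dots> = (\<integral>\<^sup>+t. (\<integral>\<^sup>+x. ?k (x, t) \<partial>lborel) \<partial>lborel)"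
    using lborel_pair.nn_integral_snd[of ?k] kb unfolding lborel_prod by simp
  also have "\<dots> \<le> (\<integral>\<^sup>+t. ennreal r * indicator {0..T} t \<partial>lborel)"
  proof (intro nn_integral_mono_AE)
    show "AE t in lborel. (\<integral>\<^sup>+x. ?k (x, t) \<partial>lborel) \<le> ennreal r * indicator {0..T} t"
      using g'(3)
    proof eventually_elim
      case (elim t)
      show ?case
      proof (cases "t \<in> {0..T}")
        case True
        have "(\<integral>\<^sup>+x. ?k (x, t) \<partial>lborel) = (\<integral>\<^sup>+x. ?k (x, t) \<partial>lebesgue)"
          by (rule nn_integral_completion[symmetric])
        also have "\<dots> = (\<integral>\<^sup>+x. ennreal (indicator K x * \<bar>g (x, t)\<bar>) \<partial>lebesgue)"
          using elim True
          by (intro nn_integral_cong_AE AE_completion) (auto elim!: eventually_mono)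
        also have "\<dots> = ennreal (LINT x:K|lebesgue. \<bar>g (x, t)\<bar>)"
          unfolding set_lebesgue_integral_def
          using set_integrable_abs[OF int[OF True]]
          by (subst nn_integral_eq_integral) (auto simp: set_integrable_def)
        also have "\<dots> \<le> ennreal r" using le[OF True] by (rule ennreal_leI)
        finally show ?thesis using True by simp
      qed simp
    qed
  qed
  also have "\<dots> = ennreal (T * r)"
    using T_pos \<open>r \<ge> 0\<close> by (simp add: nn_integral_cmult_indicator ennreal_mult' mult.commute)
  finally have nn: "(\<integral>\<^sup>+z. ennreal (indicator K (fst z) * \<bar>g z\<bar>) \<partial>strip) \<le> ennreal (T * r)" .
  show i: "integrable strip (\<lambda>z. indicator K (fst z) * \<bar>g z\<bar>)"
    using nn m by (intro integrableI_bounded) (auto simp: le_less_trans)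
  have "ennreal (LINT z|strip. indicator K (fst z) * \<bar>g z\<bar>) = (\<integral>\<^sup>+z. ennreal (indicator K (fst z) * \<bar>g z\<bar>) \<partial>strip)"
    using i by (intro nn_integral_eq_integral[symmetric]) auto
  with nn have "ennreal (LINT z|strip. indicator K (fst z) * \<bar>g z\<bar>) \<le> ennreal (T * r)" by simp
  moreover have "0 \<le> T * r" using T_pos \<open>r \<ge> 0\<close> by simp
  ultimately show "(LINT z|strip. indicator K (fst z) * \<bar>g z\<bar>) \<le> T * r"
    by (subst (asm) ennreal_le_iff)
qed

text \<open>Links the distance that is uniform in time with the planar L1 distance, in which the
  entropy functional is estimated.\<close>

lemma strip_integral_le_dE:
  assumes u: "u \<in> E" and v: "v \<in> E"
  shows "integrable strip (\<lambda>z. indicator {- real n..real n} (fst z) * \<bar>u z - v z\<bar>)"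
    and "(LINT z|strip. indicator {- real n..real n} (fst z) * \<bar>u z - v z\<bar>) \<le> T * dE n u v"
proof -
  have m: "(\<lambda>z. u z - v z) \<in> borel_measurable strip"
    using u v by (intro borel_measurable_diff) (auto simp: solution_space_def Linf_def)
  have le: "(LINT x:{- real n..real n}|lebesgue. \<bar>u (x, t) - v (x, t)\<bar>) \<le> dE n u v" if "t \<in> {0..T}" for t
    unfolding dE_def using u v that by (intro slice_le_strip_dist) auto
  have "0 \<le> (LINT x:{- real n..real n}|lebesgue. \<bar>u (x, 0) - v (x, 0)\<bar>)"
    unfolding set_lebesgue_integral_def by (intro integral_nonneg_AE) auto
  also have "\<dots> \<le> dE n u v" using le[of 0] T_pos by simp
  finally have "dE n u v \<ge> 0" .
  with m le show "integrable strip (\<lambda>z. indicator {- real n..real n} (fst z) * \<bar>u z - v z\<bar>)"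
    "(LINT z|strip. indicator {- real n..real n} (fst z) * \<bar>u z - v z\<bar>) \<le> T * dE n u v"
    using u v by (intro strip_integral_le set_integral_diff slice_integrable; auto)+
qed

end

section \<open>Completeness of bounded parts and separability\<close>

context time_strip
begin

text \<open>Essentially bounded parts of the space. Limits for the uniform L1 distances may be
  unbounded, and the flux is Lipschitz only on bounded sets; a fixed bound \<open>M\<close> cures
  both.\<close>

definition EM :: "real \<Rightarrow> (real \<times> real \<Rightarrow> real) set" where
  "EM M = {v \<in> E. AE z in strip. \<bar>v z\<bar> \<le> M}"

lemma EM_subset: "EM M \<subseteq> E" by (auto simp: EM_def)

lemma E_measurable: "v \<in> E \<Longrightarrow> v \<in> borel_measurable strip"
  by (auto simp: solution_space_def Linf_def)

lemma E_in_EM: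
  assumes "v \<in> E"
  obtains M :: nat where "v \<in> EM (real M)"
proof -
  obtain C where C: "AE z in strip. \<bar>v z\<bar> \<le> C"
    using assms by (auto simp: solution_space_def Linf_iff)
  obtain M :: nat where "C \<le> real M" using real_arch_simple by blast
  then have "v \<in> EM (real M)" using assms C unfolding EM_def by (auto elim!: eventually_mono)
  then show thesis by (rule that)
qed

text \<open>Provides a point, so that a dense subset of \<open>EM M\<close> is nonempty and can be
  enumerated by the naturals.\<close>

lemma zero_in_EM: assumes "M \<ge> 0" shows "(\<lambda>_. 0) \<in> EM M"
proof -
  have "continuous_map (top_of_set {0..T}) L1loc_topology (\<lambda>t x. 0 :: real)"
    by (intro E_L1loc_continuousI[where u = "\<lambda>_. 0"])
      (auto simp: set_integrable_def set_lebesgue_integral_def intro: exI[of _ 1])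
  then show ?thesis using assms by (auto simp: EM_def solution_space_def Linf_iff)
qed

text \<open>The limit is formed pointwise in the plane and not slice by slice, which makes it
  jointly measurable. As the distances are suprema over all times, its slices are L1 limits at every
  time, not merely at almost every one, and continuity in time survives the uniform
  convergence.\<close>

lemma EM_complete:
  assumes c: "\<And>k. c k \<in> EM M" and M: "M \<ge> 0"
    and fast: "\<And>k. dE k (c k) (c (Suc k)) \<le> (1/2)^k"
  obtains v where "v \<in> EM M" "\<And>n k. n \<le> k \<Longrightarrow> dE n (c k) v \<le> 2 * (1/2)^k"
proof -
  have cE: "c k \<in> E" for k using c EM_subset by blast
  \<comment> \<open>The default 0 off the convergence set respects the bound because
    \<open>M \<ge> 0\<close>.\<close>
  define v where "v z = (if Cauchy (\<lambda>k. c k z) then lim (\<lambda>k. c k z) else 0)" for z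
  define K where "K n = {- real n..real n}" for n :: nat
  have K: "compact (K n)" for n by (simp add: K_def)
  have [measurable]: "c k \<in> borel_measurable strip" for k using cE by (rule E_measurable)
  have vm: "v \<in> borel_measurable strip" unfolding v_def by measurable
  have slice: "set_integrable lebesgue (K n) (\<lambda>x. v (x, t)) \<and>
    (\<forall>k\<ge>n. (LINT x:K n|lebesgue. \<bar>c k (x, t) - v (x, t)\<bar>) \<le> 2 * (1/2)^k)" if t: "t \<in> {0..T}" for n t
  proof -
    define f where "f k x = indicator (K n) x * c k (x, t)" for k x
    define g where "g x = indicator (K n) x * v (x, t)" for x
    have f_int: "integrable lebesgue (f k)" for k
      using slice_integrable[OF cE t K] unfolding f_def set_integrable_def by simp
    have f_fast: "(LINT x|lebesgue. \<bar>f k x - f (Suc k) x\<bar>) \<le> (1/2)^k" if "k \<ge> n" for k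
    proof -
      have "(LINT x|lebesgue. \<bar>f k x - f (Suc k) x\<bar>) = (LINT x:K n|lebesgue. \<bar>c k (x, t) - c (Suc k) (x, t)\<bar>)"
        unfolding set_lebesgue_integral_def f_def
        by (intro Bochner_Integration.integral_cong) (auto simp: indicator_def)
      also have "\<dots> \<le> dE n (c k) (c (Suc k))"
        unfolding dE_def K_def[symmetric] using cE K t by (intro slice_le_strip_dist)
      \<comment> \<open>For \<open>k \<ge> n\<close> the interval of \<open>dE k\<close> contains
        that of \<open>dE n\<close>, so the diagonal rate eventually controls each fixed
        interval.\<close>
      also have "\<dots> \<le> dE k (c k) (c (Suc k))" using that cE by (intro dn_mono)
      also have "\<dots> \<le> (1/2)^k" by (rule fast)
      finally show ?thesis .
    qed
    have [measurable]: "f k \<in> borel_measurable lebesgue" for k using f_int by auto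
    \<comment> \<open>Off \<open>K n\<close> the truncated sequence is constantly 0 and converges,
      so \<open>g\<close> is the limit of the truncated sequence with the same default.\<close>
    have g_eq: "g x = (if Cauchy (\<lambda>k. f k x) then lim (\<lambda>k. f k x) else 0)" for x
      unfolding g_def f_def v_def by (cases "x \<in> K n") simp_all
    have gm: "g \<in> borel_measurable lebesgue" unfolding g_eq[abs_def] by measurable
    have "AE x in lebesgue. (\<lambda>k. f k x) \<longlonglongrightarrow> g x"
      using L1_fast_Cauchy(1)[OF f_int f_fast]
      unfolding g_eq by (rule AE_mp) (auto simp: convergent_LIMSEQ_iff Cauchy_convergent_iff)
    from L1_fast_Cauchy(2)[OF f_int f_fast gm this]
    have "integrable lebesgue g" "\<forall>k\<ge>n. (LINT x|lebesgue. \<bar>f k x - g x\<bar>) \<le> 2 * (1/2)^k" by auto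
    moreover have "(LINT x|lebesgue. \<bar>f k x - g x\<bar>) = (LINT x:K n|lebesgue. \<bar>c k (x, t) - v (x, t)\<bar>)" for k
      unfolding set_lebesgue_integral_def f_def g_def
      by (intro Bochner_Integration.integral_cong) (auto simp: indicator_def)
    ultimately show ?thesis by (simp add: set_integrable_def g_def[abs_def])
  qed
  have K_cover: "\<exists>n. L \<subseteq> K n" if L: "compact L" for L :: "real set"
  proof -
    obtain b where b: "\<And>x. x \<in> L \<Longrightarrow> \<bar>x\<bar> \<le> b"
      using compact_imp_bounded[OF L] unfolding bounded_real by blast
    obtain n where "b \<le> real n" using real_arch_simple by blast
    have "x \<in> K n" if "x \<in> L" for x
      using b[OF that] \<open>b \<le> real n\<close> unfolding K_def by (simp add: abs_le_iff)
    then show ?thesis by blast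
  qed
  have L_set: "L \<in> sets lebesgue" if "compact L" for L :: "real set"
    using that by (auto intro: fmeasurableD lmeasurable_compact)
  have v_int: "set_integrable lebesgue L (\<lambda>x. v (x, t))" if t: "t \<in> {0..T}" and L: "compact L" for t L
    using K_cover[OF L] slice[OF t] L_set[OF L] set_integrable_subset by blast
  have v_cont: "\<exists>d>0. \<forall>s\<in>{0..T}. \<bar>s - t\<bar> < d \<longrightarrow> (LINT x:L|lebesgue. \<bar>v (x, t) - v (x, s)\<bar>) < e"
    if t: "t \<in> {0..T}" and L: "compact L" and e: "e > 0" for t L e
  proof -
    obtain n where n: "L \<subseteq> K n" using K_cover[OF L] by blast
    \<comment> \<open>Three error terms of \<open>e/3\<close>; the two outer ones are bounded by
      \<open>2 * (1/2)^k\<close>, hence \<open>e/6\<close>.\<close>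
    obtain k0 where k0: "(1/2::real)^k0 < e/6" using e real_arch_pow_inv[of "e/6" "1/2"] by auto
    define k where "k = max n k0"
    have "(1/2::real)^k \<le> (1/2)^k0" unfolding k_def by (intro power_decreasing) auto
    then have k: "k \<ge> n" "2 * (1/2)^k < e/3" using k0 by (simp add: k_def, linarith)
    obtain d where d: "d > 0"
      "\<And>s. s \<in> {0..T} \<Longrightarrow> \<bar>s - t\<bar> < d \<Longrightarrow> (LINT x:K n|lebesgue. \<bar>c k (x, t) - c k (x, s)\<bar>) < e/3"
      using E_L1loc_continuous[OF cE t K, of "e/3"] e by (meson divide_pos_pos zero_less_numeral)
    show ?thesis
    proof (intro exI[of _ d] conjI ballI impI d(1))
      fix s assume s: "s \<in> {0..T}" "\<bar>s - t\<bar> < d"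
      note ci = slice_integrable[OF cE _ K]
      have "(LINT x:L|lebesgue. \<bar>v (x, t) - v (x, s)\<bar>) \<le> (LINT x:K n|lebesgue. \<bar>v (x, t) - v (x, s)\<bar>)"
        using v_int[OF t K] v_int[OF s(1) K] n L_set[OF L]
        by (intro set_lint_mono_set set_integrable_abs set_integral_diff) auto
      also have "\<dots> \<le> (LINT x:K n|lebesgue. \<bar>v (x, t) - c k (x, t)\<bar>) + (LINT x:K n|lebesgue. \<bar>c k (x, t) - v (x, s)\<bar>)"
        using v_int[OF t K] ci[OF t] v_int[OF s(1) K] by (rule set_lint_triangle)
      also have "(LINT x:K n|lebesgue. \<bar>c k (x, t) - v (x, s)\<bar>) \<le>
        (LINT x:K n|lebesgue. \<bar>c k (x, t) - c k (x, s)\<bar>) + (LINT x:K n|lebesgue. \<bar>c k (x, s) - v (x, s)\<bar>)"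
        using ci[OF t] ci[OF s(1)] v_int[OF s(1) K] by (rule set_lint_triangle)
      also have "(LINT x:K n|lebesgue. \<bar>v (x, t) - c k (x, t)\<bar>) = (LINT x:K n|lebesgue. \<bar>c k (x, t) - v (x, t)\<bar>)"
        by (simp add: abs_minus_commute)
      finally have "(LINT x:L|lebesgue. \<bar>v (x, t) - v (x, s)\<bar>) \<le> (LINT x:K n|lebesgue. \<bar>c k (x, t) - v (x, t)\<bar>) +
        ((LINT x:K n|lebesgue. \<bar>c k (x, t) - c k (x, s)\<bar>) + (LINT x:K n|lebesgue. \<bar>c k (x, s) - v (x, s)\<bar>))"
        by simp
      then show "(LINT x:L|lebesgue. \<bar>v (x, t) - v (x, s)\<bar>) < e"
        using slice[OF t, of n, THEN conjunct2, rule_format, OF k(1)]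
          slice[OF s(1), of n, THEN conjunct2, rule_format, OF k(1)] k(2) d(2)[OF s] by linarith
    qed
  qed
  have "AE z in strip. \<forall>k. \<bar>c k z\<bar> \<le> M" using c by (auto simp: EM_def AE_all_countable)
  then have vM: "AE z in strip. \<bar>v z\<bar> \<le> M"
  proof eventually_elim
    case (elim z)
    show ?case
    proof (cases "Cauchy (\<lambda>k. c k z)")
      case True
      then have "(\<lambda>k. c k z) \<longlonglongrightarrow> v z" by (simp add: v_def convergent_LIMSEQ_iff Cauchy_convergent_iff)
      then have "(\<lambda>k. \<bar>c k z\<bar>) \<longlonglongrightarrow> \<bar>v z\<bar>" by (rule tendsto_rabs)
      then show ?thesis using elim by (intro LIMSEQ_le_const2) auto
    qed (simp add: v_def M)
  qed
  have vE: "v \<in> E"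
    unfolding solution_space_def Linf_iff using vm vM M E_L1loc_continuousI[of v, OF v_int v_cont] by blast
  show thesis
  proof
    show "v \<in> EM M" using vE vM by (simp add: EM_def)
    show "dE n (c k) v \<le> 2 * (1/2)^k" if "n \<le> k" for n k
      unfolding dE_def K_def[symmetric] using slice that by (intro strip_dist_leI) blast
  qed
qed

text \<open>Heine-Cantor for the curve of slices: by compactness, pairs of times that violate
  uniformity accumulate at a common point \<open>l\<close>, where continuity brings both slices
  within \<open>e/2\<close> of the slice at \<open>l\<close>.\<close>

lemma slice_uniformly_continuous:
  assumes u: "u \<in> E" and K: "compact K" and e: "e > 0"
  shows "\<exists>d>0. \<forall>s\<in>{0..T}. \<forall>t\<in>{0..T}. \<bar>s - t\<bar> < d \<longrightarrow> (LINT x:K|lebesgue. \<bar>u (x, t) - u (x, s)\<bar>) < e"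
proof (rule ccontr)
  define F where "F s t = (LINT x:K|lebesgue. \<bar>u (x, s) - u (x, t)\<bar>)" for s t
  have F_tri: "F r t \<le> F r s + F s t" if "r \<in> {0..T}" "s \<in> {0..T}" "t \<in> {0..T}" for r s t
    unfolding F_def using u K that by (intro set_lint_triangle slice_integrable)
  have F_com: "F s t = F t s" for s t unfolding F_def by (simp add: abs_minus_commute)
  assume "\<not> ?thesis"
  then have ex: "\<exists>s\<in>{0..T}. \<exists>t\<in>{0..T}. \<bar>s - t\<bar> < d \<and> \<not> F t s < e" if "d > 0" for d
    using that unfolding F_def by blast
  have "\<forall>k. \<exists>s. s \<in> {0..T} \<and> (\<exists>t\<in>{0..T}. \<bar>s - t\<bar> < 1 / real (Suc k) \<and> \<not> F t s < e)"
  proof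
    fix k
    have "1 / real (Suc k) > 0" by simp
    from ex[OF this] show "\<exists>s. s \<in> {0..T} \<and> (\<exists>t\<in>{0..T}. \<bar>s - t\<bar> < 1 / real (Suc k) \<and> \<not> F t s < e)"
      by blast
  qed
  then obtain s where s: "\<forall>k. s k \<in> {0..T} \<and> (\<exists>t\<in>{0..T}. \<bar>s k - t\<bar> < 1 / real (Suc k) \<and> \<not> F t (s k) < e)"
    by metis
  then have "\<forall>k. \<exists>t. t \<in> {0..T} \<and> \<bar>s k - t\<bar> < 1 / real (Suc k) \<and> \<not> F t (s k) < e" by blast
  then obtain t where "\<forall>k. t k \<in> {0..T} \<and> \<bar>s k - t k\<bar> < 1 / real (Suc k) \<and> \<not> F (t k) (s k) < e"
    by metis
  with s have st: "\<And>k. s k \<in> {0..T}" "\<And>k. t k \<in> {0..T}"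
    "\<And>k. \<bar>s k - t k\<bar> < 1 / real (Suc k)" "\<And>k. \<not> F (t k) (s k) < e"
    by blast+
  obtain l r where l: "l \<in> {0..T}" "strict_mono r" "(s \<circ> r) \<longlonglongrightarrow> l"
    using compact_Icc[of 0 T, unfolded compact_def] st(1) by metis
  obtain d where d: "d > 0" "\<And>s. s \<in> {0..T} \<Longrightarrow> \<bar>s - l\<bar> < d \<Longrightarrow> F l s < e/2"
    using E_L1loc_continuous[OF u l(1) K, of "e/2"] e unfolding F_def by (meson half_gt_zero)
  have "\<forall>\<^sub>F k in sequentially. \<bar>s (r k) - l\<bar> < d/2"
    using tendstoD[OF l(3), of "d/2"] d by (simp add: dist_real_def)
  moreover have "\<forall>\<^sub>F k in sequentially. 1 / real (Suc k) < d/2"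
    using order_tendstoD(2)[OF LIMSEQ_Suc[OF lim_1_over_n], of "d/2"] d by simp
  ultimately have "\<forall>\<^sub>F k in sequentially. \<bar>s (r k) - l\<bar> < d/2 \<and> 1 / real (Suc k) < d/2"
    by (rule eventually_conj)
  then obtain k where k: "\<bar>s (r k) - l\<bar> < d/2" "1 / real (Suc k) < d/2"
    using eventually_happens'[OF sequentially_bot] by blast
  have "1 / real (Suc (r k)) \<le> 1 / real (Suc k)"
    using seq_suble[OF l(2), of k] by (intro divide_left_mono) auto
  then have "\<bar>t (r k) - l\<bar> < d" "\<bar>s (r k) - l\<bar> < d" using k st(3)[of "r k"] d(1) by linarith+
  then have "F l (t (r k)) < e/2" "F l (s (r k)) < e/2" using d(2) st by auto
  then have "F (t (r k)) (s (r k)) < e"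
    using F_tri[OF st(2) l(1) st(1), of "r k" "r k"] F_com[of l "t (r k)"] by simp
  then show False using st(4) by blast
qed

text \<open>Functions that are piecewise constant in time, with values in a countable L1-dense set,
  approximate uniformly in time. They generally jump and so lie outside the space, which is why
  nearby elements of \<open>S\<close> are selected. The statement serves the whole space, its
  bounded parts and the image of the solution map.\<close>

lemma subset_E_separable:
  assumes S: "S \<subseteq> E"
  obtains C where "countable C" "C \<subseteq> S" "\<And>v n e. v \<in> S \<Longrightarrow> e > 0 \<Longrightarrow> \<exists>c\<in>C. dE n v c < e"
proof -
  obtain D :: "(real \<Rightarrow> real) set" where D: "countable D" "\<And>d. d \<in> D \<Longrightarrow> integrable lborel d"
    "\<And>g e. integrable lebesgue g \<Longrightarrow> e > 0 \<Longrightarrow> \<exists>d\<in>D. (LINT x|lebesgue. \<bar>g x - d x\<bar>) < e"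
    using separable_L1_lebesgue by metis
  have D_int: "integrable lebesgue d" if "d \<in> D" for d
    using D(2)[OF that] integrable_completion[of d lborel] by auto
  \<comment> \<open>Codes: the mesh \<open>1/m\<close> and the values on successive time cells. The
    list reaches the cell containing \<open>T\<close>, so every index that occurs below is
    valid.\<close>
  define A where "A = {(m :: nat, l) | m l. l \<in> lists D \<and> nat \<lfloor>real m * T\<rfloor> < length l}"
  have "countable (lists D)" using D(1) by (rule countable_lists)
  then have A: "countable A"
    by (intro countable_subset[of A "UNIV \<times> lists D"]) (auto simp: A_def)
  have ex: "\<exists>C. countable C \<and> C \<subseteq> S \<and> (\<forall>v e. v \<in> S \<longrightarrow> e > 0 \<longrightarrow> (\<exists>c\<in>C. dE n v c < e))" for n
  proof -
    define K where "K = {- real n..real n}"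
    have K: "compact K" by (simp add: K_def)
    define near where "near v a e \<longleftrightarrow> (\<forall>t\<in>{0..T}.
      (LINT x:K|lebesgue. \<bar>v (x, t) - (snd a ! nat \<lfloor>real (fst a) * t\<rfloor>) x\<bar>) \<le> e)"
      for v :: "real \<times> real \<Rightarrow> real" and a :: "nat \<times> (real \<Rightarrow> real) list" and e :: real
    have aD: "snd a ! nat \<lfloor>real (fst a) * t\<rfloor> \<in> D" if "a \<in> A" "t \<in> {0..T}" for a t
    proof -
      have "real (fst a) * t \<le> real (fst a) * T" using that by (intro mult_left_mono) auto
      then have "nat \<lfloor>real (fst a) * t\<rfloor> \<le> nat \<lfloor>real (fst a) * T\<rfloor>" by (intro nat_mono floor_mono)
      then show ?thesis using that(1) unfolding A_def by (auto simp: in_lists_conv_set intro!: nth_mem)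
    qed
    have Ka: "set_integrable lebesgue K d" if "d \<in> D" for d
      using D_int[OF that] K unfolding set_integrable_def
      by (intro integrable_mult_indicator) (auto intro: fmeasurableD lmeasurable_compact)
    have near_tri: "dE n v w \<le> 2 * e" if v: "v \<in> S" "w \<in> S" "a \<in> A" "near v a e" "near w a e" for v w a e
      unfolding dE_def K_def[symmetric]
    proof (rule strip_dist_leI)
      fix t assume t: "t \<in> {0..T}"
      let ?d = "snd a ! nat \<lfloor>real (fst a) * t\<rfloor>"
      have E: "v \<in> E" "w \<in> E" using v S by auto
      have "(LINT x:K|lebesgue. \<bar>v (x, t) - w (x, t)\<bar>) \<le>
         (LINT x:K|lebesgue. \<bar>v (x, t) - ?d x\<bar>) + (LINT x:K|lebesgue. \<bar>?d x - w (x, t)\<bar>)"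
        using slice_integrable[OF E(1) t K] Ka[OF aD[OF v(3) t]] slice_integrable[OF E(2) t K]
        by (rule set_lint_triangle)
      also have "(LINT x:K|lebesgue. \<bar>?d x - w (x, t)\<bar>) = (LINT x:K|lebesgue. \<bar>w (x, t) - ?d x\<bar>)"
        by (simp add: abs_minus_commute)
      also have "(LINT x:K|lebesgue. \<bar>v (x, t) - ?d x\<bar>) + \<dots> \<le> e + e"
        using v t unfolding near_def by (intro add_mono) auto
      finally show "(LINT x:K|lebesgue. \<bar>v (x, t) - w (x, t)\<bar>) \<le> 2 * e" by simp
    qed
    have near_ex: "\<exists>a\<in>A. near v a e" if v: "v \<in> S" and e: "e > 0" for v e
    proof -
      have vE: "v \<in> E" using v S by auto
      obtain \<delta> where \<delta>: "\<delta> > 0" "\<And>s t. s \<in> {0..T} \<Longrightarrow> t \<in> {0..T} \<Longrightarrow> \<bar>s - t\<bar> < \<delta> \<Longrightarrow>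
        (LINT x:K|lebesgue. \<bar>v (x, t) - v (x, s)\<bar>) < e/2"
        using slice_uniformly_continuous[OF vE K, of "e/2"] e by (meson half_gt_zero)
      obtain m0 where m0: "1 / real (Suc m0) < \<delta>" using nat_approx_posE[OF \<delta>(1)] by auto
      define m where "m = Suc m0"
      have m: "real m > 0" "1 / real m < \<delta>" using m0 by (auto simp: m_def)
      \<comment> \<open>On each cell the value approximates the slice at the left end
        \<open>i / m\<close>; uniform continuity covers the rest of the cell.\<close>
      have "\<exists>d\<in>D. (LINT x:K|lebesgue. \<bar>v (x, real i / real m) - d x\<bar>) < e/2" if "i \<le> nat \<lfloor>real m * T\<rfloor>" for i
      proof -
        have "real i \<le> real m * T" using that T_pos by (simp add: le_nat_iff le_floor_iff)
        then have t: "real i / real m \<in> {0..T}" using m(1) by (auto simp: field_simps)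
        define g where "g x = indicator K x * v (x, real i / real m)" for x
        have g: "integrable lebesgue g"
          using slice_integrable[OF vE t K] unfolding set_integrable_def g_def by simp
        obtain d where d: "d \<in> D" "(LINT x|lebesgue. \<bar>g x - d x\<bar>) < e/2" using D(3)[OF g, of "e/2"] e by auto
        have "(LINT x:K|lebesgue. \<bar>v (x, real i / real m) - d x\<bar>) \<le> (LINT x|lebesgue. \<bar>g x - d x\<bar>)"
          unfolding set_lebesgue_integral_def
        proof (rule integral_mono)
          have "set_integrable lebesgue K (\<lambda>x. \<bar>v (x, real i / real m) - d x\<bar>)"
            by (intro set_integrable_abs set_integral_diff slice_integrable vE t K Ka d)
          then show "integrable lebesgue (\<lambda>x. indicat_real K x *\<^sub>R \<bar>v (x, real i / real m) - d x\<bar>)"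
            unfolding set_integrable_def .
          show "integrable lebesgue (\<lambda>x. \<bar>g x - d x\<bar>)" using g D_int[OF d(1)] by auto
          show "indicat_real K x *\<^sub>R \<bar>v (x, real i / real m) - d x\<bar> \<le> \<bar>g x - d x\<bar>" for x
            by (auto simp: g_def indicator_def)
        qed
        then show ?thesis using d by (intro bexI[of _ d]) auto
      qed
      then obtain d where d: "\<And>i. i \<le> nat \<lfloor>real m * T\<rfloor> \<Longrightarrow> d i \<in> D"
        "\<And>i. i \<le> nat \<lfloor>real m * T\<rfloor> \<Longrightarrow> (LINT x:K|lebesgue. \<bar>v (x, real i / real m) - d i x\<bar>) < e/2" by metis
      define a where "a = (m, map d [0..<Suc (nat \<lfloor>real m * T\<rfloor>)])"
      have "a \<in> A" unfolding A_def a_def using d(1) by (auto simp: in_lists_conv_set simp del: upt_Suc)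
      moreover have "near v a e"
        unfolding near_def
      proof
        fix t assume t: "t \<in> {0..T}"
        define i where "i = nat \<lfloor>real m * t\<rfloor>"
        have "real m * t \<le> real m * T" using t by (intro mult_left_mono) auto
        then have i: "i \<le> nat \<lfloor>real m * T\<rfloor>" unfolding i_def by (intro nat_mono floor_mono)
        have it: "real i \<le> real m * t" "real m * t < real i + 1"
        proof -
          have "0 \<le> real m * t" using t m by simp
          then have "real i = of_int \<lfloor>real m * t\<rfloor>" unfolding i_def by simp
          then show "real i \<le> real m * t" "real m * t < real i + 1" by linarith+
        qed
        define s where "s = real i / real m"
        have s_le: "s \<le> t" unfolding s_def using it m(1) by (simp add: field_simps)
        have "t < (real i + 1) / real m" using it(2) m(1) by (simp add: pos_less_divide_eq mult.commute)
        then have "t - s < 1 / real m" unfolding s_def by (simp add: add_divide_distrib)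
        then have s: "s \<in> {0..T}" "\<bar>s - t\<bar> < \<delta>" using t m s_le by (auto simp: s_def)
        have "snd a ! nat \<lfloor>real (fst a) * t\<rfloor> = d i"
          unfolding a_def using i by (simp add: i_def[symmetric] nth_append del: upt_Suc)
        moreover have "(LINT x:K|lebesgue. \<bar>v (x, t) - d i x\<bar>) \<le>
          (LINT x:K|lebesgue. \<bar>v (x, t) - v (x, s)\<bar>) + (LINT x:K|lebesgue. \<bar>v (x, s) - d i x\<bar>)"
          by (intro set_lint_triangle slice_integrable vE t K s(1) Ka d(1) i)
        ultimately show "(LINT x:K|lebesgue. \<bar>v (x, t) - (snd a ! nat \<lfloor>real (fst a) * t\<rfloor>) x\<bar>) \<le> e"
          using \<delta>(2)[OF s(1) t s(2)] d(2)[OF i] by (simp add: s_def)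
      qed
      ultimately show ?thesis by blast
    qed
    show ?thesis
    proof (rule countable_dense_subset_of_approximants[OF A, of S near "dE n"])
      show "\<exists>a\<in>A. near v a e" if "v \<in> S" "e > 0" for v e using near_ex that .
      show "dE n v w \<le> 2 * e" if "v \<in> S" "w \<in> S" "a \<in> A" "near v a e" "near w a e" for v w a e
        using near_tri that .
      show ?thesis if "countable C" "C \<subseteq> S" "\<And>v e. v \<in> S \<Longrightarrow> e > 0 \<Longrightarrow> \<exists>c\<in>C. dE n v c < e" for C
        using that by blast
    qed
  qed
  then obtain C where C: "\<And>n. countable (C n)" "\<And>n. C n \<subseteq> S"
    "\<And>n v e. v \<in> S \<Longrightarrow> e > 0 \<Longrightarrow> \<exists>c\<in>C n. dE n v c < e"
    by metis
  show thesis
  proof (rule that)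
    show "countable (\<Union>n. C n)" using C(1) by blast
    show "(\<Union>n. C n) \<subseteq> S" using C(2) by blast
    show "\<exists>c\<in>\<Union>n. C n. dE n v c < e" if "v \<in> S" "e > 0" for v n e
      using C(3)[OF that] by blast
  qed
qed

end

section \<open>The flux and its branch inverses\<close>

text \<open>A subsequence that keeps its distance from \<open>L\<close> is bounded, hence has a
  cluster point, which is forced to be \<open>L\<close>.\<close>

lemma bounded_unique_cluster_point:
  fixes r :: "nat \<Rightarrow> real"
  assumes bd: "bounded (range r)"
    and uniq: "\<And>\<phi> l. strict_mono \<phi> \<Longrightarrow> (r \<circ> \<phi>) \<longlonglongrightarrow> l \<Longrightarrow> l = L"
  shows "r \<longlonglongrightarrow> L"
proof (rule ccontr)
  assume "\<not> r \<longlonglongrightarrow> L"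
  then obtain e where e: "e > 0" "\<not> (\<forall>\<^sub>F n in sequentially. dist (r n) L < e)"
    unfolding tendsto_iff by blast
  then have inf: "infinite {n. \<not> dist (r n) L < e}"
    unfolding cofinite_eq_sequentially[symmetric] eventually_cofinite by simp
  define s where "s = enumerate {n. \<not> dist (r n) L < e}"
  have s: "strict_mono s" "\<And>n. \<not> dist (r (s n)) L < e"
    using inf strict_mono_enumerate enumerate_in_set unfolding s_def by blast+
  have "bounded (range (r \<circ> s))" using bd by (rule bounded_subset) auto
  then obtain l t where t: "strict_mono t" "((r \<circ> s) \<circ> t) \<longlonglongrightarrow> l"
    using bounded_imp_convergent_subsequence by blast
  have "strict_mono (s \<circ> t)" using s(1) t(1) by (rule strict_mono_o)
  moreover have "(r \<circ> (s \<circ> t)) \<longlonglongrightarrow> l" using t(2) by (simp add: o_assoc)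
  ultimately have "l = L" by (rule uniq)
  then have "\<forall>\<^sub>F n in sequentially. dist ((r \<circ> s \<circ> t) n) L < e" using t(2) e(1) tendstoD by blast
  then obtain n where "dist ((r \<circ> s \<circ> t) n) L < e"
    using eventually_happens'[OF sequentially_bot] by blast
  then show False using s(2)[of "t n"] by simp
qed

locale flux_path =
  fixes F :: "real \<Rightarrow> real \<Rightarrow> real" and N :: "real set"
  assumes B1: "flux_B1 F N" and B2: "flux_B2 F" and Lip: "common_Lipschitz F N"
begin

lemma N: "closed N" "N \<in> null_sets lebesgue" "AE x in lebesgue. x \<notin> N"
proof -
  show "closed N" "N \<in> null_sets lebesgue" using B1 by (auto simp: flux_B1_def)
  then show "AE x in lebesgue. x \<notin> N" by (intro AE_not_in)
qed

lemma F_isCont: "x \<notin> N \<Longrightarrow> isCont (\<lambda>(y, r). F y r) (x, r)"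
  using B1 by (auto simp: flux_B1_def)

lemma F_tendsto:
  assumes "x \<notin> N" "X \<longlonglongrightarrow> x" "r \<longlonglongrightarrow> l"
  shows "(\<lambda>n. F (X n) (r n)) \<longlonglongrightarrow> F x l"
  using isCont_tendsto_compose[OF F_isCont[OF assms(1), of l] tendsto_Pair[OF assms(2,3)]] by simp

text \<open>The lower envelope of the flux tends to infinity in both directions and does not depend
  on \<open>x\<close>, so the bound is uniform in \<open>x\<close>.\<close>

lemma F_coercive: "\<exists>R\<ge>0. \<forall>x r. \<bar>F x r\<bar> \<le> a \<longrightarrow> \<bar>r\<bar> \<le> R"
proof -
  obtain gm :: "real \<Rightarrow> real" where gm: "\<And>x r. gm r \<le> \<bar>F x r\<bar>" "\<And>r. gm r \<ge> 0"
    "filterlim (\<lambda>r. \<bar>gm r\<bar>) at_top at_top" "filterlim (\<lambda>r. \<bar>gm r\<bar>) at_top at_bot"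
    using B2 unfolding flux_B2_def by blast
  obtain R1 where R1: "\<And>r. r \<ge> R1 \<Longrightarrow> a < \<bar>gm r\<bar>"
    using gm(3) unfolding filterlim_at_top_dense eventually_at_top_linorder by blast
  obtain R2 where R2: "\<And>r. r \<le> R2 \<Longrightarrow> a < \<bar>gm r\<bar>"
    using gm(4) unfolding filterlim_at_top_dense eventually_at_bot_linorder by blast
  have "\<bar>r\<bar> \<le> \<bar>R1\<bar> + \<bar>R2\<bar>" if "\<bar>F x r\<bar> \<le> a" for x r
  proof -
    have "\<bar>gm r\<bar> \<le> a" using gm(1)[of r x] gm(2)[of r] that by simp
    then have "r < R1" "r > R2" using R1[of r] R2[of r] by fastforce+
    then show ?thesis by linarith
  qed
  then show ?thesis by (intro exI[of _ "\<bar>R1\<bar> + \<bar>R2\<bar>"]) auto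
qed

lemma F_bounded: "\<exists>C\<ge>0. \<forall>x r. \<bar>r\<bar> \<le> M \<longrightarrow> \<bar>F x r\<bar> \<le> C"
proof -
  obtain gp where gp: "continuous_on UNIV gp" "\<And>x r. \<bar>F x r\<bar> \<le> gp r"
    using B2 unfolding flux_B2_def by blast
  have "bounded (gp ` {-M..M})"
    using gp(1) by (intro compact_imp_bounded compact_continuous_image continuous_on_subset[OF gp(1)]) auto
  then obtain C where C: "\<And>r. r \<in> {-M..M} \<Longrightarrow> \<bar>gp r\<bar> \<le> C" unfolding bounded_real by blast
  have "\<bar>F x r\<bar> \<le> \<bar>C\<bar>" if "\<bar>r\<bar> \<le> M" for x r
    using gp(2)[of x r] C[of r] that by (simp add: abs_le_iff)
  then show ?thesis by (intro exI[of _ "\<bar>C\<bar>"]) auto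
qed

lemma F_Lipschitz: "\<exists>L\<ge>0. \<forall>x a b. x \<notin> N \<longrightarrow> \<bar>a\<bar> \<le> S \<longrightarrow> \<bar>b\<bar> \<le> S \<longrightarrow> \<bar>F x a - F x b\<bar> \<le> L * \<bar>a - b\<bar>"
proof -
  have "is_interval {-S..S} \<and> bounded {-S..S}" by (simp add: is_interval_cc)
  then obtain L where L: "\<And>x. x \<notin> N \<Longrightarrow> L-lipschitz_on {-S..S} (F x)"
    using Lip unfolding common_Lipschitz_def by blast
  have "\<bar>F x a - F x b\<bar> \<le> \<bar>L\<bar> * \<bar>a - b\<bar>" if "x \<notin> N" "\<bar>a\<bar> \<le> S" "\<bar>b\<bar> \<le> S" for x a b
  proof -
    have "\<bar>F x a - F x b\<bar> \<le> L * \<bar>a - b\<bar>"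
      using lipschitz_onD[OF L[OF that(1)], of a b] that by (simp add: dist_real_def abs_le_iff)
    also have "\<dots> \<le> \<bar>L\<bar> * \<bar>a - b\<bar>" by (intro mult_right_mono) auto
    finally show ?thesis .
  qed
  then show ?thesis by (intro exI[of _ "\<bar>L\<bar>"]) auto
qed

text \<open>A Borel version of the flux: continuous over the open complement of \<open>N\<close>,
  and 0 over the null set \<open>N\<close>.\<close>

definition F0 :: "real \<times> real \<Rightarrow> real" where
  "F0 z = indicator ((- N) \<times> UNIV) z *\<^sub>R F (fst z) (snd z)"

lemma F0_measurable: "F0 \<in> borel_measurable borel"
proof -
  have "open ((- N) \<times> (UNIV :: real set))" using N(1) by (intro open_Times) auto
  then show ?thesis unfolding F0_def[abs_def]
  proof (intro borel_measurable_continuous_on_indicator)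
    show "continuous_on ((- N) \<times> UNIV) (\<lambda>z. F (fst z) (snd z))"
      using F_isCont[unfolded case_prod_beta'] by (intro continuous_at_imp_continuous_on) auto
  qed auto
qed

lemma F0_eq: "x \<notin> N \<Longrightarrow> F0 (x, r) = F x r"
  by (simp add: F0_def)

text \<open>Cluster points of \<open>r\<close> are roots of \<open>F x \<cdot> = l\<close>, and coercivity makes \<open>r\<close> bounded.\<close>

lemma root_tendsto:
  assumes x: "x \<notin> N" "X \<longlonglongrightarrow> x" and F: "(\<lambda>n. F (X n) (r n)) \<longlonglongrightarrow> l"
    and uniq: "\<And>\<phi> s. strict_mono \<phi> \<Longrightarrow> (r \<circ> \<phi>) \<longlonglongrightarrow> s \<Longrightarrow> F x s = l \<Longrightarrow> s = s0"
  shows "r \<longlonglongrightarrow> s0"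
proof (rule bounded_unique_cluster_point)
  obtain a where a: "\<And>n. \<bar>F (X n) (r n)\<bar> \<le> a"
    using convergent_imp_bounded[OF F] unfolding bounded_real by auto
  obtain R where "\<And>x r. \<bar>F x r\<bar> \<le> a \<Longrightarrow> \<bar>r\<bar> \<le> R" using F_coercive by blast
  then show "bounded (range r)" using a unfolding bounded_real by blast
  fix \<phi> :: "nat \<Rightarrow> nat" and s assume \<phi>: "strict_mono \<phi>" and s: "(r \<circ> \<phi>) \<longlonglongrightarrow> s"
  have "(\<lambda>n. F ((X \<circ> \<phi>) n) ((r \<circ> \<phi>) n)) \<longlonglongrightarrow> F x s"
    using x(1) LIMSEQ_subseq_LIMSEQ[OF x(2) \<phi>] s by (rule F_tendsto)
  moreover have "((\<lambda>n. F (X n) (r n)) \<circ> \<phi>) \<longlonglongrightarrow> l" using F \<phi> by (rule LIMSEQ_subseq_LIMSEQ)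
  ultimately have "F x s = l" by (simp add: o_def LIMSEQ_unique)
  then show "s = s0" using uniq \<phi> s by blast
qed

end

text \<open>One branch of one path. \<open>B_closed\<close> says that the branch has a closed graph
  over the complement of \<open>N\<close>; together with injectivity and coercivity it makes the
  root on the branch depend continuously on \<open>x\<close> and \<alpha>.\<close>

locale flux_branch = flux_path +
  fixes A :: "real set" and B :: "real \<Rightarrow> real set" and G :: "real \<Rightarrow> real \<Rightarrow> real"
  assumes inj: "x \<notin> N \<Longrightarrow> inj_on (F x) (B x)"
    and G: "x \<notin> N \<Longrightarrow> \<alpha> \<in> A \<Longrightarrow> G x \<alpha> \<in> B x \<and> F x (G x \<alpha>) = \<alpha>"
    and B_closed: "x \<notin> N \<Longrightarrow> (\<And>n. X n \<notin> N) \<Longrightarrow> X \<longlonglongrightarrow> x \<Longrightarrow> (\<And>n. r n \<in> B (X n)) \<Longrightarrow> r \<longlonglongrightarrow> s \<Longrightarrow> s \<in> B x"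
begin

text \<open>Constant sequences specialise this to continuity in \<open>x\<close>, used for
  measurability, and to continuity in \<alpha>, used to pass from dense levels to all
  levels.\<close>

lemma G_tendsto:
  assumes "x \<notin> N" "\<And>n. X n \<notin> N" "X \<longlonglongrightarrow> x" "\<And>n. a n \<in> A" "a \<longlonglongrightarrow> \<alpha>" "\<alpha> \<in> A"
  shows "(\<lambda>n. G (X n) (a n)) \<longlonglongrightarrow> G x \<alpha>"
proof (rule root_tendsto[where l = \<alpha>])
  show "x \<notin> N" "X \<longlonglongrightarrow> x" by fact+
  show "(\<lambda>n. F (X n) (G (X n) (a n))) \<longlonglongrightarrow> \<alpha>" using G assms by simp
  fix \<phi> :: "nat \<Rightarrow> nat" and s
  assume \<phi>: "strict_mono \<phi>" and s: "((\<lambda>n. G (X n) (a n)) \<circ> \<phi>) \<longlonglongrightarrow> s" "F x s = \<alpha>"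
  have "s \<in> B x"
  proof (rule B_closed)
    show "x \<notin> N" by fact
    show "(X \<circ> \<phi>) n \<notin> N" for n using assms(2) by simp
    show "(X \<circ> \<phi>) \<longlonglongrightarrow> x" using assms(3) \<phi> by (rule LIMSEQ_subseq_LIMSEQ)
    show "((\<lambda>n. G (X n) (a n)) \<circ> \<phi>) n \<in> B ((X \<circ> \<phi>) n)" for n using G assms by simp
  qed (fact s(1))
  then show "s = G x \<alpha>" using inj[OF assms(1)] G[OF assms(1,6)] s(2) by (auto dest: inj_onD)
qed

lemma G_continuous_on:
  assumes "\<alpha> \<in> A"
  shows "continuous_on (- N) (\<lambda>x. G x \<alpha>)"
  unfolding continuous_on_sequentially o_def using assms by (auto intro!: G_tendsto)

lemma G_bounded: "\<exists>R\<ge>0. \<forall>x \<alpha>. x \<notin> N \<longrightarrow> \<alpha> \<in> A \<longrightarrow> \<bar>\<alpha>\<bar> \<le> a \<longrightarrow> \<bar>G x \<alpha>\<bar> \<le> R"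
  using F_coercive[of a] G by metis

definition G0 :: "real \<Rightarrow> real \<Rightarrow> real" where
  "G0 \<alpha> x = indicator (- N) x *\<^sub>R G x \<alpha>"

lemma G0_measurable: "\<alpha> \<in> A \<Longrightarrow> G0 \<alpha> \<in> borel_measurable borel"
  unfolding G0_def[abs_def] using N(1)
  by (intro borel_measurable_continuous_on_indicator G_continuous_on) auto

lemma G0_eq: "x \<notin> N \<Longrightarrow> G0 \<alpha> x = G x \<alpha>"
  by (simp add: G0_def)

text \<open>Injectivity on the branch determines a steady state up to a null set, so that testing
  with the one given by \<open>G\<close> is enough.\<close>

lemma steady_state_iff:
  assumes "\<alpha> \<in> A"
  shows "steady_state F B \<alpha> m \<longleftrightarrow> (AE x in lebesgue. m x = G x \<alpha>)"
proof
  assume "steady_state F B \<alpha> m"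
  then have "AE x in lebesgue. F x (m x) = \<alpha> \<and> m x \<in> B x" by (simp add: steady_state_def)
  then show "AE x in lebesgue. m x = G x \<alpha>"
    using N(3)
  proof eventually_elim
    case (elim x)
    then show ?case using inj_onD[OF inj[of x], of "m x" "G x \<alpha>"] G[OF _ assms, of x] by simp
  qed
next
  assume "AE x in lebesgue. m x = G x \<alpha>"
  then show "steady_state F B \<alpha> m"
    unfolding steady_state_def using N(3) by eventually_elim (use G[OF _ assms] in auto)
qed

end

text \<open>The turning point \<open>u\<^sub>M\<close> inherits continuity off \<open>N\<close> from the flux because it is the only root of
  \<open>F x \<cdot> = M\<^sub>0\<close>; hence the graphs of the branches are closed.\<close>

lemma flux_branches_B3:
  fixes f :: "'w \<Rightarrow> real \<Rightarrow> real \<Rightarrow> real"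
  assumes B1: "flux_B1 (f \<omega>) (N \<omega>)" and B2: "flux_B2 (f \<omega>)" and \<omega>: "\<omega> \<in> \<Omega>"
    and B3: "flux_B3 \<Omega> f N A B\<^sub>m B\<^sub>p"
    and Gm: "branch_inverse \<Omega> f N A B\<^sub>m G\<^sub>m" and Gp: "branch_inverse \<Omega> f N A B\<^sub>p G\<^sub>p"
  shows "flux_branch (f \<omega>) (N \<omega>) A (B\<^sub>m \<omega>) (G\<^sub>m \<omega>) \<and> flux_branch (f \<omega>) (N \<omega>) A (B\<^sub>p \<omega>) (G\<^sub>p \<omega>)"
proof -
  from B3 obtain u\<^sub>M M\<^sub>0 where *: "(A = {M\<^sub>0..} \<or> A = {..M\<^sub>0}) \<and>
        B\<^sub>m = (\<lambda>\<omega> x. {..u\<^sub>M \<omega> x}) \<and> B\<^sub>p = (\<lambda>\<omega> x. {u\<^sub>M \<omega> x..}) \<and>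
        (\<forall>\<omega>\<in>\<Omega>. \<forall>x. x \<notin> N \<omega> \<longrightarrow>
           f \<omega> x (u\<^sub>M \<omega> x) = M\<^sub>0 \<and>
           bij_betw (f \<omega> x) (B\<^sub>m \<omega> x) A \<and> bij_betw (f \<omega> x) (B\<^sub>p \<omega> x) A) \<and>
        (\<forall>\<omega>\<in>\<Omega>. common_Lipschitz (f \<omega>) (N \<omega>))"
    unfolding flux_B3_def by (elim exE)
  then have B: "B\<^sub>m = (\<lambda>\<omega> x. {..u\<^sub>M \<omega> x})" "B\<^sub>p = (\<lambda>\<omega> x. {u\<^sub>M \<omega> x..})" by blast+
  from * have bij: "f \<omega> x (u\<^sub>M \<omega> x) = M\<^sub>0 \<and> bij_betw (f \<omega> x) (B\<^sub>m \<omega> x) A \<and> bij_betw (f \<omega> x) (B\<^sub>p \<omega> x) A"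
    if "x \<notin> N \<omega>" for x using \<omega> that by (elim conjE) blast
  from * have Lip: "common_Lipschitz (f \<omega>) (N \<omega>)" using \<omega> by (elim conjE) blast
  interpret flux_path "f \<omega>" "N \<omega>" by standard fact+
  \<comment> \<open>\<open>M\<^sub>0\<close> is attained at the common end point of the two
    branches, and injectivity on each of them excludes any other root.\<close>
  have root: "s = u\<^sub>M \<omega> x" if "x \<notin> N \<omega>" "f \<omega> x s = M\<^sub>0" for x s
  proof (cases "s \<le> u\<^sub>M \<omega> x")
    case True
    then show ?thesis using bij[OF that(1)] that(2) unfolding B bij_betw_def by (auto dest: inj_onD)
  next
    case False
    then show ?thesis using bij[OF that(1)] that(2) unfolding B bij_betw_def
      by (auto dest!: inj_onD[where A = "{u\<^sub>M \<omega> x..}"])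
  qed
  have uM: "(\<lambda>n. u\<^sub>M \<omega> (X n)) \<longlonglongrightarrow> u\<^sub>M \<omega> x" if "x \<notin> N \<omega>" "\<And>n. X n \<notin> N \<omega>" "X \<longlonglongrightarrow> x" for X x
  proof (rule root_tendsto[OF that(1,3), where l = "M\<^sub>0"])
    show "(\<lambda>n. f \<omega> (X n) (u\<^sub>M \<omega> (X n))) \<longlonglongrightarrow> M\<^sub>0" using bij that(2) by simp
  qed (use root that(1) in blast)
  have G: "G \<omega> x \<alpha> \<in> B \<omega> x \<and> f \<omega> x (G \<omega> x \<alpha>) = \<alpha>"
    if "branch_inverse \<Omega> f N A B G" "bij_betw (f \<omega> x) (B \<omega> x) A" "x \<notin> N \<omega>" "\<alpha> \<in> A" for G B x \<alpha>
  proof -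
    have "G \<omega> x \<alpha> = the_inv_into (B \<omega> x) (f \<omega> x) \<alpha>"
      using that \<omega> unfolding branch_inverse_def by blast
    then show ?thesis
      using that(2,4) f_the_inv_into_f_bij_betw bij_betw_def the_inv_into_into by (metis order_refl)
  qed
  show ?thesis
  proof
    show "flux_branch (f \<omega>) (N \<omega>) A (B\<^sub>m \<omega>) (G\<^sub>m \<omega>)"
    proof
      show "inj_on (f \<omega> x) (B\<^sub>m \<omega> x)" if "x \<notin> N \<omega>" for x using bij[OF that] by (auto simp: bij_betw_def)
      show "G\<^sub>m \<omega> x \<alpha> \<in> B\<^sub>m \<omega> x \<and> f \<omega> x (G\<^sub>m \<omega> x \<alpha>) = \<alpha>" if "x \<notin> N \<omega>" "\<alpha> \<in> A" for x \<alpha>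
        using G[OF Gm _ that] bij[OF that(1)] by blast
      show "s \<in> B\<^sub>m \<omega> x" if "x \<notin> N \<omega>" "\<And>n. X n \<notin> N \<omega>" "X \<longlonglongrightarrow> x" "\<And>n. r n \<in> B\<^sub>m \<omega> (X n)" "r \<longlonglongrightarrow> s" for x X r s
        using LIMSEQ_le[OF that(5) uM[OF that(1-3)]] that(4) unfolding B by auto
    qed
    show "flux_branch (f \<omega>) (N \<omega>) A (B\<^sub>p \<omega>) (G\<^sub>p \<omega>)"
    proof
      show "inj_on (f \<omega> x) (B\<^sub>p \<omega> x)" if "x \<notin> N \<omega>" for x using bij[OF that] by (auto simp: bij_betw_def)
      show "G\<^sub>p \<omega> x \<alpha> \<in> B\<^sub>p \<omega> x \<and> f \<omega> x (G\<^sub>p \<omega> x \<alpha>) = \<alpha>" if "x \<notin> N \<omega>" "\<alpha> \<in> A" for x \<alpha>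
        using G[OF Gp _ that] bij[OF that(1)] by blast
      show "s \<in> B\<^sub>p \<omega> x" if "x \<notin> N \<omega>" "\<And>n. X n \<notin> N \<omega>" "X \<longlonglongrightarrow> x" "\<And>n. r n \<in> B\<^sub>p \<omega> (X n)" "r \<longlonglongrightarrow> s" for x X r s
        using LIMSEQ_le[OF uM[OF that(1-3)] that(5)] that(4) unfolding B by auto
    qed
  qed
qed

lemma flux_branches_B3':
  fixes f :: "'w \<Rightarrow> real \<Rightarrow> real \<Rightarrow> real"
  assumes B1: "flux_B1 (f \<omega>) (N \<omega>)" and B2: "flux_B2 (f \<omega>)" and \<omega>: "\<omega> \<in> \<Omega>"
    and B3: "flux_B3' \<Omega> f N A B\<^sub>m B\<^sub>p"
    and Gm: "branch_inverse \<Omega> f N A B\<^sub>m G\<^sub>m" and Gp: "branch_inverse \<Omega> f N A B\<^sub>p G\<^sub>p"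
  shows "flux_branch (f \<omega>) (N \<omega>) A (B\<^sub>m \<omega>) (G\<^sub>m \<omega>) \<and> flux_branch (f \<omega>) (N \<omega>) A (B\<^sub>p \<omega>) (G\<^sub>p \<omega>)"
proof -
  have A: "A = UNIV" and B: "B\<^sub>m = (\<lambda>\<omega> x. UNIV)" "B\<^sub>p = (\<lambda>\<omega> x. UNIV)"
    and bij: "\<And>x. x \<notin> N \<omega> \<Longrightarrow> bij (f \<omega> x)" and Lip: "common_Lipschitz (f \<omega>) (N \<omega>)"
    using B3 \<omega> unfolding flux_B3'_def by auto
  interpret flux_path "f \<omega>" "N \<omega>" by standard fact+
  have G: "f \<omega> x (G \<omega> x \<alpha>) = \<alpha>"
    if "branch_inverse \<Omega> f N A (\<lambda>\<omega> x. UNIV) G" "x \<notin> N \<omega>" for G x \<alpha>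
  proof -
    have "G \<omega> x \<alpha> = the_inv_into UNIV (f \<omega> x) \<alpha>"
      using that \<omega> A unfolding branch_inverse_def by blast
    then show ?thesis using f_the_inv_into_f_bij_betw[OF bij[OF that(2)]] by simp
  qed
  show ?thesis
    by (intro conjI; unfold_locales)
      (use G[OF Gm[unfolded B]] G[OF Gp[unfolded B]] bij in \<open>auto simp: B bij_def\<close>)
qed

section \<open>The entropy functional\<close>

lemma (in complete_measure) borel_measurable_cong_AE:
  fixes f g :: "'a \<Rightarrow> 'b::topological_space"
  assumes g: "g \<in> borel_measurable M" and eq: "AE x in M. f x = g x"
  shows "f \<in> borel_measurable M"
proof (rule measurableI)
  fix S :: "'b set" assume "S \<in> sets borel"
  then have "g -` S \<inter> space M \<in> sets M" using g by (rule measurable_sets[rotated])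
  then show "f -` S \<inter> space M \<in> sets M"
  proof (rule in_sets_AE[rotated])
    show "AE x in M. x \<in> g -` S \<inter> space M \<longleftrightarrow> x \<in> f -` S \<inter> space M"
      using eq by eventually_elim simp
  qed auto
qed simp

text \<open>By completeness either both functions are measurable or neither is, and in the latter
  case both integrals have the default value 0.\<close>

lemma (in complete_measure) integral_cong_AE_complete:
  fixes f g :: "'a \<Rightarrow> real"
  assumes eq: "AE x in M. f x = g x"
  shows "integral\<^sup>L M f = integral\<^sup>L M g"
proof (cases "g \<in> borel_measurable M")
  case True
  then show ?thesis using eq borel_measurable_cong_AE[OF True eq] by (intro integral_cong_AE) auto
next
  case False
  then have "f \<notin> borel_measurable M"
    using borel_measurable_cong_AE[of f g] AE_symmetric[OF eq] by blast
  then show ?thesis using False by (metis not_integrable_integral_eq borel_measurable_integrable)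
qed

lemma complete_measure_lebesgue: "complete_measure (lebesgue :: 'a::euclidean_space measure)"
  by (rule completion.complete_measure_axioms)

lemma complete_measure_lebesgue_on:
  assumes S: "S \<in> sets lebesgue"
  shows "complete_measure (lebesgue_on S)"
proof
  fix B A :: "'a set" assume BA: "B \<subseteq> A" and A: "A \<in> null_sets (lebesgue_on S)"
  have "A \<subseteq> S" "A \<in> null_sets lebesgue" using A S by (simp_all add: null_sets_restrict_space)
  then have "B \<in> null_sets lebesgue" "B \<subseteq> S"
    using BA complete_measure.complete2[OF complete_measure_lebesgue] by blast+
  then have "B \<in> null_sets (lebesgue_on S)" using S by (simp add: null_sets_restrict_space)
  then show "B \<in> sets (lebesgue_on S)" by auto
qed

text \<open>The left-hand side of the entropy inequality, with \<open>(p, q, r)\<close> in the role of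
  \<open>(\<partial>\<^sub>t\<phi>, \<partial>\<^sub>x\<phi>, \<phi>(\<cdot>, 0))\<close>.\<close>

definition entropy_functional ::
  "real \<Rightarrow> (real \<Rightarrow> real \<Rightarrow> real) \<Rightarrow> (real \<Rightarrow> real) \<Rightarrow> real \<Rightarrow> (real \<Rightarrow> real) \<Rightarrow>
   (real \<times> real \<Rightarrow> real) \<Rightarrow> (real \<times> real \<Rightarrow> real) \<Rightarrow> (real \<Rightarrow> real) \<Rightarrow> (real \<times> real \<Rightarrow> real) \<Rightarrow> real" where
  "entropy_functional T F u\<^sub>0 \<alpha> m p q r v =
     integral\<^sup>L (lebesgue_on (UNIV \<times> {0..T})) (\<lambda>z. \<bar>v z - m (fst z)\<bar> * p z)
   + integral\<^sup>L (lebesgue_on (UNIV \<times> {0..T})) (\<lambda>z. sgn (v z - m (fst z)) * (F (fst z) (v z) - \<alpha>) * q z)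
   + (LINT x|lebesgue. \<bar>u\<^sub>0 x - m x\<bar> * r x)"

text \<open>What the estimates use of the derivatives and the initial trace of a test function. A
  cut-off in \<open>x\<close> alone suffices, as the strip has finite height, and its index
  \<open>n\<close> is that of the distance \<open>dE n\<close>.\<close>

definition test_data ::
  "nat \<Rightarrow> real \<Rightarrow> (real \<times> real \<Rightarrow> real) \<Rightarrow> (real \<times> real \<Rightarrow> real) \<Rightarrow> (real \<Rightarrow> real) \<Rightarrow> bool" where
  "test_data n C p q r \<longleftrightarrow>
     p \<in> borel_measurable borel \<and> q \<in> borel_measurable borel \<and> r \<in> borel_measurable borel \<and>
     (\<forall>z. \<bar>p z\<bar> \<le> C * indicator {- real n..real n} (fst z)) \<and>
     (\<forall>z. \<bar>q z\<bar> \<le> C * indicator {- real n..real n} (fst z)) \<and>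
     (\<forall>x. \<bar>r x\<bar> \<le> C * indicator {- real n..real n} x)"

context time_strip
begin

lemma borel_measurable_strip: "(g :: real \<times> real \<Rightarrow> 'a::topological_space) \<in> borel_measurable borel \<Longrightarrow> g \<in> borel_measurable strip"
  by (rule measurable_restrict_space1, rule measurable_completion) simp

lemma indicator_strip_integrable: "integrable strip (\<lambda>z. indicator {- real n..real n} (fst z) :: real)"
proof -
  have "integrable strip (\<lambda>z. indicator {- real n..real n} (fst z) * \<bar>1 :: real\<bar>)"
    by (rule strip_integral_le[where r = "2 * real n"])
      (auto simp: set_integrable_def set_lebesgue_integral_def)
  then show ?thesis by simp
qed

lemma indicator_lebesgue_integrable: "integrable lebesgue (\<lambda>x. indicator {- real n..real n} x :: real)"
  by simp

lemma strip_integrable_bounded: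
  fixes h :: "real \<times> real \<Rightarrow> real"
  assumes "h \<in> borel_measurable strip" "AE z in strip. \<bar>h z\<bar> \<le> C * indicator {- real n..real n} (fst z)"
  shows "integrable strip h"
proof (rule Bochner_Integration.integrable_bound)
  show "integrable strip (\<lambda>z. C * indicator {- real n..real n} (fst z))"
    using indicator_strip_integrable by (rule integrable_mult_right)
  show "AE z in strip. norm (h z) \<le> norm (C * indicator {- real n..real n} (fst z))"
    using assms(2) by eventually_elim auto
qed fact

lemma lebesgue_integrable_bounded:
  fixes h :: "real \<Rightarrow> real"
  assumes "h \<in> borel_measurable lebesgue" "AE x in lebesgue. \<bar>h x\<bar> \<le> C * indicator {- real n..real n} x"
  shows "integrable lebesgue h"
proof (rule Bochner_Integration.integrable_bound)
  show "integrable lebesgue (\<lambda>x. C * indicator {- real n..real n} x)"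
    using indicator_lebesgue_integrable by (rule integrable_mult_right)
  show "AE x in lebesgue. norm (h x) \<le> norm (C * indicator {- real n..real n} x)"
    using assms(2) by eventually_elim auto
qed fact

lemma test_data_integrable:
  assumes "test_data n C p q r"
  shows "integrable strip p" "integrable strip q" "integrable lebesgue r"
  using assms unfolding test_data_def
  by (auto intro!: strip_integrable_bounded[where n = n and C = C] lebesgue_integrable_bounded[where n = n and C = C]
      borel_measurable_strip measurable_completion)

lemma entropy_functional_cong_AE:
  assumes "AE x in lebesgue. m x = m' x"
  shows "entropy_functional T F u\<^sub>0 \<alpha> m p q r v = entropy_functional T F u\<^sub>0 \<alpha> m' p q r v"
proof -
  have m: "AE z in strip. m (fst z) = m' (fst z)" using assms by (rule AE_strip_fst)
  note s = complete_measure.integral_cong_AE_complete[OF complete_measure_lebesgue_on[OF strip_set(1)]]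
  note l = complete_measure.integral_cong_AE_complete[OF complete_measure_lebesgue]
  show ?thesis
    unfolding entropy_functional_def using m assms
    by (intro arg_cong2[where f = "(+)"] s l) (auto elim!: eventually_mono)
qed

end

section \<open>Dependence of the functional on the candidate solution\<close>

locale flux_strip = time_strip T + flux_branch F N A B G
  for T F N A B G +
  fixes u\<^sub>0 :: "real \<Rightarrow> real"
  assumes u0: "u\<^sub>0 \<in> Linf lebesgue"
begin

abbreviation "\<Phi> \<alpha> \<equiv> entropy_functional T F u\<^sub>0 \<alpha> (\<lambda>x. G x \<alpha>)"

lemma AE_N: "AE z in strip. fst z \<notin> N"
  using N(3) by (rule AE_strip_fst)

lemma G_measurable: "\<alpha> \<in> A \<Longrightarrow> (\<lambda>x. G x \<alpha>) \<in> borel_measurable lebesgue"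
proof (rule complete_measure.borel_measurable_cong_AE[OF complete_measure_lebesgue])
  assume "\<alpha> \<in> A"
  then show "G0 \<alpha> \<in> borel_measurable lebesgue"
    using G0_measurable[of \<alpha>] by (intro measurable_completion) simp
  show "AE x in lebesgue. G x \<alpha> = G0 \<alpha> x" using N(3) by eventually_elim (simp add: G0_eq)
qed

lemma G_strip_measurable:
  assumes "\<alpha> \<in> A"
  shows "(\<lambda>z. G (fst z) \<alpha>) \<in> borel_measurable strip"
proof (rule complete_measure.borel_measurable_cong_AE[OF complete_measure_lebesgue_on[OF strip_set(1)]])
  show "(\<lambda>z. G0 \<alpha> (fst z)) \<in> borel_measurable strip"
    by (rule borel_measurable_strip, rule measurable_compose[OF borel_fst G0_measurable[OF assms]])
  show "AE z in strip. G (fst z) \<alpha> = G0 \<alpha> (fst z)" using AE_N by eventually_elim (simp add: G0_eq)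
qed

text \<open>Nothing is known about measurability of the flux over \<open>N\<close>, so the Borel
  version \<open>F0\<close> is composed with \<open>v\<close> and completeness transfers the
  result.\<close>

lemma F_strip_measurable:
  assumes "v \<in> borel_measurable strip"
  shows "(\<lambda>z. F (fst z) (v z)) \<in> borel_measurable strip"
proof (rule complete_measure.borel_measurable_cong_AE[OF complete_measure_lebesgue_on[OF strip_set(1)]])
  have "fst \<in> borel_measurable strip" using borel_fst by (rule borel_measurable_strip)
  then have "(\<lambda>z. (fst z, v z)) \<in> borel_measurable strip" using assms by (rule borel_measurable_Pair)
  then show "(\<lambda>z. F0 (fst z, v z)) \<in> borel_measurable strip"
    using F0_measurable by (rule measurable_compose)
  show "AE z in strip. F (fst z) (v z) = F0 (fst z, v z)" using AE_N by eventually_elim (simp add: F0_eq)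
qed

text \<open>A sum of separate bounds gives one constant, uniform in \<open>x\<close> and in all
  levels up to \<open>a\<close>. Each difference in the integrands is then at most
  \<open>2 * S\<close>.\<close>

lemma uniform_bound:
  obtains S where "S \<ge> 0" "M \<le> S" "a \<le> S" "AE x in lebesgue. \<bar>u\<^sub>0 x\<bar> \<le> S"
    "\<And>x \<alpha>. x \<notin> N \<Longrightarrow> \<alpha> \<in> A \<Longrightarrow> \<bar>\<alpha>\<bar> \<le> a \<Longrightarrow> \<bar>G x \<alpha>\<bar> \<le> S"
    "\<And>x r. \<bar>r\<bar> \<le> M \<Longrightarrow> \<bar>F x r\<bar> \<le> S"
proof -
  obtain R where R: "R \<ge> 0" "\<And>x \<alpha>. x \<notin> N \<Longrightarrow> \<alpha> \<in> A \<Longrightarrow> \<bar>\<alpha>\<bar> \<le> a \<Longrightarrow> \<bar>G x \<alpha>\<bar> \<le> R"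
    using G_bounded[of a] by blast
  obtain C where C: "C \<ge> 0" "\<And>x r. \<bar>r\<bar> \<le> M \<Longrightarrow> \<bar>F x r\<bar> \<le> C" using F_bounded[of M] by blast
  obtain U where U: "U \<ge> 0" "AE x in lebesgue. \<bar>u\<^sub>0 x\<bar> \<le> U" using u0 unfolding Linf_iff by blast
  show thesis
  proof (rule that[of "R + C + U + \<bar>M\<bar> + \<bar>a\<bar>"])
    show "AE x in lebesgue. \<bar>u\<^sub>0 x\<bar> \<le> R + C + U + \<bar>M\<bar> + \<bar>a\<bar>"
      using U(2) by eventually_elim (use R C U in linarith)
    show "\<bar>G x \<alpha>\<bar> \<le> R + C + U + \<bar>M\<bar> + \<bar>a\<bar>" if "x \<notin> N" "\<alpha> \<in> A" "\<bar>\<alpha>\<bar> \<le> a" for x \<alpha>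
      using R(2)[OF that] R(1) C(1) U(1) by linarith
    show "\<bar>F x r\<bar> \<le> R + C + U + \<bar>M\<bar> + \<bar>a\<bar>" if "\<bar>r\<bar> \<le> M" for x r
      using C(2)[OF that, of x] R(1) C(1) U(1) by linarith
  qed (use R C U in linarith)+
qed

lemma entropy_integrands:
  assumes v: "v \<in> EM M" and \<alpha>: "\<alpha> \<in> A" and pqr: "test_data n C p q r" 
  shows "integrable strip (\<lambda>z. \<bar>v z - G (fst z) \<alpha>\<bar> * p z)" (is ?A)
    and "integrable strip (\<lambda>z. sgn (v z - G (fst z) \<alpha>) * (F (fst z) (v z) - \<alpha>) * q z)" (is ?B)
    and "integrable lebesgue (\<lambda>x. \<bar>u\<^sub>0 x - G x \<alpha>\<bar> * r x)" (is ?C)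
proof -
  obtain S where S: "S \<ge> 0" "M \<le> S" "\<bar>\<alpha>\<bar> \<le> S" "AE x in lebesgue. \<bar>u\<^sub>0 x\<bar> \<le> S"
    "\<And>x. x \<notin> N \<Longrightarrow> \<bar>G x \<alpha>\<bar> \<le> S" "\<And>x r. \<bar>r\<bar> \<le> M \<Longrightarrow> \<bar>F x r\<bar> \<le> S"
    using uniform_bound[of M "\<bar>\<alpha>\<bar>"] \<alpha> by (metis order_refl)
  have vM: "AE z in strip. \<bar>v z\<bar> \<le> M" and vm: "v \<in> borel_measurable strip"
    using v EM_subset E_measurable by (auto simp: EM_def)
  note [measurable] = vm G_strip_measurable[OF \<alpha>] G_measurable[OF \<alpha>] F_strip_measurable[OF vm]
  have [measurable]: "p \<in> borel_measurable strip" "q \<in> borel_measurable strip" "r \<in> borel_measurable lebesgue"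
    "u\<^sub>0 \<in> borel_measurable lebesgue"
    using test_data_integrable[OF pqr] u0 by (auto simp: Linf_iff)
  have p: "\<bar>p z\<bar> \<le> C * indicator {- real n..real n} (fst z)" and q: "\<bar>q z\<bar> \<le> C * indicator {- real n..real n} (fst z)"
    and r: "\<bar>r x\<bar> \<le> C * indicator {- real n..real n} x" for z x
    using pqr unfolding test_data_def by blast+
  have *: "\<bar>a * b\<bar> \<le> 2 * S * C * i" if "\<bar>a\<bar> \<le> 2 * S" "\<bar>b\<bar> \<le> C * i" for a b i :: real
    using mult_mono[OF that] S(1) by (simp add: abs_mult mult.assoc)
  show ?A
  proof (rule strip_integrable_bounded)
    show "AE z in strip. \<bar>\<bar>v z - G (fst z) \<alpha>\<bar> * p z\<bar> \<le> 2 * S * C * indicator {- real n..real n} (fst z)"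
      using vM AE_N
    proof eventually_elim
      case (elim z)
      have "\<bar>\<bar>v z - G (fst z) \<alpha>\<bar>\<bar> \<le> 2 * S" using elim S(2) S(5)[of "fst z"] by linarith
      then show ?case using p by (rule *)
    qed
  qed measurable
  show ?B
  proof (rule strip_integrable_bounded)
    show "AE z in strip. \<bar>sgn (v z - G (fst z) \<alpha>) * (F (fst z) (v z) - \<alpha>) * q z\<bar>
        \<le> 2 * S * C * indicator {- real n..real n} (fst z)"
      using vM AE_N
    proof eventually_elim
      case (elim z)
      have "\<bar>F (fst z) (v z) - \<alpha>\<bar> \<le> 2 * S" using elim S(3) S(6)[of "v z" "fst z"] by linarith
      then have "\<bar>sgn (v z - G (fst z) \<alpha>) * (F (fst z) (v z) - \<alpha>)\<bar> \<le> 2 * S"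
        using S(1) by (auto simp: sgn_if abs_mult)
      then show ?case using q by (rule *)
    qed
  qed measurable
  show ?C
  proof (rule lebesgue_integrable_bounded)
    show "AE x in lebesgue. \<bar>\<bar>u\<^sub>0 x - G x \<alpha>\<bar> * r x\<bar> \<le> 2 * S * C * indicator {- real n..real n} x"
      using S(4) N(3)
    proof eventually_elim
      case (elim x)
      have "\<bar>\<bar>u\<^sub>0 x - G x \<alpha>\<bar>\<bar> \<le> 2 * S" using elim S(5)[of x] by linarith
      then show ?case using r by (rule *)
    qed
  qed measurable
qed

text \<open>The Kruzkov entropy flux is Lipschitz although the sign jumps, because the jump sits at
  \<open>G x \<alpha>\<close>, where \<open>F x\<close> equals \<alpha>. A second root of the same
  level on the other branch is no obstacle, as the sign does not change there.\<close>

lemma entropy_flux_Lipschitz: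
  assumes \<alpha>: "\<alpha> \<in> A"
  obtains L where "L \<ge> 0" "\<And>x a b. x \<notin> N \<Longrightarrow> \<bar>a\<bar> \<le> M \<Longrightarrow> \<bar>b\<bar> \<le> M \<Longrightarrow>
    \<bar>sgn (a - G x \<alpha>) * (F x a - \<alpha>) - sgn (b - G x \<alpha>) * (F x b - \<alpha>)\<bar> \<le> L * \<bar>a - b\<bar>"
proof -
  obtain S where S: "M \<le> S" "\<And>x. x \<notin> N \<Longrightarrow> \<bar>G x \<alpha>\<bar> \<le> S"
    using uniform_bound[of M "\<bar>\<alpha>\<bar>"] \<alpha> by (metis order_refl)
  obtain L where L: "L \<ge> 0" "\<And>x a b. x \<notin> N \<Longrightarrow> \<bar>a\<bar> \<le> S \<Longrightarrow> \<bar>b\<bar> \<le> S \<Longrightarrow> \<bar>F x a - F x b\<bar> \<le> L * \<bar>a - b\<bar>"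
    using F_Lipschitz[of S] by blast
  show thesis
  proof (rule that[OF L(1)])
    fix x a b assume x: "x \<notin> N" and a: "\<bar>a\<bar> \<le> M" and b: "\<bar>b\<bar> \<le> M"
    let ?m = "G x \<alpha>"
    have ab: "\<bar>F x a - F x b\<bar> \<le> L * \<bar>a - b\<bar>" using L(2)[OF x] a b S(1) by auto
    have F\<alpha>: "F x ?m = \<alpha>" using G[OF x \<alpha>] by simp
    have a\<alpha>: "\<bar>F x a - \<alpha>\<bar> \<le> L * \<bar>a - ?m\<bar>" using L(2)[OF x, of a ?m] a S(1) S(2)[OF x] F\<alpha> by auto
    have b\<alpha>: "\<bar>F x b - \<alpha>\<bar> \<le> L * \<bar>b - ?m\<bar>" using L(2)[OF x, of b ?m] b S(1) S(2)[OF x] F\<alpha> by auto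
    \<comment> \<open>For \<open>a\<close> and \<open>b\<close> on different sides of the steady
      state, the distances to it add up to the distance between them.\<close>
    have opp: "\<bar>F x a - \<alpha>\<bar> + \<bar>F x b - \<alpha>\<bar> \<le> L * \<bar>a - b\<bar>" if "(a - ?m) * (b - ?m) \<le> 0"
    proof -
      have "\<bar>a - ?m\<bar> + \<bar>b - ?m\<bar> = \<bar>a - b\<bar>" using that unfolding mult_le_0_iff by linarith
      then show ?thesis using a\<alpha> b\<alpha> by (metis add_mono distrib_left)
    qed
    show "\<bar>sgn (a - ?m) * (F x a - \<alpha>) - sgn (b - ?m) * (F x b - \<alpha>)\<bar> \<le> L * \<bar>a - b\<bar>"
    proof (cases "(a - ?m) * (b - ?m) \<le> 0")
      case True
      have t: "\<bar>sgn (c - ?m) * (F x c - \<alpha>)\<bar> \<le> \<bar>F x c - \<alpha>\<bar>" for c by (auto simp: sgn_if)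
      have "\<bar>sgn (a - ?m) * (F x a - \<alpha>) - sgn (b - ?m) * (F x b - \<alpha>)\<bar> \<le>
        \<bar>F x a - \<alpha>\<bar> + \<bar>F x b - \<alpha>\<bar>" using t[of a] t[of b] by linarith
      then show ?thesis using opp[OF True] by linarith
    next
      case False
      then have "sgn (a - ?m) = sgn (b - ?m)" "\<bar>sgn (a - ?m)\<bar> = 1"
        by (auto simp: not_le zero_less_mult_iff sgn_if)
      then have "\<bar>sgn (a - ?m) * (F x a - \<alpha>) - sgn (b - ?m) * (F x b - \<alpha>)\<bar> = \<bar>sgn (a - ?m) * (F x a - F x b)\<bar>"
        by (simp add: algebra_simps)
      also have "\<dots> = \<bar>F x a - F x b\<bar>" using \<open>\<bar>sgn (a - ?m)\<bar> = 1\<close> by (simp add: abs_mult)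
      finally show ?thesis using ab by simp
    qed
  qed
qed

text \<open>Both planar terms are Lipschitz for the planar L1 distance, which costs a factor
  \<open>T\<close> against \<open>dE n\<close>; the initial term does not involve the candidate and
  cancels.\<close>

lemma entropy_functional_Lipschitz:
  assumes \<alpha>: "\<alpha> \<in> A" and pqr: "test_data n C p q r"
  obtains L where "L \<ge> 0" "\<And>v w. v \<in> EM M \<Longrightarrow> w \<in> EM M \<Longrightarrow> \<bar>\<Phi> \<alpha> p q r v - \<Phi> \<alpha> p q r w\<bar> \<le> L * dE n v w"
proof -
  obtain L where L: "L \<ge> 0" "\<And>x a b. x \<notin> N \<Longrightarrow> \<bar>a\<bar> \<le> M \<Longrightarrow> \<bar>b\<bar> \<le> M \<Longrightarrow>
    \<bar>sgn (a - G x \<alpha>) * (F x a - \<alpha>) - sgn (b - G x \<alpha>) * (F x b - \<alpha>)\<bar> \<le> L * \<bar>a - b\<bar>"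
    using entropy_flux_Lipschitz[OF \<alpha>] by metis
  have "0 \<le> C * indicator {- real n..real n} 0"
    using pqr unfolding test_data_def by (metis abs_ge_zero order_trans fst_conv)
  then have C: "C \<ge> 0" by simp
  show thesis
  proof (rule that[of "(C + C * L) * T"])
    show "(C + C * L) * T \<ge> 0" using C L T_pos by simp
    fix v w assume v: "v \<in> EM M" and w: "w \<in> EM M"
    let ?i = "\<lambda>z. indicator {- real n..real n} (fst z) * \<bar>v z - w z\<bar>"
    have i: "integrable strip ?i" "(LINT z|strip. ?i z) \<le> T * dE n v w"
      using strip_integral_le_dE[of v w n] v w EM_subset by blast+
    have vw: "AE z in strip. \<bar>v z\<bar> \<le> M" "AE z in strip. \<bar>w z\<bar> \<le> M" using v w by (auto simp: EM_def)
    have p: "\<bar>p z\<bar> \<le> C * indicator {- real n..real n} (fst z)" and q: "\<bar>q z\<bar> \<le> C * indicator {- real n..real n} (fst z)" for z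
      using pqr unfolding test_data_def by blast+
    let ?P = "\<lambda>v z. \<bar>v z - G (fst z) \<alpha>\<bar> * p z"
    let ?Q = "\<lambda>v z. sgn (v z - G (fst z) \<alpha>) * (F (fst z) (v z) - \<alpha>) * q z"
    note ent = entropy_integrands(1,2)[OF _ \<alpha> pqr]
    have "\<bar>(LINT z|strip. ?P v z) - (LINT z|strip. ?P w z)\<bar> = \<bar>LINT z|strip. ?P v z - ?P w z\<bar>"
      using ent(1)[OF v] ent(1)[OF w] by simp
    also have "\<dots> \<le> (LINT z|strip. \<bar>?P v z - ?P w z\<bar>)" by (rule integral_abs_bound)
    also have "\<dots> \<le> (LINT z|strip. C * ?i z)"
    proof (rule integral_mono)
      show "integrable strip (\<lambda>z. \<bar>?P v z - ?P w z\<bar>)" using ent(1)[OF v] ent(1)[OF w] by simp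
      show "integrable strip (\<lambda>z. C * ?i z)" using i by simp
      show "\<bar>?P v z - ?P w z\<bar> \<le> C * ?i z" for z
      proof -
        have "\<bar>?P v z - ?P w z\<bar> = \<bar>\<bar>v z - G (fst z) \<alpha>\<bar> - \<bar>w z - G (fst z) \<alpha>\<bar>\<bar> * \<bar>p z\<bar>"
          by (simp add: abs_mult[symmetric] left_diff_distrib)
        also have "\<dots> \<le> \<bar>v z - w z\<bar> * (C * indicator {- real n..real n} (fst z))"
          using p by (intro mult_mono) auto
        finally show ?thesis by (simp add: mult_ac)
      qed
    qed
    also have "\<dots> \<le> C * (T * dE n v w)" using i(2) C by (simp add: mult_left_mono)
    finally have 1: "\<bar>(LINT z|strip. ?P v z) - (LINT z|strip. ?P w z)\<bar> \<le> C * (T * dE n v w)" .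
    have "\<bar>(LINT z|strip. ?Q v z) - (LINT z|strip. ?Q w z)\<bar> = \<bar>LINT z|strip. ?Q v z - ?Q w z\<bar>"
      using ent(2)[OF v] ent(2)[OF w] by simp
    also have "\<dots> \<le> (LINT z|strip. \<bar>?Q v z - ?Q w z\<bar>)" by (rule integral_abs_bound)
    also have "\<dots> \<le> (LINT z|strip. C * L * ?i z)"
    proof (rule integral_mono_AE)
      show "integrable strip (\<lambda>z. \<bar>?Q v z - ?Q w z\<bar>)" using ent(2)[OF v] ent(2)[OF w] by simp
      show "integrable strip (\<lambda>z. C * L * ?i z)" using i by simp
      show "AE z in strip. \<bar>?Q v z - ?Q w z\<bar> \<le> C * L * ?i z"
        using vw AE_N
      proof eventually_elim
        case (elim z)
        let ?h = "\<lambda>a. sgn (a - G (fst z) \<alpha>) * (F (fst z) a - \<alpha>)"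
        have "\<bar>?Q v z - ?Q w z\<bar> = \<bar>?h (v z) - ?h (w z)\<bar> * \<bar>q z\<bar>"
          by (simp add: abs_mult[symmetric] left_diff_distrib)
        also have "\<dots> \<le> (L * \<bar>v z - w z\<bar>) * (C * indicator {- real n..real n} (fst z))"
          using L elim q[of z] by (intro mult_mono) auto
        finally show ?case by (simp add: mult_ac)
      qed
    qed
    also have "\<dots> \<le> C * L * (T * dE n v w)" using i(2) C L by (simp add: mult_left_mono)
    finally have "\<bar>(LINT z|strip. ?Q v z) - (LINT z|strip. ?Q w z)\<bar> \<le> C * L * (T * dE n v w)" .
    then have "\<bar>\<Phi> \<alpha> p q r v - \<Phi> \<alpha> p q r w\<bar> \<le> C * (T * dE n v w) + C * L * (T * dE n v w)"
      using 1 unfolding entropy_functional_def by linarith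
    then show "\<bar>\<Phi> \<alpha> p q r v - \<Phi> \<alpha> p q r w\<bar> \<le> (C + C * L) * T * dE n v w"
      by (simp add: algebra_simps)
  qed
qed

end

section \<open>Test functions and a countable dense family\<close>

definition dt_of :: "(real \<times> real \<Rightarrow> real) \<Rightarrow> real \<times> real \<Rightarrow> real" where
  "dt_of \<phi> = (\<lambda>(x, t). deriv (\<lambda>s. \<phi> (x, s)) t)"

definition dx_of :: "(real \<times> real \<Rightarrow> real) \<Rightarrow> real \<times> real \<Rightarrow> real" where
  "dx_of \<phi> = (\<lambda>(x, t). deriv (\<lambda>y. \<phi> (y, t)) x)"

lemma adapted_entropy_inequality_iff:
  "adapted_entropy_inequality T F u\<^sub>0 \<alpha> m \<phi> u \<longleftrightarrow>
     0 \<le> entropy_functional T F u\<^sub>0 \<alpha> m (dt_of \<phi>) (dx_of \<phi>) (\<lambda>x. \<phi> (x, 0)) u"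
  by (simp add: adapted_entropy_inequality_def entropy_functional_def dt_of_def dx_of_def case_prod_beta')

lemma integral_dist_triangle:
  fixes a b c :: "'z \<Rightarrow> real"
  assumes "integrable M a" "integrable M b" "integrable M c"
  shows "(LINT z|M. \<bar>a z - b z\<bar>) \<le> (LINT z|M. \<bar>a z - c z\<bar>) + (LINT z|M. \<bar>b z - c z\<bar>)"
proof -
  have "(LINT z|M. \<bar>a z - b z\<bar>) \<le> (LINT z|M. \<bar>a z - c z\<bar> + \<bar>b z - c z\<bar>)"
    using assms by (intro integral_mono integrable_add integrable_abs Bochner_Integration.integrable_diff) auto
  also have "\<dots> = (LINT z|M. \<bar>a z - c z\<bar>) + (LINT z|M. \<bar>b z - c z\<bar>)"
    using assms by (intro Bochner_Integration.integral_add integrable_abs Bochner_Integration.integrable_diff)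
  finally show ?thesis .
qed

lemma test_function_data:
  assumes "\<phi> \<in> test_functions T"
  shows "\<exists>n C. test_data n C (dt_of \<phi>) (dx_of \<phi>) (\<lambda>x. \<phi> (x, 0))"
proof -
  obtain D :: "nat \<Rightarrow> nat \<Rightarrow> real \<times> real \<Rightarrow> real" where D0: "D 0 0 = \<phi>"
    and D: "\<And>i j z. (D i j has_derivative (\<lambda>(h, k). h * D (Suc i) j z + k * D i (Suc j) z)) (at z)"
    using assms unfolding test_functions_def smooth_on_plane_def by blast
  define S where "S = closure {z. \<phi> z \<noteq> 0}"
  have S: "compact S" using assms by (simp add: test_functions_def S_def)
  have D_cont: "continuous_on UNIV (D i j)" for i j
    using D has_derivative_continuous by (blast intro: continuous_at_imp_continuous_on)
  have dt: "dt_of \<phi> = D 0 1"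
  proof
    fix z :: "real \<times> real"
    obtain x t where z: "z = (x, t)" by (cases z)
    have "((\<lambda>s. (x, s)) has_derivative (\<lambda>k. (0, k))) (at t)"
      by (auto intro!: derivative_eq_intros)
    from has_derivative_compose[OF this D[of 0 0 "(x, t)"]]
    have "((\<lambda>s. \<phi> (x, s)) has_derivative (\<lambda>k. k * D 0 1 (x, t))) (at t)" by (simp add: D0)
    then have "((\<lambda>s. \<phi> (x, s)) has_field_derivative D 0 1 (x, t)) (at t)"
      by (rule has_derivative_imp_has_field_derivative) simp
    then show "dt_of \<phi> z = D 0 1 z" by (simp add: z dt_of_def DERIV_imp_deriv)
  qed
  have dx: "dx_of \<phi> = D 1 0"
  proof
    fix z :: "real \<times> real"
    obtain x t where z: "z = (x, t)" by (cases z)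
    have "((\<lambda>y. (y, t)) has_derivative (\<lambda>h. (h, 0))) (at x)"
      by (auto intro!: derivative_eq_intros)
    from has_derivative_compose[OF this D[of 0 0 "(x, t)"]]
    have "((\<lambda>y. \<phi> (y, t)) has_derivative (\<lambda>h. h * D 1 0 (x, t))) (at x)" by (simp add: D0)
    then have "((\<lambda>y. \<phi> (y, t)) has_field_derivative D 1 0 (x, t)) (at x)"
      by (rule has_derivative_imp_has_field_derivative) simp
    then show "dx_of \<phi> z = D 1 0 z" by (simp add: z dx_of_def DERIV_imp_deriv)
  qed
  have "{z. \<phi> z \<noteq> 0} \<subseteq> S" unfolding S_def by (rule closure_subset)
  then have zero: "\<phi> z = 0" if "z \<notin> S" for z using that by auto
  \<comment> \<open>Off the closed support the function vanishes in a whole neighbourhood, so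
    uniqueness of the derivative annihilates both partial derivatives.\<close>
  have D_zero: "D 1 0 z = 0 \<and> D 0 1 z = 0" if z: "z \<notin> S" for z
  proof -
    have "open (- S)" using S by (simp add: compact_imp_closed open_Compl)
    then have "(\<phi> has_derivative (\<lambda>_. 0)) (at z)"
      using z zero by (intro has_derivative_transform_within_open[of "\<lambda>_. 0" "\<lambda>_. 0" z UNIV "- S" \<phi>]) auto
    then have "(\<lambda>(h, k). h * D (Suc 0) 0 z + k * D 0 (Suc 0) z) = (\<lambda>_. 0)"
      using has_derivative_unique D[of 0 0 z] unfolding D0 by blast
    then show ?thesis by (auto dest: fun_cong[of _ _ "(1, 0)"] fun_cong[of _ _ "(0, 1)"])
  qed
  have bd: "\<exists>C\<ge>0. \<forall>z. \<bar>g z\<bar> \<le> C" if "continuous_on UNIV g" "\<And>z. z \<notin> S \<Longrightarrow> g z = 0" for g :: "real \<times> real \<Rightarrow> real"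
  proof -
    have "bounded (g ` S)"
      using S that(1) by (intro compact_imp_bounded compact_continuous_image) (auto intro: continuous_on_subset)
    then obtain C where C: "\<And>z. z \<in> S \<Longrightarrow> \<bar>g z\<bar> \<le> C" unfolding bounded_real by blast
    have "\<bar>g z\<bar> \<le> \<bar>C\<bar>" for z using C[of z] that(2)[of z] by (cases "z \<in> S") auto
    then show ?thesis by (intro exI[of _ "\<bar>C\<bar>"]) auto
  qed
  obtain C1 where C1: "C1 \<ge> 0" "\<And>z. \<bar>D 0 1 z\<bar> \<le> C1" using bd[OF D_cont, of 0 1] D_zero by auto
  obtain C2 where C2: "C2 \<ge> 0" "\<And>z. \<bar>D 1 0 z\<bar> \<le> C2" using bd[OF D_cont, of 1 0] D_zero by auto
  obtain C3 where C3: "C3 \<ge> 0" "\<And>z. \<bar>\<phi> z\<bar> \<le> C3" using bd[OF D_cont, of 0 0] zero D0 by auto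
  obtain b where b: "\<And>z. z \<in> S \<Longrightarrow> norm z \<le> b" using compact_imp_bounded[OF S] unfolding bounded_iff by blast
  obtain n :: nat where n: "b \<le> real n" using real_arch_simple by blast
  have fstS: "fst z \<in> {- real n..real n}" if "z \<in> S" for z
    using b[OF that] n norm_fst_le[of "fst z" "snd z"] by (simp add: abs_le_iff)
  have out: "z \<notin> S" if "fst z \<notin> {- real n..real n}" for z using fstS that by blast
  have "test_data n (C1 + C2 + C3) (D 0 1) (D 1 0) (\<lambda>x. \<phi> (x, 0))"
    unfolding test_data_def
  proof (intro conjI allI)
    show "D 0 1 \<in> borel_measurable borel" "D 1 0 \<in> borel_measurable borel"
      using D_cont by (auto intro: borel_measurable_continuous_onI)
    have "continuous_on UNIV (\<lambda>x. \<phi> (x, 0))"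
      using D_cont[of 0 0] unfolding D0
      by (rule continuous_on_compose2) (auto intro!: continuous_on_Pair continuous_on_id continuous_on_const)
    then show "(\<lambda>x. \<phi> (x, 0)) \<in> borel_measurable borel" by (rule borel_measurable_continuous_onI)
    show "\<bar>D 0 1 z\<bar> \<le> (C1 + C2 + C3) * indicator {- real n..real n} (fst z)" for z
      using C1(1) C2(1) C3(1) C1(2)[of z] D_zero[of z] out[of z]
      by (cases "fst z \<in> {- real n..real n}") (simp_all del: atLeastAtMost_iff)
    show "\<bar>D 1 0 z\<bar> \<le> (C1 + C2 + C3) * indicator {- real n..real n} (fst z)" for z
      using C1(1) C2(1) C3(1) C2(2)[of z] D_zero[of z] out[of z]
      by (cases "fst z \<in> {- real n..real n}") (simp_all del: atLeastAtMost_iff)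
    show "\<bar>\<phi> (x, 0)\<bar> \<le> (C1 + C2 + C3) * indicator {- real n..real n} x" for x
      using C1(1) C2(1) C3(1) C3(2)[of "(x, 0)"] zero[of "(x, 0)"] out[of "(x, 0)"]
      by (cases "x \<in> {- real n..real n}") (simp_all del: atLeastAtMost_iff)
  qed
  then show ?thesis unfolding dt dx by blast
qed

context time_strip
begin

text \<open>L1 distance of the weights; it controls the functional because the factors in front of
  the weights are essentially bounded.\<close>

definition test_dist :: "(real \<times> real \<Rightarrow> real) \<Rightarrow> (real \<times> real \<Rightarrow> real) \<Rightarrow> (real \<Rightarrow> real) \<Rightarrow>
    (real \<times> real \<Rightarrow> real) \<Rightarrow> (real \<times> real \<Rightarrow> real) \<Rightarrow> (real \<Rightarrow> real) \<Rightarrow> real" where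
  "test_dist p q r p' q' r' = (LINT z|strip. \<bar>p z - p' z\<bar>) + (LINT z|strip. \<bar>q z - q' z\<bar>) + (LINT x|lebesgue. \<bar>r x - r' x\<bar>)"

text \<open>A test function is identified with its two derivatives and its initial trace, a point in
  a product of three separable L1 spaces. Approximants there need not come from test functions, so
  nearby test functions are selected.\<close>

lemma test_functions_separable:
  obtains \<D> where "countable \<D>" "\<D> \<subseteq> test_functions T"
    "\<And>\<phi> e. \<phi> \<in> test_functions T \<Longrightarrow> e > 0 \<Longrightarrow> \<exists>\<psi>\<in>\<D>.
      test_dist (dt_of \<phi>) (dx_of \<phi>) (\<lambda>x. \<phi> (x, 0)) (dt_of \<psi>) (dx_of \<psi>) (\<lambda>x. \<psi> (x, 0)) < e"
proof -
  obtain D2 :: "(real \<times> real \<Rightarrow> real) set" where D2: "countable D2" "\<And>d. d \<in> D2 \<Longrightarrow> integrable lborel d"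
    "\<And>g e. integrable lebesgue g \<Longrightarrow> e > 0 \<Longrightarrow> \<exists>d\<in>D2. (LINT x|lebesgue. \<bar>g x - d x\<bar>) < e"
    using separable_L1_lebesgue[where 'a = "real \<times> real"] by metis
  obtain D1 :: "(real \<Rightarrow> real) set" where D1: "countable D1" "\<And>d. d \<in> D1 \<Longrightarrow> integrable lborel d"
    "\<And>g e. integrable lebesgue g \<Longrightarrow> e > 0 \<Longrightarrow> \<exists>d\<in>D1. (LINT x|lebesgue. \<bar>g x - d x\<bar>) < e"
    using separable_L1_lebesgue[where 'a = real] by metis
  have D1i: "integrable lebesgue d" if "d \<in> D1" for d
    using D1(2)[OF that] integrable_completion[of d lborel] by auto
  have D2i: "integrable lebesgue d" if "d \<in> D2" for d
    using D2(2)[OF that] integrable_completion[of d lborel] by auto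
  have strip_i: "integrable strip d" if "integrable lebesgue d" for d :: "real \<times> real \<Rightarrow> real"
    unfolding integrable_restrict_space[OF strip_Int_space]
    using integrable_mult_indicator[OF strip_set(1) that] .
  note D2s = strip_i[OF D2i]
  have data: "integrable strip (dt_of \<phi>)" "integrable strip (dx_of \<phi>)" "integrable lebesgue (\<lambda>x. \<phi> (x, 0))"
    if "\<phi> \<in> test_functions T" for \<phi>
    using test_function_data[OF that] test_data_integrable by blast+
  \<comment> \<open>Extension by zero passes from the strip to the plane, and restricting back to
    the strip does not increase the distance.\<close>
  have D2_strip: "\<exists>d\<in>D2. (LINT z|strip. \<bar>g z - d z\<bar>) < e" if g: "integrable strip g" and e: "e > 0" for g and e :: real
  proof -
    let ?g = "\<lambda>z. indicator (UNIV \<times> {0..T}) z *\<^sub>R g z"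
    have gi: "integrable lebesgue ?g" using g unfolding integrable_restrict_space[OF strip_Int_space] .
    obtain d where d: "d \<in> D2" "(LINT z|lebesgue. \<bar>?g z - d z\<bar>) < e" using D2(3)[OF gi e] by blast
    have "(LINT z|strip. \<bar>g z - d z\<bar>) = (LINT z|lebesgue. indicator (UNIV \<times> {0..T}) z *\<^sub>R \<bar>g z - d z\<bar>)"
      by (rule integral_restrict_space[OF strip_Int_space])
    also have "\<dots> \<le> (LINT z|lebesgue. \<bar>?g z - d z\<bar>)"
    proof (rule integral_mono)
      show "integrable lebesgue (\<lambda>z. indicator (UNIV \<times> {0..T}) z *\<^sub>R \<bar>g z - d z\<bar>)"
        using integrable_abs[OF Bochner_Integration.integrable_diff[OF g D2s[OF d(1)]]]
        unfolding integrable_restrict_space[OF strip_Int_space] .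
      show "integrable lebesgue (\<lambda>z. \<bar>?g z - d z\<bar>)"
        using integrable_abs[OF Bochner_Integration.integrable_diff[OF gi D2i[OF d(1)]]] .
      show "indicator (UNIV \<times> {0..T}) z *\<^sub>R \<bar>g z - d z\<bar> \<le> \<bar>?g z - d z\<bar>" for z
        by (auto simp: indicator_def)
    qed
    finally show ?thesis using d by (intro bexI[of _ d]) auto
  qed
  define C where "C = D2 \<times> D2 \<times> D1"
  have C: "countable C" unfolding C_def using D1(1) D2(1) by blast
  define near where "near \<phi> c e \<longleftrightarrow> test_dist (dt_of \<phi>) (dx_of \<phi>) (\<lambda>x. \<phi> (x, 0)) (fst c) (fst (snd c)) (snd (snd c)) \<le> e"
    for \<phi> c e
  define d where "d \<phi> \<psi> = test_dist (dt_of \<phi>) (dx_of \<phi>) (\<lambda>x. \<phi> (x, 0)) (dt_of \<psi>) (dx_of \<psi>) (\<lambda>x. \<psi> (x, 0))" for \<phi> \<psi>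
  note outer = that
  show thesis
  proof (rule countable_dense_subset_of_approximants[OF C, of "test_functions T" near d])
    show "\<exists>c\<in>C. near \<phi> c e" if \<phi>: "\<phi> \<in> test_functions T" and e: "e > 0" for \<phi> e
    proof -
      have e3: "e / 3 > 0" using e by simp
      obtain a where a: "a \<in> D2" "(LINT z|strip. \<bar>dt_of \<phi> z - a z\<bar>) < e/3" using D2_strip[OF data(1)[OF \<phi>] e3] by blast
      obtain b where b: "b \<in> D2" "(LINT z|strip. \<bar>dx_of \<phi> z - b z\<bar>) < e/3" using D2_strip[OF data(2)[OF \<phi>] e3] by blast
      obtain c where c: "c \<in> D1" "(LINT x|lebesgue. \<bar>\<phi> (x, 0) - c x\<bar>) < e/3" using D1(3)[OF data(3)[OF \<phi>] e3] by blast
      have "near \<phi> (a, b, c) e" unfolding near_def test_dist_def using a b c by simp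
      then show ?thesis using a b c unfolding C_def by blast
    qed
    show "d \<phi> \<psi> \<le> 2 * e" if \<phi>: "\<phi> \<in> test_functions T" and \<psi>: "\<psi> \<in> test_functions T" and c: "c \<in> C"
      and n: "near \<phi> c e" "near \<psi> c e" for \<phi> \<psi> c e
    proof -
      obtain a b c' where c': "c = (a, b, c')" "a \<in> D2" "b \<in> D2" "c' \<in> D1" using c unfolding C_def by auto
      have "(LINT z|strip. \<bar>dt_of \<phi> z - dt_of \<psi> z\<bar>) \<le> (LINT z|strip. \<bar>dt_of \<phi> z - a z\<bar>) + (LINT z|strip. \<bar>dt_of \<psi> z - a z\<bar>)"
        using data(1)[OF \<phi>] data(1)[OF \<psi>] D2s[OF c'(2)] by (rule integral_dist_triangle)
      moreover have "(LINT z|strip. \<bar>dx_of \<phi> z - dx_of \<psi> z\<bar>) \<le> (LINT z|strip. \<bar>dx_of \<phi> z - b z\<bar>) + (LINT z|strip. \<bar>dx_of \<psi> z - b z\<bar>)"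
        using data(2)[OF \<phi>] data(2)[OF \<psi>] D2s[OF c'(3)] by (rule integral_dist_triangle)
      moreover have "(LINT x|lebesgue. \<bar>\<phi> (x, 0) - \<psi> (x, 0)\<bar>) \<le> (LINT x|lebesgue. \<bar>\<phi> (x, 0) - c' x\<bar>) + (LINT x|lebesgue. \<bar>\<psi> (x, 0) - c' x\<bar>)"
        using data(3)[OF \<phi>] data(3)[OF \<psi>] D1i[OF c'(4)] by (rule integral_dist_triangle)
      ultimately show ?thesis using n unfolding near_def d_def test_dist_def c'(1) fst_conv snd_conv by linarith
    qed
    show thesis if "countable S'" "S' \<subseteq> test_functions T"
      "\<And>s e. s \<in> test_functions T \<Longrightarrow> 0 < e \<Longrightarrow> \<exists>s'\<in>S'. d s s' < e" for S'
      by (rule outer[of S']) (use that in \<open>auto simp: d_def\<close>)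
  qed
qed

end

section \<open>Dependence on the test function and on the level\<close>

context flux_strip
begin

text \<open>\<open>c\<close> bounds the factors in front of the three weights; it depends on the
  candidate and the level but not on the test data, as the density argument requires.\<close>

lemma entropy_functional_test_stable:
  assumes v: "v \<in> EM M" and \<alpha>: "\<alpha> \<in> A"
  obtains c where "c \<ge> 0" "\<And>n C p q r n' C' p' q' r'. test_data n C p q r \<Longrightarrow> test_data n' C' p' q' r' \<Longrightarrow>
    \<bar>\<Phi> \<alpha> p q r v - \<Phi> \<alpha> p' q' r' v\<bar> \<le> c * test_dist p q r p' q' r'"
proof -
  obtain S where S: "S \<ge> 0" "M \<le> S" "\<bar>\<alpha>\<bar> \<le> S" "AE x in lebesgue. \<bar>u\<^sub>0 x\<bar> \<le> S"
    "\<And>x. x \<notin> N \<Longrightarrow> \<bar>G x \<alpha>\<bar> \<le> S" "\<And>x r. \<bar>r\<bar> \<le> M \<Longrightarrow> \<bar>F x r\<bar> \<le> S"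
    using uniform_bound[of M "\<bar>\<alpha>\<bar>"] \<alpha> by (metis order_refl)
  have vM: "AE z in strip. \<bar>v z\<bar> \<le> M" using v by (auto simp: EM_def)
  have gen: "\<bar>(LINT z|R. h z * p z) - (LINT z|R. h z * p' z)\<bar> \<le> 2 * S * (LINT z|R. \<bar>p z - p' z\<bar>)"
    if "integrable R (\<lambda>z. h z * p z)" "integrable R (\<lambda>z. h z * p' z)" "integrable R p" "integrable R p'"
      "AE z in R. \<bar>h z\<bar> \<le> 2 * S" for R :: "'z measure" and h p p'
  proof -
    have "\<bar>(LINT z|R. h z * p z) - (LINT z|R. h z * p' z)\<bar> = \<bar>LINT z|R. h z * p z - h z * p' z\<bar>"
      using that by simp
    also have "\<dots> \<le> (LINT z|R. \<bar>h z * p z - h z * p' z\<bar>)" by (rule integral_abs_bound)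
    also have "\<dots> \<le> (LINT z|R. 2 * S * \<bar>p z - p' z\<bar>)"
    proof (rule integral_mono_AE)
      show "integrable R (\<lambda>z. \<bar>h z * p z - h z * p' z\<bar>)" "integrable R (\<lambda>z. 2 * S * \<bar>p z - p' z\<bar>)"
        using that by auto
      show "AE z in R. \<bar>h z * p z - h z * p' z\<bar> \<le> 2 * S * \<bar>p z - p' z\<bar>"
        using that(5)
      proof eventually_elim
        case (elim z)
        have "\<bar>h z * p z - h z * p' z\<bar> = \<bar>h z\<bar> * \<bar>p z - p' z\<bar>"
          by (simp add: abs_mult[symmetric] right_diff_distrib)
        also have "\<dots> \<le> 2 * S * \<bar>p z - p' z\<bar>" using elim by (intro mult_right_mono) auto
        finally show ?case .
      qed
    qed
    finally show ?thesis by simp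
  qed
  show thesis
  proof (rule that[of "2 * S"])
    show "2 * S \<ge> 0" using S by simp
    fix n C p q r n' C' p' q' r' assume d: "test_data n C p q r" and d': "test_data n' C' p' q' r'"
    note i = entropy_integrands[OF v \<alpha> d] and i' = entropy_integrands[OF v \<alpha> d']
    note t = test_data_integrable[OF d] and t' = test_data_integrable[OF d']
    have "AE z in strip. \<bar>\<bar>v z - G (fst z) \<alpha>\<bar>\<bar> \<le> 2 * S"
      using vM AE_N
    proof eventually_elim
      case (elim z)
      then show ?case using S(2) S(5)[of "fst z"] by linarith
    qed
    from gen[OF i(1) i'(1) t(1) t'(1) this]
    have 1: "\<bar>(LINT z|strip. \<bar>v z - G (fst z) \<alpha>\<bar> * p z) - (LINT z|strip. \<bar>v z - G (fst z) \<alpha>\<bar> * p' z)\<bar>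
       \<le> 2 * S * (LINT z|strip. \<bar>p z - p' z\<bar>)" .
    have "AE z in strip. \<bar>sgn (v z - G (fst z) \<alpha>) * (F (fst z) (v z) - \<alpha>)\<bar> \<le> 2 * S"
      using vM
    proof eventually_elim
      case (elim z)
      then have "\<bar>F (fst z) (v z) - \<alpha>\<bar> \<le> 2 * S" using S(3) S(6)[of "v z" "fst z"] by linarith
      then show ?case using S(1) by (auto simp: sgn_if abs_mult)
    qed
    from gen[OF i(2) i'(2) t(2) t'(2) this]
    have 2: "\<bar>(LINT z|strip. sgn (v z - G (fst z) \<alpha>) * (F (fst z) (v z) - \<alpha>) * q z) -
       (LINT z|strip. sgn (v z - G (fst z) \<alpha>) * (F (fst z) (v z) - \<alpha>) * q' z)\<bar>
       \<le> 2 * S * (LINT z|strip. \<bar>q z - q' z\<bar>)" .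
    have "AE x in lebesgue. \<bar>\<bar>u\<^sub>0 x - G x \<alpha>\<bar>\<bar> \<le> 2 * S"
      using S(4) N(3)
    proof eventually_elim
      case (elim x)
      then show ?case using S(5)[of x] by linarith
    qed
    from gen[OF i(3) i'(3) t(3) t'(3) this]
    have 3: "\<bar>(LINT x|lebesgue. \<bar>u\<^sub>0 x - G x \<alpha>\<bar> * r x) - (LINT x|lebesgue. \<bar>u\<^sub>0 x - G x \<alpha>\<bar> * r' x)\<bar>
       \<le> 2 * S * (LINT x|lebesgue. \<bar>r x - r' x\<bar>)" .
    show "\<bar>\<Phi> \<alpha> p q r v - \<Phi> \<alpha> p' q' r' v\<bar> \<le> 2 * S * test_dist p q r p' q' r'"
      using 1 2 3 unfolding entropy_functional_def test_dist_def distrib_left by linarith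
  qed
qed

text \<open>Dominated convergence, based on continuity of the roots in the level. Only the flux term
  needs care, at points where \<open>v\<close> meets the limiting steady state.\<close>

lemma entropy_functional_level_tendsto:
  assumes v: "v \<in> EM M" and a: "\<And>k. a k \<in> A" "a \<longlonglongrightarrow> \<alpha>" and \<alpha>: "\<alpha> \<in> A" and d: "test_data n C p q r"
  shows "(\<lambda>k. \<Phi> (a k) p q r v) \<longlonglongrightarrow> \<Phi> \<alpha> p q r v"
proof -
  obtain b where b: "\<And>k. \<bar>a k\<bar> \<le> b" using convergent_imp_bounded[OF a(2)] unfolding bounded_real by auto
  have \<alpha>b: "\<bar>\<alpha>\<bar> \<le> b" using b tendsto_rabs[OF a(2)] by (intro LIMSEQ_le_const2) auto
  obtain S where S: "S \<ge> 0" "M \<le> S" "b \<le> S" "AE x in lebesgue. \<bar>u\<^sub>0 x\<bar> \<le> S"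
    "\<And>x \<alpha>. x \<notin> N \<Longrightarrow> \<alpha> \<in> A \<Longrightarrow> \<bar>\<alpha>\<bar> \<le> b \<Longrightarrow> \<bar>G x \<alpha>\<bar> \<le> S" "\<And>x r. \<bar>r\<bar> \<le> M \<Longrightarrow> \<bar>F x r\<bar> \<le> S"
    using uniform_bound[of M b] by metis
  have vM: "AE z in strip. \<bar>v z\<bar> \<le> M" using v by (auto simp: EM_def)
  note i = entropy_integrands[OF v \<alpha> d] and ik = entropy_integrands[OF v a(1) d]
  note t = test_data_integrable[OF d]
  have Ga: "(\<lambda>k. G x (a k)) \<longlonglongrightarrow> G x \<alpha>" if "x \<notin> N" for x
    using that a \<alpha> by (intro G_tendsto) auto
  have bd: "\<bar>h * s\<bar> \<le> 2 * S * \<bar>s\<bar>" if "\<bar>h\<bar> \<le> 2 * S" for h s :: real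
    using that by (simp add: abs_mult mult_right_mono)
  have w: "integrable strip (\<lambda>z. 2 * S * \<bar>p z\<bar>)" "integrable strip (\<lambda>z. 2 * S * \<bar>q z\<bar>)"
    "integrable lebesgue (\<lambda>x. 2 * S * \<bar>r x\<bar>)" using t by auto
  have 1: "(\<lambda>k. LINT z|strip. \<bar>v z - G (fst z) (a k)\<bar> * p z) \<longlonglongrightarrow> (LINT z|strip. \<bar>v z - G (fst z) \<alpha>\<bar> * p z)"
  proof (rule integral_dominated_convergence[OF _ _ w(1)])
    show "(\<lambda>z. \<bar>v z - G (fst z) \<alpha>\<bar> * p z) \<in> borel_measurable strip" using i(1) by auto
    show "(\<lambda>z. \<bar>v z - G (fst z) (a k)\<bar> * p z) \<in> borel_measurable strip" for k using ik(1)[of k] by auto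
    show "AE z in strip. (\<lambda>k. \<bar>v z - G (fst z) (a k)\<bar> * p z) \<longlonglongrightarrow> \<bar>v z - G (fst z) \<alpha>\<bar> * p z"
      using AE_N by eventually_elim (intro tendsto_intros Ga)
    show "AE z in strip. norm (\<bar>v z - G (fst z) (a k)\<bar> * p z) \<le> 2 * S * \<bar>p z\<bar>" for k
      using AE_N vM
    proof eventually_elim
      case (elim z)
      have "\<bar>\<bar>v z - G (fst z) (a k)\<bar>\<bar> \<le> 2 * S"
        using elim S(2) S(5)[OF _ a(1)[of k] b[of k], of "fst z"] by linarith
      then show ?case unfolding real_norm_def by (rule bd)
    qed
  qed
  have 3: "(\<lambda>k. LINT x|lebesgue. \<bar>u\<^sub>0 x - G x (a k)\<bar> * r x) \<longlonglongrightarrow> (LINT x|lebesgue. \<bar>u\<^sub>0 x - G x \<alpha>\<bar> * r x)"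
  proof (rule integral_dominated_convergence[OF _ _ w(3)])
    show "(\<lambda>x. \<bar>u\<^sub>0 x - G x \<alpha>\<bar> * r x) \<in> borel_measurable lebesgue" using i(3) by auto
    show "(\<lambda>x. \<bar>u\<^sub>0 x - G x (a k)\<bar> * r x) \<in> borel_measurable lebesgue" for k using ik(3)[of k] by auto
    show "AE x in lebesgue. (\<lambda>k. \<bar>u\<^sub>0 x - G x (a k)\<bar> * r x) \<longlonglongrightarrow> \<bar>u\<^sub>0 x - G x \<alpha>\<bar> * r x"
      using N(3) by eventually_elim (intro tendsto_intros Ga)
    show "AE x in lebesgue. norm (\<bar>u\<^sub>0 x - G x (a k)\<bar> * r x) \<le> 2 * S * \<bar>r x\<bar>" for k
      using N(3) S(4)
    proof eventually_elim
      case (elim x)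
      have "\<bar>\<bar>u\<^sub>0 x - G x (a k)\<bar>\<bar> \<le> 2 * S"
        using elim S(5)[OF _ a(1)[of k] b[of k], of x] by linarith
      then show ?case unfolding real_norm_def by (rule bd)
    qed
  qed
  have 2: "(\<lambda>k. LINT z|strip. sgn (v z - G (fst z) (a k)) * (F (fst z) (v z) - a k) * q z) \<longlonglongrightarrow>
     (LINT z|strip. sgn (v z - G (fst z) \<alpha>) * (F (fst z) (v z) - \<alpha>) * q z)"
  proof (rule integral_dominated_convergence[OF _ _ w(2)])
    show "(\<lambda>z. sgn (v z - G (fst z) \<alpha>) * (F (fst z) (v z) - \<alpha>) * q z) \<in> borel_measurable strip" using i(2) by auto
    show "(\<lambda>z. sgn (v z - G (fst z) (a k)) * (F (fst z) (v z) - a k) * q z) \<in> borel_measurable strip" for k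
      using ik(2)[of k] by auto
    show "AE z in strip. (\<lambda>k. sgn (v z - G (fst z) (a k)) * (F (fst z) (v z) - a k) * q z) \<longlonglongrightarrow>
        sgn (v z - G (fst z) \<alpha>) * (F (fst z) (v z) - \<alpha>) * q z"
      using AE_N
    proof eventually_elim
      case (elim z)
      have d: "(\<lambda>k. F (fst z) (v z) - a k) \<longlonglongrightarrow> F (fst z) (v z) - \<alpha>" by (intro tendsto_intros a)
      show ?case
      proof (rule tendsto_mult_right, cases "v z = G (fst z) \<alpha>")
        \<comment> \<open>The signs need not converge here, but they are bounded by 1 and the other
          factor tends to 0.\<close>
        case True
        then have 0: "F (fst z) (v z) - \<alpha> = 0" using G[OF elim \<alpha>] by simp
        have "(\<lambda>k. sgn (v z - G (fst z) (a k)) * (F (fst z) (v z) - a k)) \<longlonglongrightarrow> 0"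
        proof (rule Lim_null_comparison)
          show "\<forall>\<^sub>F k in sequentially. norm (sgn (v z - G (fst z) (a k)) * (F (fst z) (v z) - a k)) \<le> \<bar>F (fst z) (v z) - a k\<bar>"
            by (intro always_eventually allI) (auto simp: sgn_if)
          show "(\<lambda>k. \<bar>F (fst z) (v z) - a k\<bar>) \<longlonglongrightarrow> 0"
            using tendsto_rabs[OF d] 0 by simp
        qed
        then show "(\<lambda>k. sgn (v z - G (fst z) (a k)) * (F (fst z) (v z) - a k)) \<longlonglongrightarrow> sgn (v z - G (fst z) \<alpha>) * (F (fst z) (v z) - \<alpha>)"
          using 0 by simp
      next
        case False
        show "(\<lambda>k. sgn (v z - G (fst z) (a k)) * (F (fst z) (v z) - a k)) \<longlonglongrightarrow> sgn (v z - G (fst z) \<alpha>) * (F (fst z) (v z) - \<alpha>)"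
          using False by (intro tendsto_mult d tendsto_sgn tendsto_diff tendsto_const Ga elim) auto
      qed
    qed
    show "AE z in strip. norm (sgn (v z - G (fst z) (a k)) * (F (fst z) (v z) - a k) * q z) \<le> 2 * S * \<bar>q z\<bar>" for k
      using vM
    proof eventually_elim
      case (elim z)
      have "\<bar>F (fst z) (v z) - a k\<bar> \<le> 2 * S" using S(3) b[of k] S(6)[OF elim, of "fst z"] by linarith
      then have "\<bar>sgn (v z - G (fst z) (a k)) * (F (fst z) (v z) - a k)\<bar> \<le> 2 * S"
        using S(1) by (auto simp: sgn_if abs_mult)
      then show ?case unfolding real_norm_def by (rule bd)
    qed
  qed
  show ?thesis unfolding entropy_functional_def by (intro tendsto_add 1 2 3)
qed

text \<open>All test functions are reached at a fixed level of \<open>A0\<close> before the level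
  varies; this order allows the stability constant \<open>c\<close> to depend on the level.\<close>

lemma entropy_inequality_from_dense:
  assumes v: "v \<in> EM M" and A0: "A0 \<subseteq> A" "A \<subseteq> closure A0" and \<D>: "\<D> \<subseteq> test_functions T"
    "\<And>\<phi> e. \<phi> \<in> test_functions T \<Longrightarrow> e > 0 \<Longrightarrow> \<exists>\<psi>\<in>\<D>.
      test_dist (dt_of \<phi>) (dx_of \<phi>) (\<lambda>x. \<phi> (x, 0)) (dt_of \<psi>) (dx_of \<psi>) (\<lambda>x. \<psi> (x, 0)) < e"
    and ge: "\<And>\<alpha> \<psi>. \<alpha> \<in> A0 \<Longrightarrow> \<psi> \<in> \<D> \<Longrightarrow> \<Phi> \<alpha> (dt_of \<psi>) (dx_of \<psi>) (\<lambda>x. \<psi> (x, 0)) v \<ge> 0"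
    and \<alpha>: "\<alpha> \<in> A" and \<phi>: "\<phi> \<in> test_functions T" and m: "steady_state F B \<alpha> m"
  shows "adapted_entropy_inequality T F u\<^sub>0 \<alpha> m \<phi> v"
proof -
  define \<Psi> where "\<Psi> \<alpha> \<phi> = \<Phi> \<alpha> (dt_of \<phi>) (dx_of \<phi>) (\<lambda>x. \<phi> (x, 0)) v" for \<alpha> \<phi>
  have "\<Psi> \<beta> \<phi> \<ge> 0" if \<beta>: "\<beta> \<in> A0" for \<beta>
  proof (rule field_le_epsilon)
    fix e :: real assume e: "e > 0"
    have \<beta>A: "\<beta> \<in> A" using \<beta> A0 by blast
    obtain c where c: "c \<ge> 0" "\<And>n C p q r n' C' p' q' r'. test_data n C p q r \<Longrightarrow> test_data n' C' p' q' r' \<Longrightarrow>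
      \<bar>\<Phi> \<beta> p q r v - \<Phi> \<beta> p' q' r' v\<bar> \<le> c * test_dist p q r p' q' r'"
      using entropy_functional_test_stable[OF v \<beta>A] by metis
    have "e / (c + 1) > 0" using e c by simp
    then obtain \<psi> where \<psi>: "\<psi> \<in> \<D>"
      "test_dist (dt_of \<phi>) (dx_of \<phi>) (\<lambda>x. \<phi> (x, 0)) (dt_of \<psi>) (dx_of \<psi>) (\<lambda>x. \<psi> (x, 0)) < e / (c + 1)"
      using \<D>(2)[OF \<phi>] by blast
    obtain n C where d: "test_data n C (dt_of \<phi>) (dx_of \<phi>) (\<lambda>x. \<phi> (x, 0))" using test_function_data[OF \<phi>] by blast
    obtain n' C' where d': "test_data n' C' (dt_of \<psi>) (dx_of \<psi>) (\<lambda>x. \<psi> (x, 0))"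
      using test_function_data[of \<psi> T] \<psi> \<D>(1) by blast
    have "\<bar>\<Psi> \<beta> \<phi> - \<Psi> \<beta> \<psi>\<bar> \<le> c * (e / (c + 1))"
      unfolding \<Psi>_def using \<psi>(2) c(1) by (intro order_trans[OF c(2)[OF d d']] mult_left_mono) auto
    also have "\<dots> \<le> e" using c(1) e by (simp add: field_simps)
    finally show "0 \<le> \<Psi> \<beta> \<phi> + e" using ge[OF \<beta> \<psi>(1)] unfolding \<Psi>_def by linarith
  qed
  moreover have "\<alpha> \<in> closure A0" using A0(2) \<alpha> by blast
  then obtain a where a: "\<And>k. a k \<in> A0" "a \<longlonglongrightarrow> \<alpha>"
    unfolding closure_sequential by blast
  moreover have "(\<lambda>k. \<Psi> (a k) \<phi>) \<longlonglongrightarrow> \<Psi> \<alpha> \<phi>"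
  proof -
    obtain n C where d: "test_data n C (dt_of \<phi>) (dx_of \<phi>) (\<lambda>x. \<phi> (x, 0))" using test_function_data[OF \<phi>] by blast
    show ?thesis unfolding \<Psi>_def using entropy_functional_level_tendsto[OF v _ a(2) \<alpha> d] a(1) A0(1) by blast
  qed
  ultimately have "\<Psi> \<alpha> \<phi> \<ge> 0" by (intro LIMSEQ_le_const) auto
  moreover have "AE x in lebesgue. m x = G x \<alpha>" using m steady_state_iff[OF \<alpha>] by simp
  ultimately show ?thesis
    unfolding adapted_entropy_inequality_iff \<Psi>_def using entropy_functional_cong_AE by metis
qed

end

section \<open>Measurability in \<open>\<omega>\<close>\<close>

text \<open>Sampling at points of the full-measure set where measurability in \<open>\<omega>\<close> is known gives functions
  that are jointly measurable, and they converge at every continuity point.\<close>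

lemma sampling_jointly_measurable:
  fixes h :: "'w \<Rightarrow> real \<Rightarrow> real \<Rightarrow> real" and N :: "'w \<Rightarrow> real set"
  assumes meas: "\<And>\<rho>. AE x in lebesgue. (\<lambda>\<omega>. h \<omega> x \<rho>) \<in> borel_measurable P"
    and cont: "\<And>\<omega> x X r \<rho>. \<omega> \<in> space P \<Longrightarrow> x \<notin> N \<omega> \<Longrightarrow> X \<longlonglongrightarrow> x \<Longrightarrow> r \<longlonglongrightarrow> \<rho> \<Longrightarrow>
      (\<lambda>n. h \<omega> (X n) (r n)) \<longlonglongrightarrow> h \<omega> x \<rho>"
  obtains H :: "'w \<times> real \<times> real \<Rightarrow> real" where "H \<in> borel_measurable (P \<Otimes>\<^sub>M borel)"
    "\<And>\<omega> x \<rho>. \<omega> \<in> space P \<Longrightarrow> x \<notin> N \<omega> \<Longrightarrow> H (\<omega>, x, \<rho>) = h \<omega> x \<rho>"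
proof -
  \<comment> \<open>The exceptional null set may depend on \<rho>; restriction to rational values
    leaves a single one.\<close>
  have "AE x in lebesgue. \<forall>q\<in>\<rat>. (\<lambda>\<omega>. h \<omega> x q) \<in> borel_measurable P"
    using meas by (intro AE_ball_countable') (auto simp: countable_rat)
  then have good: "AE x in lborel. \<forall>q\<in>\<rat>. (\<lambda>\<omega>. h \<omega> x q) \<in> borel_measurable P"
    by (simp add: AE_completion_iff)
  \<comment> \<open>A set of full measure meets every interval of positive length, which provides an
    admissible sample point near each grid point.\<close>
  have "\<exists>x. \<bar>x - real_of_int i / real (Suc n)\<bar> \<le> 1 / real (Suc n) \<and> (\<forall>q\<in>\<rat>. (\<lambda>\<omega>. h \<omega> x q) \<in> borel_measurable P)" for n i
  proof (rule ccontr)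
    let ?I = "{real_of_int i / real (Suc n) .. real_of_int i / real (Suc n) + 1 / real (Suc n)}"
    assume no: "\<nexists>x. \<bar>x - real_of_int i / real (Suc n)\<bar> \<le> 1 / real (Suc n) \<and> (\<forall>q\<in>\<rat>. (\<lambda>\<omega>. h \<omega> x q) \<in> borel_measurable P)"
    have "AE x in lborel. x \<notin> ?I"
      using good
    proof eventually_elim
      case (elim x)
      show ?case
      proof
        assume "x \<in> ?I"
        then have "\<bar>x - real_of_int i / real (Suc n)\<bar> \<le> 1 / real (Suc n)" by auto
        then show False using no elim by blast
      qed
    qed
    then have "emeasure lborel ?I = 0" by (subst (asm) AE_iff_measurable[of ?I]) auto
    then show False by simp
  qed
  note ex = this
  define s where "s n i = (SOME x. \<bar>x - real_of_int i / real (Suc n)\<bar> \<le> 1 / real (Suc n) \<and> (\<forall>q\<in>\<rat>. (\<lambda>\<omega>. h \<omega> x q) \<in> borel_measurable P))" for n i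
  have s: "\<bar>s n i - real_of_int i / real (Suc n)\<bar> \<le> 1 / real (Suc n)"
    "q \<in> \<rat> \<Longrightarrow> (\<lambda>\<omega>. h \<omega> (s n i) q) \<in> borel_measurable P" for n i q
    using someI_ex[OF ex[of i n]] unfolding s_def by auto
  \<comment> \<open>The last argument is rounded down to a rational grid, since measurability at the
    sample points is known for rational values.\<close>
  define g where "g n x = real_of_int \<lfloor>real (Suc n) * x\<rfloor> / real (Suc n)" for n :: nat and x :: real
  have g_le: "\<bar>g n x - x\<bar> \<le> 1 / real (Suc n)" for n x
  proof -
    have "real_of_int \<lfloor>real (Suc n) * x\<rfloor> \<le> real (Suc n) * x" "real (Suc n) * x < real_of_int \<lfloor>real (Suc n) * x\<rfloor> + 1"
      by linarith+
    then have "g n x \<le> x" "x < (real_of_int \<lfloor>real (Suc n) * x\<rfloor> + 1) / real (Suc n)"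
      unfolding g_def by (simp_all add: pos_divide_le_eq pos_less_divide_eq mult.commute del: of_nat_Suc)
    then show ?thesis unfolding g_def by (simp add: add_divide_distrib del: of_nat_Suc)
  qed
  have to0: "(\<lambda>n. c / real (Suc n)) \<longlonglongrightarrow> 0" for c
    using tendsto_mult_right_zero[OF LIMSEQ_Suc[OF lim_1_over_n], of c] by simp
  have g_lim: "(\<lambda>n. g n x) \<longlonglongrightarrow> x" for x
    by (rule LIM_zero_cancel, rule Lim_null_comparison[OF _ to0[of 1]]) (use g_le in auto)
  have s_lim: "(\<lambda>n. s n \<lfloor>real (Suc n) * x\<rfloor>) \<longlonglongrightarrow> x" for x
  proof (rule LIM_zero_cancel, rule Lim_null_comparison[OF _ to0[of 2]])
    show "\<forall>\<^sub>F n in sequentially. norm (s n \<lfloor>real (Suc n) * x\<rfloor> - x) \<le> 2 / real (Suc n)"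
    proof (intro always_eventually allI)
      fix n
      have "\<bar>s n \<lfloor>real (Suc n) * x\<rfloor> - g n x\<bar> \<le> 1 / real (Suc n)" unfolding g_def by (rule s(1))
      moreover have "2 / real (Suc n) = 1 / real (Suc n) + 1 / real (Suc n)" by simp
      ultimately show "norm (s n \<lfloor>real (Suc n) * x\<rfloor> - x) \<le> 2 / real (Suc n)"
        using g_le[of n x] unfolding real_norm_def by linarith
    qed
  qed
  \<comment> \<open>For each pair of grid indices the sample depends on \<omega> alone, and there
    are countably many such pairs.\<close>
  define h' where "h' n z = h (fst z) (s n \<lfloor>real (Suc n) * fst (snd z)\<rfloor>) (g n (snd (snd z)))" for n and z :: "'w \<times> real \<times> real"
  have [measurable]: "(\<lambda>z. fst (snd z)) \<in> borel_measurable (P \<Otimes>\<^sub>M (borel :: (real \<times> real) measure))"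
    "(\<lambda>z. snd (snd z)) \<in> borel_measurable (P \<Otimes>\<^sub>M (borel :: (real \<times> real) measure))"
    by (auto intro!: measurable_compose[OF measurable_snd] borel_measurable_continuous_onI continuous_intros)
  have h'_meas: "h' n \<in> borel_measurable (P \<Otimes>\<^sub>M borel)" for n
  proof -
    have "(\<lambda>z. h (fst z) (s n i) (real_of_int j / real (Suc n))) \<in> borel_measurable (P \<Otimes>\<^sub>M (borel :: (real \<times> real) measure))" for i j
      by (rule measurable_compose[OF measurable_fst s(2)]) auto
    then have "(\<lambda>z. h (fst z) (s n i) (real_of_int \<lfloor>real (Suc n) * snd (snd z)\<rfloor> / real (Suc n))) \<in> borel_measurable (P \<Otimes>\<^sub>M (borel :: (real \<times> real) measure))" for i
      by (rule measurable_compose_countable) measurable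
    then show ?thesis unfolding h'_def g_def
      by (rule measurable_compose_countable) measurable
  qed
  show thesis
  proof
    \<comment> \<open>\<open>lim\<close> is measurable even where the samples diverge, so
      \<open>N \<omega>\<close> may vary with \<omega> in any manner.\<close>
    show "(\<lambda>z. lim (\<lambda>n. h' n z)) \<in> borel_measurable (P \<Otimes>\<^sub>M borel)"
      using h'_meas by (rule borel_measurable_lim_metric)
    show "lim (\<lambda>n. h' n (\<omega>, x, \<rho>)) = h \<omega> x \<rho>" if "\<omega> \<in> space P" "x \<notin> N \<omega>" for \<omega> x \<rho>
      unfolding h'_def fst_conv snd_conv by (rule limI, rule cont[OF that s_lim g_lim])
  qed
qed

text \<open>Carries a single branch. The two branches become two instances with the same flux,
  levels and initial datum.\<close>

locale random_flux = prob_space P + complete_measure P + time_strip T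
  for P :: "'w measure" and T :: real +
  fixes f :: "'w \<Rightarrow> real \<Rightarrow> real \<Rightarrow> real" and N :: "'w \<Rightarrow> real set" and A :: "real set"
    and B :: "'w \<Rightarrow> real \<Rightarrow> real set" and G :: "'w \<Rightarrow> real \<Rightarrow> real \<Rightarrow> real"
    and u\<^sub>0 :: "'w \<Rightarrow> real \<Rightarrow> real" and p :: real
  assumes path: "\<omega> \<in> space P \<Longrightarrow> flux_strip T (f \<omega>) (N \<omega>) A (B \<omega>) (G \<omega>) (u\<^sub>0 \<omega>)"
    and f_meas: "AE x in lebesgue. (\<lambda>\<omega>. f \<omega> x \<rho>) \<in> borel_measurable P"
    and G_meas: "\<alpha> \<in> A \<Longrightarrow> AE x in lebesgue. (\<lambda>\<omega>. G \<omega> x \<alpha>) \<in> borel_measurable P"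
    and u0_L1: "in_Bochner_Lp P p L1_topology L1_norm u\<^sub>0"
begin

lemma f_version:
  obtains H :: "'w \<times> real \<times> real \<Rightarrow> real" where "H \<in> borel_measurable (P \<Otimes>\<^sub>M borel)"
    "\<And>\<omega> x \<rho>. \<omega> \<in> space P \<Longrightarrow> x \<notin> N \<omega> \<Longrightarrow> H (\<omega>, x, \<rho>) = f \<omega> x \<rho>"
proof (rule sampling_jointly_measurable[of f P N])
  show "AE x in lebesgue. (\<lambda>\<omega>. f \<omega> x \<rho>) \<in> borel_measurable P" for \<rho> by (rule f_meas)
  show "(\<lambda>n. f \<omega> (X n) (r n)) \<longlonglongrightarrow> f \<omega> x \<rho>"
    if "\<omega> \<in> space P" "x \<notin> N \<omega>" "X \<longlonglongrightarrow> x" "r \<longlonglongrightarrow> \<rho>" for \<omega> x X r \<rho>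
  proof -
    interpret flux_strip T "f \<omega>" "N \<omega>" A "B \<omega>" "G \<omega>" "u\<^sub>0 \<omega>" by (rule path[OF that(1)])
    show ?thesis using that(2-4) by (rule F_tendsto)
  qed
qed (use that in blast)

lemma G_version:
  assumes \<alpha>: "\<alpha> \<in> A"
  obtains H :: "'w \<times> real \<Rightarrow> real" where "H \<in> borel_measurable (P \<Otimes>\<^sub>M borel)"
    "\<And>\<omega> x. \<omega> \<in> space P \<Longrightarrow> x \<notin> N \<omega> \<Longrightarrow> H (\<omega>, x) = G \<omega> x \<alpha>"
\<comment> \<open>The level is fixed, so the last argument of the sampling construction is a dummy,
  later set to 0.\<close>
proof (rule sampling_jointly_measurable[of "\<lambda>\<omega> x _. G \<omega> x \<alpha>" P N])
  show "AE x in lebesgue. (\<lambda>\<omega>. G \<omega> x \<alpha>) \<in> borel_measurable P" for \<rho> :: real by (rule G_meas[OF \<alpha>])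
  show "(\<lambda>n. G \<omega> (X n) \<alpha>) \<longlonglongrightarrow> G \<omega> x \<alpha>" if "\<omega> \<in> space P" "x \<notin> N \<omega>" "X \<longlonglongrightarrow> x" for \<omega> x X
  proof -
    interpret flux_strip T "f \<omega>" "N \<omega>" A "B \<omega>" "G \<omega>" "u\<^sub>0 \<omega>" by (rule path[OF that(1)])
    have "isCont (\<lambda>x. G \<omega> x \<alpha>) x"
      using G_continuous_on[OF \<alpha>] N(1) that(2) by (simp add: continuous_on_eq_continuous_at open_Compl)
    then show ?thesis using that(3) by (rule isCont_tendsto_compose)
  qed
next
  fix H :: "'w \<times> real \<times> real \<Rightarrow> real"
  assume H: "H \<in> borel_measurable (P \<Otimes>\<^sub>M borel)"
    "\<And>\<omega> x \<rho>. \<omega> \<in> space P \<Longrightarrow> x \<notin> N \<omega> \<Longrightarrow> H (\<omega>, x, \<rho>) = G \<omega> x \<alpha>"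
  have "(\<lambda>z. (fst z, snd z, 0 :: real)) \<in> P \<Otimes>\<^sub>M borel \<rightarrow>\<^sub>M P \<Otimes>\<^sub>M (borel :: (real \<times> real) measure)"
    by (intro measurable_Pair measurable_fst measurable_compose[OF measurable_snd]
        borel_measurable_continuous_onI continuous_intros)
  from measurable_compose[OF this H(1)] show thesis using H(2) by (intro that) auto
qed

text \<open>The integrand agrees with a jointly measurable function only off a null set that depends
  on \<omega>. Path by path this changes no integral, and Fubini's theorem for \<open>lborel\<close>
  applies to the joint version.\<close>

lemma strip_integral_measurable:
  fixes K :: "'w \<times> real \<times> real \<Rightarrow> real"
  assumes K: "K \<in> borel_measurable (P \<Otimes>\<^sub>M borel)"
    and k: "\<And>\<omega>. \<omega> \<in> space P \<Longrightarrow> AE z in strip. k \<omega> z = K (\<omega>, z)"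
  shows "(\<lambda>\<omega>. integral\<^sup>L strip (k \<omega>)) \<in> borel_measurable P"
proof -
  let ?S = "(UNIV :: real set) \<times> {0..T}"
  have [measurable]: "K \<in> borel_measurable (P \<Otimes>\<^sub>M borel)" "?S \<in> sets borel" using K strip_set by auto
  have "(\<lambda>\<omega>. \<integral>z. indicator ?S z *\<^sub>R K (\<omega>, z) \<partial>lborel) \<in> borel_measurable P"
    by (rule lborel.borel_measurable_lebesgue_integral) measurable
  moreover have "integral\<^sup>L strip (k \<omega>) = (\<integral>z. indicator ?S z *\<^sub>R K (\<omega>, z) \<partial>lborel)" if "\<omega> \<in> space P" for \<omega>
  proof -
    have "integral\<^sup>L strip (k \<omega>) = (\<integral>z. K (\<omega>, z) \<partial>strip)"
      using k[OF that] by (rule complete_measure.integral_cong_AE_complete[OF complete_measure_lebesgue_on[OF strip_set(1)]])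
    also have "\<dots> = (\<integral>z. indicator ?S z *\<^sub>R K (\<omega>, z) \<partial>lebesgue)" by (rule integral_restrict_space[OF strip_Int_space])
    also have "\<dots> = (\<integral>z. indicator ?S z *\<^sub>R K (\<omega>, z) \<partial>lborel)"
    proof (rule integral_completion)
      have [measurable]: "(\<lambda>z. K (\<omega>, z)) \<in> borel_measurable borel"
        using that by measurable
      show "(\<lambda>z. indicator ?S z *\<^sub>R K (\<omega>, z)) \<in> borel_measurable lborel" by measurable
    qed
    finally show ?thesis .
  qed
  ultimately show ?thesis by (simp cong: measurable_cong)
qed

lemma line_integral_measurable:
  fixes K :: "'w \<times> real \<Rightarrow> real"
  assumes K: "K \<in> borel_measurable (P \<Otimes>\<^sub>M borel)"
    and k: "\<And>\<omega>. \<omega> \<in> space P \<Longrightarrow> AE x in lebesgue. k \<omega> x = K (\<omega>, x)"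
  shows "(\<lambda>\<omega>. integral\<^sup>L lebesgue (k \<omega>)) \<in> borel_measurable P"
proof -
  have [measurable]: "K \<in> borel_measurable (P \<Otimes>\<^sub>M borel)" using K by auto
  have "(\<lambda>\<omega>. \<integral>z. K (\<omega>, z) \<partial>lborel) \<in> borel_measurable P"
    by (rule lborel.borel_measurable_lebesgue_integral) measurable
  moreover have "integral\<^sup>L lebesgue (k \<omega>) = (\<integral>z. K (\<omega>, z) \<partial>lborel)" if "\<omega> \<in> space P" for \<omega>
  proof -
    have "integral\<^sup>L lebesgue (k \<omega>) = (\<integral>z. K (\<omega>, z) \<partial>lebesgue)"
      using k[OF that] by (rule complete_measure.integral_cong_AE_complete[OF complete_measure_lebesgue])
    also have "\<dots> = (\<integral>z. K (\<omega>, z) \<partial>lborel)"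
    proof (rule integral_completion)
      show "(\<lambda>z. K (\<omega>, z)) \<in> borel_measurable lborel" using that by measurable
    qed
    finally show ?thesis .
  qed
  ultimately show ?thesis by (simp cong: measurable_cong)
qed

text \<open>The datum is given as an L1-valued map, not as a jointly measurable function. Its term
  is Lipschitz in the L1 norm, so values at a countable dense set, combined with the measurable
  distances to these points, determine it.\<close>

lemma initial_term_measurable:
  assumes \<alpha>: "\<alpha> \<in> A" and d: "test_data n C q q' r"
  shows "(\<lambda>\<omega>. LINT x|lebesgue. \<bar>u\<^sub>0 \<omega> x - G \<omega> x \<alpha>\<bar> * r x) \<in> borel_measurable P"
proof -
  obtain v where v: "strongly_measurable P L1_topology v"
    "AE \<omega> in P. AE x in lebesgue. u\<^sub>0 \<omega> x = v \<omega> x"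
    using u0_L1 unfolding in_Bochner_Lp_def by blast
  obtain D :: "(real \<Rightarrow> real) set" where D: "countable D" "\<And>d. d \<in> D \<Longrightarrow> d \<in> borel_measurable borel"
    "\<And>d. d \<in> D \<Longrightarrow> integrable lborel d"
    "\<And>g e. integrable lebesgue g \<Longrightarrow> e > 0 \<Longrightarrow> \<exists>d\<in>D. (LINT x|lebesgue. \<bar>g x - d x\<bar>) < e"
    by (rule separable_L1_lebesgue[where 'a = real]) blast
  have Di: "integrable lebesgue d" if "d \<in> D" for d
    using D(3)[OF that] integrable_completion[of d lborel] by auto
  obtain H where H: "H \<in> borel_measurable (P \<Otimes>\<^sub>M borel)"
    "\<And>\<omega> x. \<omega> \<in> space P \<Longrightarrow> x \<notin> N \<omega> \<Longrightarrow> H (\<omega>, x) = G \<omega> x \<alpha>"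
    using G_version[OF \<alpha>] by blast
  have r: "r \<in> borel_measurable borel" "\<And>x. \<bar>r x\<bar> \<le> C * indicator {- real n..real n} x"
    using d unfolding test_data_def by blast+
  have "C * indicator {- real n..real n} 0 \<ge> 0" using r(2)[of 0] by (metis abs_ge_zero order_trans)
  then have C: "C \<ge> 0" by simp
  have rC: "\<bar>r x\<bar> \<le> C" for x using r(2)[of x] C
    by (cases "x \<in> {- real n..real n}") (simp_all del: atLeastAtMost_iff)
  have rl: "r \<in> borel_measurable lebesgue" using r(1) by (simp add: measurable_completion)
  define J where "J \<omega> g = (LINT x|lebesgue. \<bar>g x - G \<omega> x \<alpha>\<bar> * r x)" for \<omega> g
  have top: "topspace L1_topology = {g. integrable lebesgue g}"
    unfolding L1_topology_def by (rule topspace_pseudometrics_topology) (auto simp: L1_norm_def)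
  have vm: "v \<in> measurable P (sigma {g. integrable lebesgue g} {U. openin L1_topology U})"
    using v(1) unfolding strongly_measurable_def borel_of_topology_def top by simp
  have sub: "{U. openin L1_topology U} \<subseteq> Pow {g. integrable lebesgue g}"
    using openin_subset top by blast
  have v_int: "integrable lebesgue (v \<omega>)" if "\<omega> \<in> space P" for \<omega>
    using measurable_space[OF vm that] by (simp add: space_measure_of[OF sub])
  have ball: "{\<omega> \<in> space P. (LINT x|lebesgue. \<bar>d x - v \<omega> x\<bar>) < e} \<in> sets P" if dD: "d \<in> D" and e: "e > 0" for d e
  proof -
    have "openin L1_topology {g \<in> {g. integrable lebesgue g}. L1_norm (\<lambda>x. d x - g x) < e}"
      unfolding L1_topology_def using Di[OF dD] e
      by (intro openin_pseudometrics_topology_ball[where d = "\<lambda>g h. L1_norm (\<lambda>x. g x - h x)"]) auto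
    then have "{g \<in> {g. integrable lebesgue g}. L1_norm (\<lambda>x. d x - g x) < e} \<in>
        sets (sigma {g. integrable lebesgue g} {U. openin L1_topology U})"
      by (simp add: sets_measure_of[OF sub] sigma_sets.Basic)
    from measurable_sets[OF vm this]
    have "v -` {g \<in> {g. integrable lebesgue g}. L1_norm (\<lambda>x. d x - g x) < e} \<inter> space P \<in> sets P" .
    also have "v -` {g \<in> {g. integrable lebesgue g}. L1_norm (\<lambda>x. d x - g x) < e} \<inter> space P =
        {\<omega> \<in> space P. (LINT x|lebesgue. \<bar>d x - v \<omega> x\<bar>) < e}"
      using v_int by (auto simp: L1_norm_def)
    finally show ?thesis .
  qed
  have Jd: "(\<lambda>\<omega>. J \<omega> d) \<in> borel_measurable P" if dD: "d \<in> D" for d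
    unfolding J_def
  proof (rule line_integral_measurable)
    note [measurable] = H(1) D(2)[OF dD] r(1)
    show "(\<lambda>z. \<bar>d (snd z) - H z\<bar> * r (snd z)) \<in> borel_measurable (P \<Otimes>\<^sub>M borel)" by measurable
    show "AE x in lebesgue. \<bar>d x - G \<omega> x \<alpha>\<bar> * r x = \<bar>d (snd (\<omega>, x)) - H (\<omega>, x)\<bar> * r (snd (\<omega>, x))"
      if "\<omega> \<in> space P" for \<omega>
    proof -
      interpret flux_strip T "f \<omega>" "N \<omega>" A "B \<omega>" "G \<omega>" "u\<^sub>0 \<omega>" by (rule path[OF that])
      show ?thesis using N(3) by eventually_elim (simp add: H(2)[OF that])
    qed
  qed
  have J_Lip: "\<bar>J \<omega> g - J \<omega> d\<bar> \<le> C * (LINT x|lebesgue. \<bar>d x - g x\<bar>)"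
    if \<omega>: "\<omega> \<in> space P" and g: "integrable lebesgue g" and d: "integrable lebesgue d" for \<omega> g d
  proof -
    interpret flux_strip T "f \<omega>" "N \<omega>" A "B \<omega>" "G \<omega>" "u\<^sub>0 \<omega>" by (rule path[OF \<omega>])
    obtain R where R: "R \<ge> 0" "\<And>x. x \<notin> N \<omega> \<Longrightarrow> \<bar>G \<omega> x \<alpha>\<bar> \<le> R"
      using G_bounded[of "\<bar>\<alpha>\<bar>"] \<alpha> by (metis order_refl)
    note [measurable] = rl G_measurable[OF \<alpha>]
    have i: "integrable lebesgue (\<lambda>x. \<bar>a x - G \<omega> x \<alpha>\<bar> * r x)" if a: "integrable lebesgue a" for a
    proof (rule Bochner_Integration.integrable_bound)
      show "integrable lebesgue (\<lambda>x. C * \<bar>a x\<bar> + R * (C * indicator {- real n..real n} x))"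
        using a by (intro Bochner_Integration.integrable_add integrable_mult_right integrable_abs indicator_lebesgue_integrable)
      have [measurable]: "a \<in> borel_measurable lebesgue" using a by auto
      show "(\<lambda>x. \<bar>a x - G \<omega> x \<alpha>\<bar> * r x) \<in> borel_measurable lebesgue" by measurable
      show "AE x in lebesgue. norm (\<bar>a x - G \<omega> x \<alpha>\<bar> * r x) \<le> norm (C * \<bar>a x\<bar> + R * (C * indicator {- real n..real n} x))"
        using N(3)
      proof eventually_elim
        case (elim x)
        have "\<bar>a x - G \<omega> x \<alpha>\<bar> * \<bar>r x\<bar> \<le> (\<bar>a x\<bar> + R) * \<bar>r x\<bar>"
          using R(2)[OF elim] by (intro mult_right_mono) auto
        also have "\<dots> = \<bar>a x\<bar> * \<bar>r x\<bar> + R * \<bar>r x\<bar>" by (simp add: distrib_right)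
        also have "\<dots> \<le> \<bar>a x\<bar> * C + R * (C * indicator {- real n..real n} x)"
          using rC[of x] r(2)[of x] R(1) by (intro add_mono mult_left_mono) auto
        finally show ?case using C R(1) by (simp add: abs_mult mult.commute)
      qed
    qed
    have "\<bar>J \<omega> g - J \<omega> d\<bar> = \<bar>LINT x|lebesgue. \<bar>g x - G \<omega> x \<alpha>\<bar> * r x - \<bar>d x - G \<omega> x \<alpha>\<bar> * r x\<bar>"
      unfolding J_def using i[OF g] i[OF d] by simp
    also have "\<dots> \<le> (LINT x|lebesgue. \<bar>\<bar>g x - G \<omega> x \<alpha>\<bar> * r x - \<bar>d x - G \<omega> x \<alpha>\<bar> * r x\<bar>)" by (rule integral_abs_bound)
    also have "\<dots> \<le> (LINT x|lebesgue. C * \<bar>d x - g x\<bar>)"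
    proof (rule integral_mono)
      show "integrable lebesgue (\<lambda>x. \<bar>\<bar>g x - G \<omega> x \<alpha>\<bar> * r x - \<bar>d x - G \<omega> x \<alpha>\<bar> * r x\<bar>)"
        "integrable lebesgue (\<lambda>x. C * \<bar>d x - g x\<bar>)" using i[OF g] i[OF d] g d by auto
      fix x
      have "\<bar>\<bar>g x - G \<omega> x \<alpha>\<bar> * r x - \<bar>d x - G \<omega> x \<alpha>\<bar> * r x\<bar> = \<bar>\<bar>g x - G \<omega> x \<alpha>\<bar> - \<bar>d x - G \<omega> x \<alpha>\<bar>\<bar> * \<bar>r x\<bar>"
        by (simp add: abs_mult[symmetric] left_diff_distrib)
      also have "\<dots> \<le> \<bar>d x - g x\<bar> * C" using rC by (intro mult_mono) auto
      finally show "\<bar>\<bar>g x - G \<omega> x \<alpha>\<bar> * r x - \<bar>d x - G \<omega> x \<alpha>\<bar> * r x\<bar> \<le> C * \<bar>d x - g x\<bar>" by (simp add: mult.commute)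
    qed
    finally show ?thesis by simp
  qed
  have "(\<lambda>\<omega>. J \<omega> (v \<omega>)) \<in> borel_measurable P"
    unfolding borel_measurable_iff_less
  proof
    fix a
    \<comment> \<open>A point \<open>d\<close> within \<open>1 / Suc k\<close> of the datum changes
      the value by at most \<open>C / Suc k\<close>. The margin absorbs this in one direction;
      density supplies a suitable pair in the other.\<close>
    have "{\<omega> \<in> space P. J \<omega> (v \<omega>) < a} = (\<Union>d\<in>D. \<Union>k. {\<omega> \<in> space P. (LINT x|lebesgue. \<bar>d x - v \<omega> x\<bar>) < 1 / real (Suc k)}
       \<inter> {\<omega> \<in> space P. J \<omega> d < a - C / real (Suc k)})"
    proof (intro set_eqI iffI)
      fix \<omega> assume "\<omega> \<in> {\<omega> \<in> space P. J \<omega> (v \<omega>) < a}"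
      then have \<omega>: "\<omega> \<in> space P" "a - J \<omega> (v \<omega>) > 0" by auto
      \<comment> \<open>The error \<open>C / Suc k\<close> is spent twice, on passing to
        \<open>d\<close> and on the margin; the summand 1 covers \<open>C = 0\<close>.\<close>
      obtain k where k: "1 / real (Suc k) < (a - J \<omega> (v \<omega>)) / (2 * C + 1)"
        using nat_approx_posE[of "(a - J \<omega> (v \<omega>)) / (2 * C + 1)"] \<omega>(2) C by auto
      have "(2 * C + 1) * (1 / real (Suc k)) < a - J \<omega> (v \<omega>)"
        using k C by (simp add: pos_less_divide_eq mult.commute)
      moreover have "(2 * C + 1) * (1 / real (Suc k)) = 2 * (C / real (Suc k)) + 1 / real (Suc k)"
        by (simp add: add_divide_distrib del: of_nat_Suc)
      moreover have "1 / real (Suc k) > 0" by simp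
      ultimately have kk: "2 * (C / real (Suc k)) < a - J \<omega> (v \<omega>)" by linarith
      obtain d where d: "d \<in> D" "(LINT x|lebesgue. \<bar>v \<omega> x - d x\<bar>) < 1 / real (Suc k)"
        using D(4)[OF v_int[OF \<omega>(1)], of "1 / real (Suc k)"] by auto
      then have d': "(LINT x|lebesgue. \<bar>d x - v \<omega> x\<bar>) < 1 / real (Suc k)" by (simp add: abs_minus_commute)
      have "\<bar>J \<omega> (v \<omega>) - J \<omega> d\<bar> \<le> C * (1 / real (Suc k))"
        using d' C by (intro order_trans[OF J_Lip[OF \<omega>(1) v_int[OF \<omega>(1)] Di[OF d(1)]]] mult_left_mono) auto
      then have "J \<omega> d < a - C / real (Suc k)" using kk by simp
      then show "\<omega> \<in> (\<Union>d\<in>D. \<Union>k. {\<omega> \<in> space P. (LINT x|lebesgue. \<bar>d x - v \<omega> x\<bar>) < 1 / real (Suc k)}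
       \<inter> {\<omega> \<in> space P. J \<omega> d < a - C / real (Suc k)})" using d(1) d' \<omega>(1) by blast
    next
      fix \<omega> assume "\<omega> \<in> (\<Union>d\<in>D. \<Union>k. {\<omega> \<in> space P. (LINT x|lebesgue. \<bar>d x - v \<omega> x\<bar>) < 1 / real (Suc k)}
       \<inter> {\<omega> \<in> space P. J \<omega> d < a - C / real (Suc k)})"
      then obtain d k where d: "d \<in> D" "(LINT x|lebesgue. \<bar>d x - v \<omega> x\<bar>) < 1 / real (Suc k)"
        "J \<omega> d < a - C / real (Suc k)" and \<omega>: "\<omega> \<in> space P" by blast
      have "\<bar>J \<omega> (v \<omega>) - J \<omega> d\<bar> \<le> C * (1 / real (Suc k))"
        using d(2) C by (intro order_trans[OF J_Lip[OF \<omega> v_int[OF \<omega>] Di[OF d(1)]]] mult_left_mono) auto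
      then have "J \<omega> (v \<omega>) < a" using d(3) by simp
      then show "\<omega> \<in> {\<omega> \<in> space P. J \<omega> (v \<omega>) < a}" using \<omega> by simp
    qed
    also have "\<dots> \<in> sets P"
    proof (intro sets.countable_UN'[OF D(1)] sets.countable_UN image_subsetI sets.Int)
      show "{\<omega> \<in> space P. (LINT x|lebesgue. \<bar>d x - v \<omega> x\<bar>) < 1 / real (Suc k)} \<in> sets P" if "d \<in> D" for d k
        using that by (rule ball) simp
      show "{\<omega> \<in> space P. J \<omega> d < a - C / real (Suc k)} \<in> sets P" if "d \<in> D" for d k
        using Jd[OF that] by measurable
    qed
    finally show "{\<omega> \<in> space P. J \<omega> (v \<omega>) < a} \<in> sets P" .
  qed
  \<comment> \<open>The given datum agrees with its strongly measurable version only for almost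
    every \<omega>; completeness of \<open>P\<close> transfers measurability.\<close>
  moreover have "AE \<omega> in P. (LINT x|lebesgue. \<bar>u\<^sub>0 \<omega> x - G \<omega> x \<alpha>\<bar> * r x) = J \<omega> (v \<omega>)"
    using v(2)
  proof eventually_elim
    case (elim \<omega>)
    show ?case unfolding J_def
      by (rule complete_measure.integral_cong_AE_complete[OF complete_measure_lebesgue])
        (use elim in eventually_elim, simp)
  qed
  ultimately show ?thesis by (rule borel_measurable_cong_AE)
qed

text \<open>The candidate \<open>c\<close> is fixed and replaced by a Borel version, so that
  inserting it into the jointly measurable version of the flux is a measurable composition.\<close>

lemma entropy_functional_measurable:
  assumes \<alpha>: "\<alpha> \<in> A" and d: "test_data n C q q' r" and c: "c \<in> E"
  shows "(\<lambda>\<omega>. entropy_functional T (f \<omega>) (u\<^sub>0 \<omega>) \<alpha> (\<lambda>x. G \<omega> x \<alpha>) q q' r c) \<in> borel_measurable P"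
proof -
  obtain c' where c': "c' \<in> borel_measurable borel" "AE z in strip. c z = c' z"
    by (rule strip_borel_version[OF E_measurable[OF c]])
  obtain H where H: "H \<in> borel_measurable (P \<Otimes>\<^sub>M borel)"
    "\<And>\<omega> x. \<omega> \<in> space P \<Longrightarrow> x \<notin> N \<omega> \<Longrightarrow> H (\<omega>, x) = G \<omega> x \<alpha>"
    using G_version[OF \<alpha>] by blast
  obtain K where K: "K \<in> borel_measurable (P \<Otimes>\<^sub>M borel)"
    "\<And>\<omega> x \<rho>. \<omega> \<in> space P \<Longrightarrow> x \<notin> N \<omega> \<Longrightarrow> K (\<omega>, x, \<rho>) = f \<omega> x \<rho>"
    using f_version by blast
  have fs: "(\<lambda>z. fst (snd z)) \<in> borel_measurable (P \<Otimes>\<^sub>M (borel :: (real \<times> real) measure))"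
    by (rule measurable_compose[OF measurable_snd borel_fst])
  have cm: "(\<lambda>z. c' (snd z)) \<in> borel_measurable (P \<Otimes>\<^sub>M borel)"
    by (rule measurable_compose[OF measurable_snd c'(1)])
  have Hm: "(\<lambda>z. H (fst z, fst (snd z))) \<in> borel_measurable (P \<Otimes>\<^sub>M (borel :: (real \<times> real) measure))"
    by (rule measurable_compose[OF measurable_Pair[OF measurable_fst fs] H(1)])
  have Km: "(\<lambda>z. K (fst z, fst (snd z), c' (snd z))) \<in> borel_measurable (P \<Otimes>\<^sub>M (borel :: (real \<times> real) measure))"
    by (rule measurable_compose[OF measurable_Pair[OF measurable_fst borel_measurable_Pair[OF fs cm]] K(1)])
  have qm: "(\<lambda>z. q (snd z)) \<in> borel_measurable (P \<Otimes>\<^sub>M borel)" "(\<lambda>z. q' (snd z)) \<in> borel_measurable (P \<Otimes>\<^sub>M borel)"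
    using d unfolding test_data_def by (auto intro: measurable_compose[OF measurable_snd])
  have N: "AE z in strip. fst z \<notin> N \<omega>" if "\<omega> \<in> space P" for \<omega>
  proof -
    interpret flux_strip T "f \<omega>" "N \<omega>" A "B \<omega>" "G \<omega>" "u\<^sub>0 \<omega>" by (rule path[OF that])
    show ?thesis by (rule AE_N)
  qed
  have "(\<lambda>\<omega>. LINT z|strip. \<bar>c z - G \<omega> (fst z) \<alpha>\<bar> * q z) \<in> borel_measurable P"
  proof (rule strip_integral_measurable)
    show "(\<lambda>z. \<bar>c' (snd z) - H (fst z, fst (snd z))\<bar> * q (snd z)) \<in> borel_measurable (P \<Otimes>\<^sub>M borel)"
      by (intro borel_measurable_times borel_measurable_abs borel_measurable_diff cm Hm qm)
    show "AE z in strip. \<bar>c z - G \<omega> (fst z) \<alpha>\<bar> * q z =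
      \<bar>c' (snd (\<omega>, z)) - H (fst (\<omega>, z), fst (snd (\<omega>, z)))\<bar> * q (snd (\<omega>, z))" if "\<omega> \<in> space P" for \<omega>
      using c'(2) N[OF that] by eventually_elim (simp add: H(2)[OF that])
  qed
  moreover have "(\<lambda>\<omega>. LINT z|strip. sgn (c z - G \<omega> (fst z) \<alpha>) * (f \<omega> (fst z) (c z) - \<alpha>) * q' z) \<in> borel_measurable P"
  proof (rule strip_integral_measurable)
    have "(\<lambda>z. sgn (c' (snd z) - H (fst z, fst (snd z)))) \<in> borel_measurable (P \<Otimes>\<^sub>M borel)"
      using borel_measurable_diff[OF cm Hm] by measurable
    then show "(\<lambda>z. sgn (c' (snd z) - H (fst z, fst (snd z))) * (K (fst z, fst (snd z), c' (snd z)) - \<alpha>) * q' (snd z))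
       \<in> borel_measurable (P \<Otimes>\<^sub>M borel)"
      by (intro borel_measurable_times borel_measurable_diff Km qm borel_measurable_const)
    show "AE z in strip. sgn (c z - G \<omega> (fst z) \<alpha>) * (f \<omega> (fst z) (c z) - \<alpha>) * q' z =
      sgn (c' (snd (\<omega>, z)) - H (fst (\<omega>, z), fst (snd (\<omega>, z)))) *
      (K (fst (\<omega>, z), fst (snd (\<omega>, z)), c' (snd (\<omega>, z))) - \<alpha>) * q' (snd (\<omega>, z))" if "\<omega> \<in> space P" for \<omega>
      using c'(2) N[OF that] by eventually_elim (simp add: H(2)[OF that] K(2)[OF that])
  qed
  ultimately show ?thesis
    unfolding entropy_functional_def using initial_term_measurable[OF \<alpha> d] by (intro borel_measurable_add)
qed

end

section \<open>The solution map\<close>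

context random_flux
begin

text \<open>The index pairs a level with a test function. The steady state is the one given by
  \<open>G\<close>; any other on the same branch yields the same value.\<close>

definition \<Psi> :: "real \<times> (real \<times> real \<Rightarrow> real) \<Rightarrow> 'w \<Rightarrow> (real \<times> real \<Rightarrow> real) \<Rightarrow> real" where
  "\<Psi> q \<omega> c = entropy_functional T (f \<omega>) (u\<^sub>0 \<omega>) (fst q) (\<lambda>x. G \<omega> x (fst q))
     (dt_of (snd q)) (dx_of (snd q)) (\<lambda>x. snd q (x, 0)) c"

lemma \<Psi>_measurable:
  assumes "q \<in> A \<times> test_functions T" "c \<in> E"
  shows "(\<lambda>\<omega>. \<Psi> q \<omega> c) \<in> borel_measurable P"
proof -
  obtain n C where "test_data n C (dt_of (snd q)) (dx_of (snd q)) (\<lambda>x. snd q (x, 0))"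
    using test_function_data[of "snd q" T] assms(1) by auto
  then show ?thesis unfolding \<Psi>_def using assms by (intro entropy_functional_measurable) auto
qed

lemma \<Psi>_Lipschitz:
  assumes \<omega>: "\<omega> \<in> space P" and q: "q \<in> A \<times> test_functions T"
  obtains L n where "L \<ge> 0" "\<And>v w. v \<in> EM M \<Longrightarrow> w \<in> EM M \<Longrightarrow> \<bar>\<Psi> q \<omega> v - \<Psi> q \<omega> w\<bar> \<le> L * dE n v w"
proof -
  interpret flux_strip T "f \<omega>" "N \<omega>" A "B \<omega>" "G \<omega>" "u\<^sub>0 \<omega>" by (rule path[OF \<omega>])
  obtain n C where d: "test_data n C (dt_of (snd q)) (dx_of (snd q)) (\<lambda>x. snd q (x, 0))"
    using test_function_data[of "snd q" T] q by auto
  have "fst q \<in> A" using q by auto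
  then show thesis
  proof (rule entropy_functional_Lipschitz[OF _ d, of "fst q" M])
    fix L assume "L \<ge> 0" "\<And>v w. v \<in> EM M \<Longrightarrow> w \<in> EM M \<Longrightarrow>
      \<bar>\<Phi> (fst q) (dt_of (snd q)) (dx_of (snd q)) (\<lambda>x. snd q (x, 0)) v
       - \<Phi> (fst q) (dt_of (snd q)) (dx_of (snd q)) (\<lambda>x. snd q (x, 0)) w\<bar> \<le> L * dE n v w"
    then show thesis by (intro that[of L n]) (simp_all add: \<Psi>_def)
  qed
qed

text \<open>Continuity at the solution, in the form in which approximants are chosen. The
  neighbourhood depends on \<omega>, which is harmless since the choice is made path by
  path.\<close>

lemma \<Psi>_lower_bound_near:
  assumes \<omega>: "\<omega> \<in> space P" and q: "q \<in> A \<times> test_functions T" and v: "v \<in> EM M"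
    and pos: "\<Psi> q \<omega> v \<ge> 0" and e: "e > 0"
  shows "\<exists>m \<delta>. \<delta> > 0 \<and> (\<forall>c\<in>EM M. dE m v c < \<delta> \<longrightarrow> \<Psi> q \<omega> c \<ge> - e)"
proof -
  obtain L n where L: "L \<ge> 0" "\<And>v w. v \<in> EM M \<Longrightarrow> w \<in> EM M \<Longrightarrow> \<bar>\<Psi> q \<omega> v - \<Psi> q \<omega> w\<bar> \<le> L * dE n v w"
    using \<Psi>_Lipschitz[OF \<omega> q] by blast
  have "\<Psi> q \<omega> c \<ge> - e" if c: "c \<in> EM M" "dE n v c < e / (L + 1)" for c
  proof -
    have "\<bar>\<Psi> q \<omega> v - \<Psi> q \<omega> c\<bar> \<le> L * dE n v c" using L(2)[OF v c(1)] .
    also have "\<dots> \<le> L * (e / (L + 1))" using c(2) L(1) by (intro mult_left_mono) auto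
    also have "\<dots> \<le> e" using L(1) e by (simp add: field_simps)
    finally show ?thesis using pos by linarith
  qed
  then show ?thesis using L(1) e by (intro exI[of _ n] exI[of _ "e / (L + 1)"]) auto
qed

text \<open>Tolerance and distance to the limit both vanish while the Lipschitz constant is fixed
  for the path. The start \<open>k0\<close> reflects that each inequality is imposed only from its
  own stage on.\<close>

lemma \<Psi>_limit_nonneg:
  assumes \<omega>: "\<omega> \<in> space P" and q: "q \<in> A \<times> test_functions T" and v: "v \<in> EM M" and c: "\<And>k. c k \<in> EM M"
    and lim: "\<And>n k. n \<le> k \<Longrightarrow> dE n (c k) v \<le> 2 * (1/2)^k"
    and ge: "\<And>k. k \<ge> k0 \<Longrightarrow> \<Psi> q \<omega> (c k) \<ge> - 1 / real (Suc k)"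
  shows "\<Psi> q \<omega> v \<ge> 0"
proof -
  obtain L n where L: "L \<ge> 0" "\<And>v w. v \<in> EM M \<Longrightarrow> w \<in> EM M \<Longrightarrow> \<bar>\<Psi> q \<omega> v - \<Psi> q \<omega> w\<bar> \<le> L * dE n v w"
    using \<Psi>_Lipschitz[OF \<omega> q] by blast
  have "- 1 / real (Suc k) - L * (2 * (1/2)^k) \<le> \<Psi> q \<omega> v" if "k \<ge> max k0 n" for k
  proof -
    have "\<bar>\<Psi> q \<omega> (c k) - \<Psi> q \<omega> v\<bar> \<le> L * dE n (c k) v" using L(2)[OF c v] .
    also have "\<dots> \<le> L * (2 * (1/2)^k)" using lim[of n k] that L(1) by (intro mult_left_mono) auto
    finally show ?thesis using ge[of k] that by auto
  qed
  then have "\<exists>K. \<forall>k\<ge>K. - 1 / real (Suc k) - L * (2 * (1/2)^k) \<le> \<Psi> q \<omega> v" by blast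
  moreover have "(\<lambda>k. - 1 / real (Suc k) - L * (2 * (1/2)^k)) \<longlonglongrightarrow> 0"
  proof -
    have "(\<lambda>k. - (1 / real (Suc k)) - L * (2 * (1/2)^k)) \<longlonglongrightarrow> - 0 - L * (2 * 0)"
      by (intro tendsto_intros LIMSEQ_Suc[OF lim_1_over_n] LIMSEQ_power_zero) simp
    then show ?thesis by simp
  qed
  ultimately show ?thesis by (rule LIMSEQ_le_const2[rotated])
qed

lemma \<Psi>_nonneg:
  assumes \<omega>: "\<omega> \<in> space P" and q: "q \<in> A \<times> test_functions T"
    and sol: "\<And>\<alpha> m \<phi>. \<alpha> \<in> A \<Longrightarrow> steady_state (f \<omega>) (B \<omega>) \<alpha> m \<Longrightarrow> \<phi> \<in> test_functions T \<Longrightarrow>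
      adapted_entropy_inequality T (f \<omega>) (u\<^sub>0 \<omega>) \<alpha> m \<phi> v"
  shows "\<Psi> q \<omega> v \<ge> 0"
proof -
  interpret flux_strip T "f \<omega>" "N \<omega>" A "B \<omega>" "G \<omega>" "u\<^sub>0 \<omega>" by (rule path[OF \<omega>])
  have "steady_state (f \<omega>) (B \<omega>) (fst q) (\<lambda>x. G \<omega> x (fst q))" using q steady_state_iff by auto
  then show ?thesis using sol[of "fst q" _ "snd q"] q unfolding \<Psi>_def adapted_entropy_inequality_iff by auto
qed

lemma \<Psi>_entropy_inequality:
  assumes \<omega>: "\<omega> \<in> space P" and v: "v \<in> EM M" and A0: "A0 \<subseteq> A" "A \<subseteq> closure A0" and \<D>: "\<D> \<subseteq> test_functions T"
    "\<And>\<phi> e. \<phi> \<in> test_functions T \<Longrightarrow> e > 0 \<Longrightarrow> \<exists>\<psi>\<in>\<D>.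
      test_dist (dt_of \<phi>) (dx_of \<phi>) (\<lambda>x. \<phi> (x, 0)) (dt_of \<psi>) (dx_of \<psi>) (\<lambda>x. \<psi> (x, 0)) < e"
    and ge: "\<And>q. q \<in> A0 \<times> \<D> \<Longrightarrow> \<Psi> q \<omega> v \<ge> 0"
    and \<alpha>: "\<alpha> \<in> A" and m: "steady_state (f \<omega>) (B \<omega>) \<alpha> m" and \<phi>: "\<phi> \<in> test_functions T"
  shows "adapted_entropy_inequality T (f \<omega>) (u\<^sub>0 \<omega>) \<alpha> m \<phi> v"
proof -
  interpret flux_strip T "f \<omega>" "N \<omega>" A "B \<omega>" "G \<omega>" "u\<^sub>0 \<omega>" by (rule path[OF \<omega>])
  show ?thesis
  proof (rule entropy_inequality_from_dense[OF v A0 \<D> _ \<alpha> \<phi> m])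
    show "entropy_functional T (f \<omega>) (u\<^sub>0 \<omega>) \<beta> (\<lambda>x. G \<omega> x \<beta>) (dt_of \<psi>) (dx_of \<psi>) (\<lambda>x. \<psi> (x, 0)) v \<ge> 0"
      if "\<beta> \<in> A0" "\<psi> \<in> \<D>" for \<beta> \<psi>
      using ge[of "(\<beta>, \<psi>)"] that by (simp add: \<Psi>_def)
  qed
qed

end

section \<open>Simultaneous conditions and invariance under equality almost everywhere\<close>

context time_strip
begin

text \<open>The largest index and the smallest radius serve all conditions, by monotonicity of
  \<open>dE\<close> in its index.\<close>

lemma finite_common_neighbourhood:
  assumes "finite Q" "v \<in> S" "S \<subseteq> E"
    and "\<And>q. q \<in> Q \<Longrightarrow> \<exists>m \<delta>. \<delta> > 0 \<and> (\<forall>c\<in>S. dE m v c < \<delta> \<longrightarrow> R q c)"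
  shows "\<exists>m \<delta>. \<delta> > 0 \<and> (\<forall>c\<in>S. dE m v c < \<delta> \<longrightarrow> (\<forall>q\<in>Q. R q c))"
  using assms(1,4)
proof (induction Q rule: finite_induct)
  case empty
  then show ?case by (intro exI[of _ 0] exI[of _ 1]) auto
next
  case (insert q Q)
  obtain m \<delta> where m: "\<delta> > 0" "\<And>c. c \<in> S \<Longrightarrow> dE m v c < \<delta> \<Longrightarrow> R q c"
    using insert.prems[of q] by blast
  obtain m' \<delta>' where m': "\<delta>' > 0" "\<And>c q. c \<in> S \<Longrightarrow> dE m' v c < \<delta>' \<Longrightarrow> q \<in> Q \<Longrightarrow> R q c"
    using insert.IH insert.prems by blast
  show ?case
  proof (intro exI[of _ "max m m'"] exI[of _ "min \<delta> \<delta>'"] conjI ballI impI)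
    show "min \<delta> \<delta>' > 0" using m m' by simp
    fix c q' assume c: "c \<in> S" "dE (max m m') v c < min \<delta> \<delta>'" and q': "q' \<in> insert q Q"
    have "dE m v c \<le> dE (max m m') v c" "dE m' v c \<le> dE (max m m') v c"
      using assms(2,3) c(1) by (auto intro!: dn_mono)
    then show "R q' c" using m(2)[OF c(1)] m'(2)[OF c(1)] c(2) q' by auto
  qed
qed

lemma strip_dist_cong_AE:
  assumes "\<And>t. t \<in> {0..T} \<Longrightarrow> AE x in lebesgue. v (x, t) = w (x, t)"
  shows "strip_dist T K c v = strip_dist T K c w"
  unfolding strip_dist_def
proof (rule SUP_cong[OF refl])
  fix t assume "t \<in> {0..T}"
  then show "(LINT x:K|lebesgue. \<bar>c (x, t) - v (x, t)\<bar>) = (LINT x:K|lebesgue. \<bar>c (x, t) - w (x, t)\<bar>)"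
    unfolding set_lebesgue_integral_def using assms[of t]
    by (intro complete_measure.integral_cong_AE_complete[OF complete_measure_lebesgue]) (auto elim!: eventually_mono)
qed

end

text \<open>The event that the solution lies in a closed ball is the result of a Suslin operation: a code
  \<open>\<sigma>\<close> selects rapidly converging elements of a countable dense set on which more and more of the
  countably many entropy inequalities hold with a vanishing error. By uniqueness, any limit of such a
  sequence is the solution.\<close>

lemma solution_in_ball_measurable:
  assumes m: "random_flux P T f N A B\<^sub>m G\<^sub>m u\<^sub>0 p" and pl: "random_flux P T f N A B\<^sub>p G\<^sub>p u\<^sub>0 p"
    and sol: "\<And>\<omega>. \<omega> \<in> space P \<Longrightarrow>
          unique_adapted_entropy_solution T (f \<omega>) A (B\<^sub>m \<omega>) (B\<^sub>p \<omega>) (u\<^sub>0 \<omega>) (u \<omega>)"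
    and c0: "c0 \<in> solution_space T"
  shows "{\<omega> \<in> space P. time_strip.dE T n0 c0 (u \<omega>) \<le> r} \<in> sets P"
proof -
  interpret time_strip T using m by (rule random_flux.axioms)
  interpret m: random_flux P T f N A B\<^sub>m G\<^sub>m u\<^sub>0 p by (rule m)
  interpret p: random_flux P T f N A B\<^sub>p G\<^sub>p u\<^sub>0 p by (rule pl)
  have uE: "u \<omega> \<in> E" if "\<omega> \<in> space P" for \<omega>
    using sol[OF that] by (simp add: unique_adapted_entropy_solution_def adapted_entropy_solution_def)
  obtain A0 where A0: "countable A0" "A0 \<subseteq> A" "A \<subseteq> closure A0" using separable by blast
  obtain \<D> where \<D>: "countable \<D>" "\<D> \<subseteq> test_functions T"
    "\<And>\<phi> e. \<phi> \<in> test_functions T \<Longrightarrow> e > 0 \<Longrightarrow> \<exists>\<psi>\<in>\<D>.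
      test_dist (dt_of \<phi>) (dx_of \<phi>) (\<lambda>x. \<phi> (x, 0)) (dt_of \<psi>) (dx_of \<psi>) (\<lambda>x. \<psi> (x, 0)) < e"
    by (rule test_functions_separable) blast
  define Q where "Q = A0 \<times> \<D>"
  have Q: "countable Q" "Q \<subseteq> A \<times> test_functions T" using A0 \<D> by (auto simp: Q_def)
  \<comment> \<open>Stages of an enumeration of the inequalities: each stage is finite, and an
    inequality that has entered belongs to all later stages.\<close>
  define Qn where "Qn n = {q \<in> Q. to_nat_on Q q \<le> n}" for n
  have Qn_sub: "q \<in> A \<times> test_functions T" if "q \<in> Qn n" for q n using that Q(2) by (auto simp: Qn_def)
  have Qn: "finite (Qn n)" for n
  proof (rule finite_imageD)
    show "finite (to_nat_on Q ` Qn n)" by (rule finite_subset[of _ "{..n}"]) (auto simp: Qn_def)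
    show "inj_on (to_nat_on Q) (Qn n)"
      using inj_on_to_nat_on[OF Q(1)] by (rule inj_on_subset) (auto simp: Qn_def)
  qed
  \<comment> \<open>A measurable set between the event with the bound \<open>M\<close> and the event
    without it is enough, for the union over \<open>M\<close> recovers the latter.\<close>
  have main: "\<exists>S\<in>sets P. {\<omega> \<in> space P. u \<omega> \<in> EM (real M) \<and> dE n0 c0 (u \<omega>) \<le> r} \<subseteq> S \<and>
      S \<subseteq> {\<omega> \<in> space P. dE n0 c0 (u \<omega>) \<le> r}" for M :: nat
  proof -
    obtain C where C: "countable C" "C \<subseteq> EM (real M)"
      "\<And>v n e. v \<in> EM (real M) \<Longrightarrow> e > 0 \<Longrightarrow> \<exists>c\<in>C. dE n v c < e"
      using subset_E_separable[OF EM_subset] by blast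
    have "C \<noteq> {}" using C(3)[OF zero_in_EM, of 1] by auto
    define e where "e = from_nat_into C"
    have e: "range e = C" unfolding e_def using \<open>C \<noteq> {}\<close> C(1) by (rule range_from_nat_into)
    have eM: "e i \<in> EM (real M)" for i using e C(2) by auto
    have eE: "e i \<in> E" for i using eM EM_subset by blast
    define good where "good n i = {\<omega> \<in> space P. \<forall>q\<in>Qn n. m.\<Psi> q \<omega> (e i) \<ge> - 1 / real (Suc n) \<and> p.\<Psi> q \<omega> (e i) \<ge> - 1 / real (Suc n)}" for n i
    have good: "good n i \<in> sets P" for n i
      unfolding good_def
    proof (rule sets.sets_Collect_finite_All[OF _ Qn])
      fix q assume q: "q \<in> Qn n"
      have [measurable]: "(\<lambda>\<omega>. m.\<Psi> q \<omega> (e i)) \<in> borel_measurable P" "(\<lambda>\<omega>. p.\<Psi> q \<omega> (e i)) \<in> borel_measurable P"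
        using m.\<Psi>_measurable[OF Qn_sub[OF q] eE] p.\<Psi>_measurable[OF Qn_sub[OF q] eE] by auto
      show "{\<omega> \<in> space P. m.\<Psi> q \<omega> (e i) \<ge> - 1 / real (Suc n) \<and> p.\<Psi> q \<omega> (e i) \<ge> - 1 / real (Suc n)} \<in> sets P"
        by measurable
    qed
    \<comment> \<open>These conditions restrict the code and do not involve \<omega>. The slack
      \<open>1 / length s\<close> vanishes along the code, so that the limit lies in the closed
      ball.\<close>
    define ok where "ok s \<longleftrightarrow> dE n0 c0 (e (last s)) \<le> r + 1 / real (length s) \<and>
      (\<forall>k. Suc k < length s \<longrightarrow> dE k (e (s ! k)) (e (s ! Suc k)) \<le> (1/2)^k)" for s
    \<comment> \<open>The last entry of a list of length \<open>n + 1\<close> belongs to stage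
      \<open>n\<close>; the empty list imposes nothing beyond \<open>space P\<close>.\<close>
    define W where "W s = (if s = [] then space P else if ok s then good (length s - 1) (last s) else {})" for s
    define S where "S = {\<omega> \<in> space P. \<exists>\<sigma>. \<forall>n. \<omega> \<in> W (map \<sigma> [0..<n])}"
    have "S \<in> sets P"
      unfolding S_def using good m.finite_measure_axioms m.complete_measure_axioms
      by (intro suslin_operation_measurable) (auto simp: W_def)
    moreover have "\<omega> \<in> S" if \<omega>: "\<omega> \<in> space P" and uM: "u \<omega> \<in> EM (real M)" and ur: "dE n0 c0 (u \<omega>) \<le> r" for \<omega>
    proof -
      have aes: "adapted_entropy_solution T (f \<omega>) A (B\<^sub>m \<omega>) (B\<^sub>p \<omega>) (u\<^sub>0 \<omega>) (u \<omega>)"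
        using sol[OF \<omega>] by (simp add: unique_adapted_entropy_solution_def)
      have pos: "m.\<Psi> q \<omega> (u \<omega>) \<ge> 0 \<and> p.\<Psi> q \<omega> (u \<omega>) \<ge> 0" if "q \<in> A \<times> test_functions T" for q
        using m.\<Psi>_nonneg[OF \<omega> that] p.\<Psi>_nonneg[OF \<omega> that] aes unfolding adapted_entropy_solution_def by blast
      have near: "\<exists>i. \<omega> \<in> good n i \<and> dE n (u \<omega>) (e i) \<le> (1/2)^n / 2 \<and> dE n0 (u \<omega>) (e i) \<le> 1 / real (Suc n)" for n
      proof -
        have "\<exists>\<mu> \<delta>. \<delta> > 0 \<and> (\<forall>c\<in>EM (real M). dE \<mu> (u \<omega>) c < \<delta> \<longrightarrow>
            m.\<Psi> q \<omega> c \<ge> - (1 / real (Suc n)) \<and> p.\<Psi> q \<omega> c \<ge> - (1 / real (Suc n)))" if q: "q \<in> Qn n" for q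
        proof -
          have n: "1 / real (Suc n) > 0" by simp
          \<comment> \<open>The two branches are treated as a family of two conditions indexed by a
            boolean.\<close>
          have "\<exists>\<mu> \<delta>. \<delta> > 0 \<and> (\<forall>c\<in>EM (real M). dE \<mu> (u \<omega>) c < \<delta> \<longrightarrow> (\<forall>b\<in>{True, False}.
             (if b then m.\<Psi> q \<omega> c else p.\<Psi> q \<omega> c) \<ge> - (1 / real (Suc n))))"
          proof (rule finite_common_neighbourhood[OF _ uM EM_subset])
            fix b :: bool
            show "\<exists>\<mu> \<delta>. \<delta> > 0 \<and> (\<forall>c\<in>EM (real M). dE \<mu> (u \<omega>) c < \<delta> \<longrightarrow>
               (if b then m.\<Psi> q \<omega> c else p.\<Psi> q \<omega> c) \<ge> - (1 / real (Suc n)))"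
              using m.\<Psi>_lower_bound_near[OF \<omega> Qn_sub[OF q] uM _ n] p.\<Psi>_lower_bound_near[OF \<omega> Qn_sub[OF q] uM _ n]
                pos[OF Qn_sub[OF q]] by (cases b) auto
          qed simp
          then show ?thesis by (simp add: ex_bool_eq)
        qed
        then obtain \<mu> \<delta> where \<mu>: "\<delta> > 0" "\<And>c q. c \<in> EM (real M) \<Longrightarrow> dE \<mu> (u \<omega>) c < \<delta> \<Longrightarrow> q \<in> Qn n \<Longrightarrow>
            m.\<Psi> q \<omega> c \<ge> - (1 / real (Suc n)) \<and> p.\<Psi> q \<omega> c \<ge> - (1 / real (Suc n))"
          using finite_common_neighbourhood[OF Qn uM EM_subset, of n
              "\<lambda>q c. m.\<Psi> q \<omega> c \<ge> - (1 / real (Suc n)) \<and> p.\<Psi> q \<omega> c \<ge> - (1 / real (Suc n))"] by blast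
        \<comment> \<open>One approximant has to serve the inequalities, the rate of convergence and
          the distance to the ball; hence the minimum of the radii here and the maximum of the
          indices in \<open>\<nu>\<close>.\<close>
        define \<delta>' where "\<delta>' = min \<delta> (min ((1/2)^n / 2) (1 / real (Suc n)))"
        have "\<delta>' > 0" using \<mu>(1) by (simp add: \<delta>'_def)
        define \<nu> where "\<nu> = max \<mu> (max n n0)"
        obtain i where i: "dE \<nu> (u \<omega>) (e i) < \<delta>'" using C(3)[OF uM \<open>\<delta>' > 0\<close>, of \<nu>] e by blast
        have "dE k (u \<omega>) (e i) \<le> dE \<nu> (u \<omega>) (e i)" if "k \<le> \<nu>" for k
          using that uE[OF \<omega>] eE by (rule dn_mono)
        then have k: "dE k (u \<omega>) (e i) < \<delta>'" if "k \<le> \<nu>" for k using i that by (meson le_less_trans)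
        have "dE \<mu> (u \<omega>) (e i) < \<delta>" "dE n (u \<omega>) (e i) < (1/2)^n / 2" "dE n0 (u \<omega>) (e i) < 1 / real (Suc n)"
          using k[of \<mu>] k[of n] k[of n0] by (auto simp: \<nu>_def \<delta>'_def)
        then show ?thesis using \<mu>(2)[OF eM] \<omega> by (intro exI[of _ i]) (auto simp: good_def)
      qed
      then obtain \<sigma> where \<sigma>: "\<And>n. \<omega> \<in> good n (\<sigma> n) \<and> dE n (u \<omega>) (e (\<sigma> n)) \<le> (1/2)^n / 2 \<and> dE n0 (u \<omega>) (e (\<sigma> n)) \<le> 1 / real (Suc n)"
        by metis
      \<comment> \<open>Consecutive members are compared through the solution; the extra factor 1/2
        in their choice keeps the sum below \<open>(1/2)^k\<close>.\<close>
      have chain: "dE k (e (\<sigma> k)) (e (\<sigma> (Suc k))) \<le> (1/2)^k" for k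
      proof -
        have "dE k (e (\<sigma> k)) (e (\<sigma> (Suc k))) \<le> dE k (e (\<sigma> k)) (u \<omega>) + dE k (u \<omega>) (e (\<sigma> (Suc k)))"
          using triangle[OF dn_in eE uE[OF \<omega>] eE] .
        also have "dE k (e (\<sigma> k)) (u \<omega>) = dE k (u \<omega>) (e (\<sigma> k))" using sym[OF dn_in eE uE[OF \<omega>]] .
        also have "dE k (u \<omega>) (e (\<sigma> (Suc k))) \<le> dE (Suc k) (u \<omega>) (e (\<sigma> (Suc k)))"
          using uE[OF \<omega>] eE by (intro dn_mono) auto
        also have "dE k (u \<omega>) (e (\<sigma> k)) + \<dots> \<le> (1/2)^k / 2 + (1/2)^(Suc k) / 2"
          using \<sigma> by (intro add_mono) blast+
        also have "\<dots> \<le> (1/2)^k" by simp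
        finally show ?thesis by simp
      qed
      have close: "dE n0 c0 (e (\<sigma> n)) \<le> r + 1 / real (Suc n)" for n
      proof -
        have "dE n0 c0 (e (\<sigma> n)) \<le> dE n0 c0 (u \<omega>) + dE n0 (u \<omega>) (e (\<sigma> n))"
          using triangle[OF dn_in c0 uE[OF \<omega>] eE] .
        then show ?thesis using ur \<sigma>[of n] by linarith
      qed
      have "\<omega> \<in> W (map \<sigma> [0..<n])" for n
      proof (cases n)
        case (Suc j)
        have "ok (map \<sigma> [0..<n])"
          unfolding ok_def Suc using close[of j] chain by (auto simp: nth_append less_Suc_eq)
        then show ?thesis using \<sigma>[of j] unfolding W_def Suc by simp
      qed (simp add: W_def \<omega>)
      then show ?thesis using \<omega> by (auto simp: S_def)
    qed
    moreover have "dE n0 c0 (u \<omega>) \<le> r" if \<omega>S: "\<omega> \<in> S" for \<omega>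
    proof -
      obtain \<sigma> where \<omega>: "\<omega> \<in> space P" and \<sigma>: "\<And>n. \<omega> \<in> W (map \<sigma> [0..<n])" using \<omega>S by (auto simp: S_def)
      have ok: "ok (map \<sigma> [0..<Suc n])" and g: "\<omega> \<in> good n (\<sigma> n)" for n
        using \<sigma>[of "Suc n"] unfolding W_def by (auto split: if_splits)
      define c where "c k = e (\<sigma> k)" for k
      have cM: "c k \<in> EM (real M)" for k using eM by (simp add: c_def)
      have cE: "c k \<in> E" for k using eE by (simp add: c_def)
      have fast: "dE k (c k) (c (Suc k)) \<le> (1/2)^k" for k
      proof -
        have "dE k (e (map \<sigma> [0..<Suc (Suc k)] ! k)) (e (map \<sigma> [0..<Suc (Suc k)] ! Suc k)) \<le> (1/2)^k"
          using ok[of "Suc k"] unfolding ok_def by (auto simp del: upt_Suc)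
        then show ?thesis by (simp add: c_def nth_append)
      qed
      have close: "dE n0 c0 (c k) \<le> r + 1 / real (Suc k)" for k
        using ok[of k] by (simp add: ok_def c_def)
      obtain v where v: "v \<in> EM (real M)" "\<And>n k. n \<le> k \<Longrightarrow> dE n (c k) v \<le> 2 * (1/2)^k"
        using EM_complete[OF cM _ fast] by auto
      have vE: "v \<in> E" using v(1) EM_subset by blast
      have \<Psi>0: "m.\<Psi> q \<omega> v \<ge> 0 \<and> p.\<Psi> q \<omega> v \<ge> 0" if q: "q \<in> Q" for q
      proof -
        have qk: "q \<in> Qn k" if "k \<ge> to_nat_on Q q" for k using q that by (simp add: Qn_def)
        have qA: "q \<in> A \<times> test_functions T" using q Q(2) by blast
        show ?thesis
          using m.\<Psi>_limit_nonneg[OF \<omega> qA v(1) cM v(2), of "to_nat_on Q q"]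
            p.\<Psi>_limit_nonneg[OF \<omega> qA v(1) cM v(2), of "to_nat_on Q q"] g qk
          unfolding good_def c_def by blast
      qed
      \<comment> \<open>Both branches enter: a solution is tested against every steady state of
        either kind, and only then does uniqueness identify \<open>v\<close> with
        \<open>u \<omega>\<close>.\<close>
      have "adapted_entropy_solution T (f \<omega>) A (B\<^sub>m \<omega>) (B\<^sub>p \<omega>) (u\<^sub>0 \<omega>) v"
        unfolding adapted_entropy_solution_def
      proof (intro conjI ballI allI impI vE)
        fix \<alpha> \<mu> \<phi> assume \<alpha>: "\<alpha> \<in> A" and \<phi>: "\<phi> \<in> test_functions T"
          and "steady_state (f \<omega>) (B\<^sub>m \<omega>) \<alpha> \<mu> \<or> steady_state (f \<omega>) (B\<^sub>p \<omega>) \<alpha> \<mu>"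
        then show "adapted_entropy_inequality T (f \<omega>) (u\<^sub>0 \<omega>) \<alpha> \<mu> \<phi> v"
          using m.\<Psi>_entropy_inequality[OF \<omega> v(1) A0(2,3) \<D>(2,3) _ \<alpha> _ \<phi>]
            p.\<Psi>_entropy_inequality[OF \<omega> v(1) A0(2,3) \<D>(2,3) _ \<alpha> _ \<phi>] \<Psi>0 unfolding Q_def by blast
      qed
      then have vu: "AE x in lebesgue. v (x, t) = u \<omega> (x, t)" if "t \<in> {0..T}" for t
        using sol[OF \<omega>] that by (simp add: unique_adapted_entropy_solution_def)
      \<comment> \<open>The slack in the ball condition plus the rate of convergence; both tend to
        0.\<close>
      have "dE n0 c0 v \<le> r + (1 / real (Suc k) + 2 * (1/2)^k)" if "k \<ge> n0" for k
      proof -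
        have "dE n0 c0 v \<le> dE n0 c0 (c k) + dE n0 (c k) v" using triangle[OF dn_in c0 cE vE] .
        then show ?thesis using close[of k] v(2)[OF that] by linarith
      qed
      then have "\<exists>K. \<forall>k\<ge>K. dE n0 c0 v \<le> r + (1 / real (Suc k) + 2 * (1/2)^k)" by blast
      moreover have "(\<lambda>k. r + (1 / real (Suc k) + 2 * (1/2)^k)) \<longlonglongrightarrow> r + (0 + 2 * 0)"
        by (intro tendsto_intros LIMSEQ_Suc[OF lim_1_over_n] LIMSEQ_power_zero) simp
      ultimately have "dE n0 c0 v \<le> r + (0 + 2 * 0)" by (rule LIMSEQ_le_const[rotated])
      then show ?thesis unfolding dE_def using strip_dist_cong_AE[OF vu] by simp
    qed
    ultimately show ?thesis by (intro bexI[of _ S]) (auto simp: S_def)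
  qed
  then have "\<forall>M. \<exists>S. S \<in> sets P \<and> {\<omega> \<in> space P. u \<omega> \<in> EM (real M) \<and> dE n0 c0 (u \<omega>) \<le> r} \<subseteq> S \<and>
      S \<subseteq> {\<omega> \<in> space P. dE n0 c0 (u \<omega>) \<le> r}" by blast
  from choice[OF this] obtain S where S: "\<And>M. S M \<in> sets P"
    "\<And>M. {\<omega> \<in> space P. u \<omega> \<in> EM (real M) \<and> dE n0 c0 (u \<omega>) \<le> r} \<subseteq> S M"
    "\<And>M. S M \<subseteq> {\<omega> \<in> space P. dE n0 c0 (u \<omega>) \<le> r}" by blast
  have "{\<omega> \<in> space P. dE n0 c0 (u \<omega>) \<le> r} = (\<Union>M :: nat. S M)"
  proof
    show "(\<Union>M. S M) \<subseteq> {\<omega> \<in> space P. dE n0 c0 (u \<omega>) \<le> r}" using S(3) by blast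
    show "{\<omega> \<in> space P. dE n0 c0 (u \<omega>) \<le> r} \<subseteq> (\<Union>M. S M)"
    proof
      fix \<omega> assume \<omega>: "\<omega> \<in> {\<omega> \<in> space P. dE n0 c0 (u \<omega>) \<le> r}"
      then obtain M :: nat where "u \<omega> \<in> EM (real M)" using E_in_EM[OF uE] by blast
      then show "\<omega> \<in> (\<Union>M. S M)" using S(2)[of M] \<omega> by blast
    qed
  qed
  then show ?thesis using S(1) by (simp add: sets.countable_UN image_subset_iff)
qed

theorem theorem2p16:
  fixes P :: "'w measure" and T p :: real
    and f :: "'w \<Rightarrow> real \<Rightarrow> real \<Rightarrow> real" and N :: "'w \<Rightarrow> real set"
    and A :: "real set" and B\<^sub>m B\<^sub>p :: "'w \<Rightarrow> real \<Rightarrow> real set"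
    and f_inv\<^sub>m f_inv\<^sub>p :: "'w \<Rightarrow> real \<Rightarrow> real \<Rightarrow> real"
    and u\<^sub>0 :: "'w \<Rightarrow> real \<Rightarrow> real" and u :: "'w \<Rightarrow> real \<times> real \<Rightarrow> real"
  assumes "prob_space P" and "complete_measure P"
    and "T > 0" and "p \<ge> 1"
    and B1: "\<And>\<omega>. \<omega> \<in> space P \<Longrightarrow> flux_B1 (f \<omega>) (N \<omega>)"
    and B2: "\<And>\<omega>. \<omega> \<in> space P \<Longrightarrow> flux_B2 (f \<omega>)"
    and B3: "flux_B3 (space P) f N A B\<^sub>m B\<^sub>p \<or> flux_B3' (space P) f N A B\<^sub>m B\<^sub>p"
    and inv_minus: "branch_inverse (space P) f N A B\<^sub>m f_inv\<^sub>m"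
    and inv_plus: "branch_inverse (space P) f N A B\<^sub>p f_inv\<^sub>p"
    and B4: "\<And>\<rho>. AE x in lebesgue. (\<lambda>\<omega>. f \<omega> x \<rho>) \<in> borel_measurable P"
    and B5: "\<And>\<rho>. \<rho> \<in> A \<Longrightarrow> AE x in lebesgue.
               (\<lambda>\<omega>. f_inv\<^sub>m \<omega> x \<rho>) \<in> borel_measurable P \<and>
               (\<lambda>\<omega>. f_inv\<^sub>p \<omega> x \<rho>) \<in> borel_measurable P"
    and B6: "\<And>\<omega> \<rho>. \<omega> \<in> space P \<Longrightarrow> \<rho> \<in> A \<Longrightarrow>
               (\<lambda>x. f_inv\<^sub>m \<omega> x \<rho>) \<in> Linf lebesgue \<and> (\<lambda>x. f_inv\<^sub>p \<omega> x \<rho>) \<in> Linf lebesgue"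
    and u0_Linf: "\<And>\<omega>. \<omega> \<in> space P \<Longrightarrow> u\<^sub>0 \<omega> \<in> Linf lebesgue"
    and u0_Lp_Linf: "in_Bochner_Lp P p Linf_topology Linf_norm u\<^sub>0"
    and u0_Lp_L1: "in_Bochner_Lp P p L1_topology L1_norm u\<^sub>0"
    and solution: "\<And>\<omega>. \<omega> \<in> space P \<Longrightarrow>
          unique_adapted_entropy_solution T (f \<omega>) A (B\<^sub>m \<omega>) (B\<^sub>p \<omega>) (u\<^sub>0 \<omega>) (u \<omega>)"
  shows "strongly_measurable P (solution_topology T) u"
proof -
  have strip: "time_strip T" using \<open>T > 0\<close> by (rule time_strip.intro)
  interpret time_strip T by (rule strip)
  \<comment> \<open>From here on the two flux cases look alike: each branch consists of unique roots
    with a closed graph over the complement of \<open>N \<omega>\<close>.\<close>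
  have br: "flux_branch (f \<omega>) (N \<omega>) A (B\<^sub>m \<omega>) (f_inv\<^sub>m \<omega>) \<and> flux_branch (f \<omega>) (N \<omega>) A (B\<^sub>p \<omega>) (f_inv\<^sub>p \<omega>)"
    if \<omega>: "\<omega> \<in> space P" for \<omega>
    using B3 flux_branches_B3[OF B1[OF \<omega>] B2[OF \<omega>] \<omega> _ inv_minus inv_plus]
      flux_branches_B3'[OF B1[OF \<omega>] B2[OF \<omega>] \<omega> _ inv_minus inv_plus] by blast
  have strips: "flux_strip T (f \<omega>) (N \<omega>) A (B \<omega>) (G \<omega>) (u\<^sub>0 \<omega>)"
    if "\<omega> \<in> space P" "flux_branch (f \<omega>) (N \<omega>) A (B \<omega>) (G \<omega>)" for \<omega> B G
    by (rule flux_strip.intro[OF strip that(2) flux_strip_axioms.intro[OF u0_Linf[OF that(1)]]])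
  have random: "random_flux P T f N A B G u\<^sub>0 p"
    if "\<And>\<omega>. \<omega> \<in> space P \<Longrightarrow> flux_branch (f \<omega>) (N \<omega>) A (B \<omega>) (G \<omega>)"
      "\<And>\<alpha>. \<alpha> \<in> A \<Longrightarrow> AE x in lebesgue. (\<lambda>\<omega>. G \<omega> x \<alpha>) \<in> borel_measurable P" for B G
  proof (intro random_flux.intro random_flux_axioms.intro)
    show "prob_space P" "complete_measure P" "time_strip T" by (fact assms(1,2) strip)+
    show "flux_strip T (f \<omega>) (N \<omega>) A (B \<omega>) (G \<omega>) (u\<^sub>0 \<omega>)" if "\<omega> \<in> space P" for \<omega>
      using strips that \<open>\<And>\<omega>. \<omega> \<in> space P \<Longrightarrow> flux_branch (f \<omega>) (N \<omega>) A (B \<omega>) (G \<omega>)\<close> by blast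
  qed (fact B4 that u0_Lp_L1)+
  have m: "random_flux P T f N A B\<^sub>m f_inv\<^sub>m u\<^sub>0 p"
    using br B5 by (intro random) (auto elim!: eventually_mono)
  have pl: "random_flux P T f N A B\<^sub>p f_inv\<^sub>p u\<^sub>0 p"
    using br B5 by (intro random) (auto elim!: eventually_mono)
  have uE: "u \<omega> \<in> E" if "\<omega> \<in> space P" for \<omega>
    using solution[OF that] by (simp add: unique_adapted_entropy_solution_def adapted_entropy_solution_def)
  obtain C where C: "countable C" "C \<subseteq> E" "\<And>v n e. v \<in> E \<Longrightarrow> e > 0 \<Longrightarrow> \<exists>c\<in>C. dE n v c < e"
    using subset_E_separable[OF subset_refl] by blast
  have uS: "u ` space P \<subseteq> E" using uE by blast
  \<comment> \<open>Separability concerns the image as a subspace, so this dense set is taken inside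
    the image, unlike the ball centres \<open>C\<close>.\<close>
  obtain C' where C': "countable C'" "C' \<subseteq> u ` space P"
    "\<And>v n e. v \<in> u ` space P \<Longrightarrow> e > 0 \<Longrightarrow> \<exists>c\<in>C'. dE n v c < e"
    using subset_E_separable[OF uS] by blast
  show ?thesis
    unfolding strongly_measurable_def solution_topology_eq
  proof
    show "u \<in> P \<rightarrow>\<^sub>M borel_of_topology (pseudometrics_topology E {strip_dist T K |K. compact K})"
    proof (rule measurable_borel_of_topology[OF _ C])
      show "u \<in> space P \<rightarrow> E" using uE by blast
      show "{\<omega> \<in> space P. dE n c (u \<omega>) \<le> r} \<in> sets P" if "c \<in> C" for c n r
        using solution_in_ball_measurable[OF m pl solution] that C(2) by blast
    qed
    show "separable_space (subtopology (pseudometrics_topology E {strip_dist T K |K. compact K}) (u ` space P))"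
      using separable_subtopology[OF uS C'] .
  qed
qed

end
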